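(* Let $(\mathfrak g,\mathcal F_\bullet\mathfrak g,R)$ be a filtered Rota–Baxter Lie algebra over a field $\mathbf k$ of characteristic zero and let $\mathfrak R:\widehat{\mathfrak g}\to\widehat{\mathfrak g}$ be the Rota–Baxter operator on the group $(\widehat{\mathfrak g},* )$ given by $\mathfrak R(x)=\log(\widehat{\mathcal R}(\exp(x)))$. Then $\mathfrak R=\widehat R\circ\Omega$, where $\Omega$ is the post-Lie Magnus expansion and $\widehat R$ is the completion of $R$ (see context).
   Context: A filtered Lie algebra $(\mathfrak g,\mathcal F_\bullet\mathfrak g)$: a Lie algebra with subspaces $\mathfrak g=\mathcal F_1\mathfrak g\supset\mathcal F_2\mathfrak g\supset\cdots$, $[\mathcal F_n\mathfrak g,\mathcal F_m\mathfrak g]\subset\mathcal F_{n+m}\mathfrak g$. A Rota–Baxter operator of weight 1: linear $R$ with $[R(x),R(y)]=R([R(x),y]+[x,R(y)]+[x,y])$; filtered Rota–Baxter Lie algebra: additionally $R(\mathcal F_n\mathfrak g)\subset\mathcal F_n\mathfrak g$ for all $n$. Filtered universal enveloping algebra: $\mathcal F_0U(\mathfrak g)=U(\mathfrak g)$, and for $n\ge1$, $\mathcal F_nU(\mathfrak g)$ is spanned by products $x_1\cdots x_k$ ($k\ge1$, $x_i\in\mathcal F_{n_i}\mathfrak g$, $\sum n_i\ge n$). $\mathcal R:U(\mathfrak g)\to U(\mathfrak g)$ is the well-defined linear map with $\mathcal R(1)=1$, $\mathcal R(x)=R(x)$, $\mathcal R(xh)=R(x)\mathcal R(h)-\mathcal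 R([R(x),h])$ ($x\in\mathfrak g$, $h\in U(\mathfrak g)$); it preserves the filtration and so induces $\widehat{\mathcal R}$ on $\widehat U(\mathfrak g)=\varprojlim U(\mathfrak g)/\mathcal F_nU(\mathfrak g)$. Define $a\star b=a_{(1)}\mathcal R(a_{(2)})\,b\,S(\mathcal R(a_{(3)}))$ on $U(\mathfrak g)$ (Sweedler notation, $S$ the antipode); it is compatible with the filtration and extends to $\widehat U(\mathfrak g)$. $\widehat{\mathfrak g}=\varprojlim\mathfrak g/\mathcal F_{n+1}\mathfrak g$ is regarded as a subspace of $\mathcal F_1\widehat U(\mathfrak g)$ (the kernel of $\widehat U(\mathfrak g)\to U(\mathfrak g)/\mathcal F_1U(\mathfrak g)$). $\mathbb G$ is the group of nonzero group-like elements ($\widehat\Delta(g)=g\hat\otimes g$) of the complete Hopf algebra $\widehat U(\mathfrak g)$. The maps $\exp(x)=\sum_{n\ge0}x^n/n!$ and $\exp_\star(x)=\sum_{n\ge0}x^{\star n}/n!$ (with $x^{\star n}=x\star\cdots\star x$, $n$ factors) are bijections $\widehat{\mathfrak g}\to\mathbb G$; their inverses are $\log$ and $\log_\star$. The group structure on $\widehat{\mathfrak g}$ is $x*y=\log(\exp(x)\exp(y))$, and $\widehat{\mathcal R}(\mathbb G)\subset\mathbb G$. The post-Lie Magnus expansion is $\Omega:\widehat{\mathfrak g}\to\widehat{\mathfrak g}$, $\Omega(x)=\log_\star(\exp(x))$. The completion $\widehat R:\widehat{\mathfrak g}\to\widehat{\mathfrak g}$ acts componentwise by the maps $\mathfrak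 g/\mathcal F_{n+1}\mathfrak g\to\mathfrak g/\mathcal F_{n+1}\mathfrak g$ induced by $R$. *)

theory Defs
  imports Main "HOL-Library.Function_Algebras"
begin

text \<open>Elements of the free associative k-algebra on the set g are finitely supported
  coefficient functions on words (lists of elements of g).  Addition, negation and
  finite sums are the pointwise ones (HOL-Library.Function_Algebras).\<close>

type_synonym ('g, 'k) fa = "'g list \<Rightarrow> 'k"

definition fa_fin :: "('g, 'k::zero) fa set" where
  "fa_fin = {p. finite {w. p w \<noteq> 0}}"

definition fa_word :: "'g list \<Rightarrow> ('g, 'k::{zero,one}) fa" where
  "fa_word w = (\<lambda>v. if v = w then 1 else 0)"

definition fa_one :: "('g, 'k::{zero,one}) fa" where
  "fa_one = fa_word []"

definition fa_gen :: "'g \<Rightarrow> ('g, 'k::{zero,one}) fa" where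
  "fa_gen x = fa_word [x]"

definition fa_mult :: "('g, 'k::semiring_0) fa \<Rightarrow> ('g, 'k) fa \<Rightarrow> ('g, 'k) fa" where
  "fa_mult p q = (\<lambda>w. \<Sum>i\<le>length w. p (take i w) * q (drop i w))"

definition fa_smul :: "'k::times \<Rightarrow> ('g, 'k) fa \<Rightarrow> ('g, 'k) fa" where
  "fa_smul c p = (\<lambda>w. c * p w)"

fun fa_pow :: "('g, 'k::semiring_1) fa \<Rightarrow> nat \<Rightarrow> ('g, 'k) fa" where
  "fa_pow p 0 = fa_one"
| "fa_pow p (Suc n) = fa_mult p (fa_pow p n)"

section \<open>U(g) = free algebra modulo the ideal J, and its filtration\<close>

inductive_set fa_ideal ::
  "('k::comm_ring_1 \<Rightarrow> 'g::ab_group_add \<Rightarrow> 'g) \<Rightarrow> ('g \<Rightarrow> 'g \<Rightarrow> 'g) \<Rightarrow> ('g, 'k) fa set"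
  for smul br where
  gen_add: "fa_gen (x + y) - fa_gen x - fa_gen y \<in> fa_ideal smul br"
| gen_smul: "fa_gen (smul c x) - fa_smul c (fa_gen x) \<in> fa_ideal smul br"
| gen_lie: "fa_mult (fa_gen x) (fa_gen y) - fa_mult (fa_gen y) (fa_gen x) - fa_gen (br x y)
              \<in> fa_ideal smul br"
| zero: "0 \<in> fa_ideal smul br"
| add: "a \<in> fa_ideal smul br \<Longrightarrow> b \<in> fa_ideal smul br \<Longrightarrow> a + b \<in> fa_ideal smul br"
| smul: "a \<in> fa_ideal smul br \<Longrightarrow> fa_smul c a \<in> fa_ideal smul br"
| lmult: "a \<in> fa_ideal smul br \<Longrightarrow> p \<in> fa_fin \<Longrightarrow> fa_mult p a \<in> fa_ideal smul br"
| rmult: "a \<in> fa_ideal smul br \<Longrightarrow> p \<in> fa_fin \<Longrightarrow> fa_mult a p \<in> fa_ideal smul br"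

text \<open>Preimage in the free algebra of F_n U(g): for n = 0 everything; for n \<ge> 1 the
  span of J and of the products x_1 ... x_k (k \<ge> 1, x_i in F_{n_i} g, n_i \<ge> 1,
  sum n_i \<ge> n).  A product is the word [x_1,...,x_k]; the list pairs each x_i with n_i.\<close>

inductive_set fa_filt ::
  "('k::comm_ring_1 \<Rightarrow> 'g::ab_group_add \<Rightarrow> 'g) \<Rightarrow> ('g \<Rightarrow> 'g \<Rightarrow> 'g) \<Rightarrow> (nat \<Rightarrow> 'g set)
     \<Rightarrow> nat \<Rightarrow> ('g, 'k) fa set"
  for smul br F n where
  all0: "n = 0 \<Longrightarrow> p \<in> fa_fin \<Longrightarrow> p \<in> fa_filt smul br F n"
| ideal: "a \<in> fa_ideal smul br \<Longrightarrow> a \<in> fa_filt smul br F n"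
| prod: "xs \<noteq> [] \<Longrightarrow> (\<forall>(x, m) \<in> set xs. 1 \<le> m \<and> x \<in> F m) \<Longrightarrow>
         n \<le> sum_list (map snd xs) \<Longrightarrow> fa_word (map fst xs) \<in> fa_filt smul br F n"
| zero: "0 \<in> fa_filt smul br F n"
| add: "a \<in> fa_filt smul br F n \<Longrightarrow> b \<in> fa_filt smul br F n \<Longrightarrow> a + b \<in> fa_filt smul br F n"
| smul: "a \<in> fa_filt smul br F n \<Longrightarrow> fa_smul c a \<in> fa_filt smul br F n"

text \<open>The class of a in U(g)/F_n U(g), as a set of representatives.\<close>
definition fcoset where
  "fcoset smul br F n a = {b \<in> fa_fin. b - a \<in> fa_filt smul br F n}"

definition Uhat where
  "Uhat smul br F = {c :: nat \<Rightarrow> ('g::ab_group_add, 'k::comm_ring_1) fa set.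
      (\<forall>n. \<exists>a \<in> fa_fin. c n = fcoset smul br F n a) \<and> (\<forall>n. c (Suc n) \<subseteq> c n)}"

definition urep :: "(nat \<Rightarrow> ('g, 'k) fa set) \<Rightarrow> nat \<Rightarrow> ('g, 'k) fa" where
  "urep c n = (SOME a. a \<in> c n)"

text \<open>exp on F_1 of the completion; in degree n the terms j \<ge> n lie in F_n.\<close>
definition uhat_exp where
  "uhat_exp smul br F c = (\<lambda>n. fcoset smul br F n
      (\<Sum>j<n. fa_smul (inverse (fact j)) (fa_pow (urep c n) j)))"

text \<open>On words: \<open>\<R>(1) = 1\<close>, \<open>\<R>(x h) = R(x) \<R>(h) - \<R>([R x, h])\<close>, where the commutator of
  R x with the word h = h_1...h_k is represented by sum_i h_1..[R x,h_i]..h_k.\<close>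

function rbw :: "('g \<Rightarrow> 'g) \<Rightarrow> ('g \<Rightarrow> 'g \<Rightarrow> 'g) \<Rightarrow> 'g list \<Rightarrow> ('g, 'k::comm_ring_1) fa" where
  "rbw R br [] = fa_one"
| "rbw R br (x # w) = fa_mult (fa_gen (R x)) (rbw R br w)
      - (\<Sum>i<length w. rbw R br (w[i := br (R x) (w ! i)]))"
  by pat_completeness auto
termination by (relation "measure (\<lambda>(R, br, w). length w)") auto

definition fa_RB :: "('g \<Rightarrow> 'g) \<Rightarrow> ('g \<Rightarrow> 'g \<Rightarrow> 'g) \<Rightarrow> ('g, 'k::comm_ring_1) fa \<Rightarrow> ('g, 'k) fa" where
  "fa_RB R br p = (\<Sum>w \<in> {w. p w \<noteq> 0}. fa_smul (p w) (rbw R br w))"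

definition uhat_RB where
  "uhat_RB smul br F R c = (\<lambda>n. fcoset smul br F n (fa_RB R br (urep c n)))"

definition fa_S :: "('g, 'k::comm_ring_1) fa \<Rightarrow> ('g, 'k) fa" where
  "fa_S p = (\<lambda>w. (-1) ^ length w * p (rev w))"

text \<open>The iterated coproduct of a word is the sum over all 3-colourings of its letters of
  (letters of colour 0) \<otimes> (colour 1) \<otimes> (colour 2), order preserved.\<close>
definition colourings :: "nat \<Rightarrow> nat list set" where
  "colourings k = {cs. length cs = k \<and> set cs \<subseteq> {0, 1, 2}}"

definition subword :: "'g list \<Rightarrow> nat list \<Rightarrow> nat \<Rightarrow> 'g list" where
  "subword w cs i = map fst (filter (\<lambda>(x, c). c = i) (zip w cs))"

definition star_word where
  "star_word R br w b = (\<Sum>cs \<in> colourings (length w).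
      fa_mult (fa_mult (fa_mult (fa_word (subword w cs 0)) (rbw R br (subword w cs 1))) b)
              (fa_S (rbw R br (subword w cs 2))))"

definition fa_star :: "('g \<Rightarrow> 'g) \<Rightarrow> ('g \<Rightarrow> 'g \<Rightarrow> 'g) \<Rightarrow> ('g, 'k::comm_ring_1) fa \<Rightarrow> ('g, 'k) fa \<Rightarrow> ('g, 'k) fa" where
  "fa_star R br a b = (\<Sum>w \<in> {w. a w \<noteq> 0}. fa_smul (a w) (star_word R br w b))"

fun fa_star_pow where
  "fa_star_pow R br p 0 = fa_one"
| "fa_star_pow R br p (Suc n) = fa_star R br p (fa_star_pow R br p n)"

definition uhat_exp_star where
  "uhat_exp_star smul br F R c = (\<lambda>n. fcoset smul br F n
      (\<Sum>j<n. fa_smul (inverse (fact j)) (fa_star_pow R br (urep c n) j)))"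

definition gcoset :: "(nat \<Rightarrow> 'g::ab_group_add set) \<Rightarrow> nat \<Rightarrow> 'g \<Rightarrow> 'g set" where
  "gcoset F n x = {y. y - x \<in> F (Suc n)}"

definition ghat :: "(nat \<Rightarrow> 'g::ab_group_add set) \<Rightarrow> (nat \<Rightarrow> 'g set) set" where
  "ghat F = {c. (\<forall>n. \<exists>x. c n = gcoset F n x) \<and> (\<forall>n. c (Suc n) \<subseteq> c n)}"

definition grep :: "(nat \<Rightarrow> 'g set) \<Rightarrow> nat \<Rightarrow> 'g" where
  "grep c n = (SOME x. x \<in> c n)"

definition ghat_emb where
  "ghat_emb smul br F c = (\<lambda>n. fcoset smul br F n (fa_gen (grep c n)))"

definition ghat_R :: "(nat \<Rightarrow> 'g::ab_group_add set) \<Rightarrow> ('g \<Rightarrow> 'g) \<Rightarrow> (nat \<Rightarrow> 'g set) \<Rightarrow> (nat \<Rightarrow> 'g set)" where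
  "ghat_R F R c = (\<lambda>n. gcoset F n (R (grep c n)))"

text \<open>log and log_star are the inverses of the bijections exp, exp_star from \<open>\<widehat>g\<close> onto the group
  of group-like elements.\<close>
definition ghat_log where
  "ghat_log smul br F y = (THE z. z \<in> ghat F \<and> uhat_exp smul br F (ghat_emb smul br F z) = y)"

definition ghat_log_star where
  "ghat_log_star smul br F R y =
     (THE z. z \<in> ghat F \<and> uhat_exp_star smul br F R (ghat_emb smul br F z) = y)"

definition magnus where
  "magnus smul br F R x = ghat_log_star smul br F R (uhat_exp smul br F (ghat_emb smul br F x))"

definition frakR where
  "frakR smul br F R x = ghat_log smul br F (uhat_RB smul br F R (uhat_exp smul br F (ghat_emb smul br F x)))"

definition lie_algebra :: "('k::field \<Rightarrow> 'g::ab_group_add \<Rightarrow> 'g) \<Rightarrow> ('g \<Rightarrow> 'g \<Rightarrow> 'g) \<Rightarrow> bool" where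
  "lie_algebra smul br \<longleftrightarrow>
     (\<forall>c x y. smul c (x + y) = smul c x + smul c y) \<and>
     (\<forall>c d x. smul (c + d) x = smul c x + smul d x) \<and>
     (\<forall>c d x. smul (c * d) x = smul c (smul d x)) \<and>
     (\<forall>x. smul 1 x = x) \<and>
     (\<forall>x y z. br (x + y) z = br x z + br y z) \<and>
     (\<forall>x y z. br x (y + z) = br x y + br x z) \<and>
     (\<forall>c x y. br (smul c x) y = smul c (br x y)) \<and>
     (\<forall>c x y. br x (smul c y) = smul c (br x y)) \<and>
     (\<forall>x. br x x = 0) \<and>
     (\<forall>x y z. br x (br y z) + br y (br z x) + br z (br x y) = 0)"

definition lie_filtration :: "('k::field \<Rightarrow> 'g::ab_group_add \<Rightarrow> 'g) \<Rightarrow> ('g \<Rightarrow> 'g \<Rightarrow> 'g) \<Rightarrow> (nat \<Rightarrow> 'g set) \<Rightarrow> bool" where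
  "lie_filtration smul br F \<longleftrightarrow>
     F 1 = UNIV \<and>
     (\<forall>n\<ge>1. F (Suc n) \<subseteq> F n) \<and>
     (\<forall>n\<ge>1. 0 \<in> F n \<and> (\<forall>x\<in>F n. \<forall>y\<in>F n. x + y \<in> F n) \<and> (\<forall>c. \<forall>x\<in>F n. smul c x \<in> F n)) \<and>
     (\<forall>n\<ge>1. \<forall>m\<ge>1. \<forall>x\<in>F n. \<forall>y\<in>F m. br x y \<in> F (n + m))"

definition rota_baxter :: "('k::field \<Rightarrow> 'g::ab_group_add \<Rightarrow> 'g) \<Rightarrow> ('g \<Rightarrow> 'g \<Rightarrow> 'g) \<Rightarrow> ('g \<Rightarrow> 'g) \<Rightarrow> bool" where
  "rota_baxter smul br R \<longleftrightarrow>
     (\<forall>x y. R (x + y) = R x + R y) \<and> (\<forall>c x. R (smul c x) = smul c (R x)) \<and>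
     (\<forall>x y. br (R x) (R y) = R (br (R x) y + br x (R y) + br x y))"

end

theory Submission
  imports Defs "HOL.Modules"
begin

text \<open>
  For z in g one has z \<star> b = z b + [R z, b], so the recursion defining the operator \<R> on U(g)
  says that \<R>(z \<star> b) = R z \<R>(b). Hence \<R> maps the star exponential of z to exp (R z). Applied
  to z = \<Omega>(x), whose star exponential is exp x, this gives \<R>(exp x) = exp (R z), which is the claim.

  What remains is that exp and the star exponential are injective on the completion of g, and that
  exp x is a star exponential. For this, the logarithm phi of the identity of U(g) in the convolution
  algebra of linear maps from the free algebra to g is constructed from its differential equation;
  it vanishes on the relators of U(g) by the Maurer--Cartan equation. As phi respects the
  filtrations and is the identity on g, the filtration of U(g) restricts to that of g. As phi is
  a logarithm, every star exponential is, modulo any step of the filtration, the exponential of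
  an element of g. Both exponentials of z + d are congruent to those of z plus d modulo
  \<open>F (n + 1)\<close> if d is in \<open>F n\<close>; this gives injectivity, and surjectivity by successive approximation.
\<close>

section \<open>The free algebra as a ring\<close>

text \<open>The series for the logarithm of the identity consists of products in U(g), and it would
  remain to prove that its values lie in g. The differential equation involves brackets only, so its
  solution has values in g by construction. It comes from E(x w) = x E(w) for the identity E: if E =
  exp phi, then ((exp (ad phi) - 1) / ad phi) applied to the derivative of phi in the direction x
  must be the constant x, and inverting this power series introduces the Bernoulli coefficients.
  Surjectivity rests on both uses of the logarithm. If the star exponential of z agrees with exp x
  modulo step k, the difference is a priori only an element of the k-th step of U(g), while a
  correction of z must come from g. Once the star exponential is known to be exp c with c in g, the
  correction is x - c, and it lies in F k because the filtration of U(g) restricts to that of g.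
  Everything is computed with representatives in the free algebra, modulo J or a step of the
  filtration. Series in ad phi are finite on each word, since phi vanishes on the empty
  word.\<close>

lemma fa_mult_Nil: "fa_mult p q [] = p [] * q []"
  by (simp add: fa_mult_def)

text \<open>The cut before the first letter is separated from the others. The resulting recursion on
  the word, with the left factor replaced by its derivative \<open>\<lambda>v. p (x # v)\<close>,
  carries associativity and the unit laws.\<close>

lemma fa_mult_Cons:
  "fa_mult p q (x # w) = p [] * q (x # w) + fa_mult (\<lambda>v. p (x # v)) q w"
  by (simp add: fa_mult_def sum.atMost_Suc_shift del: sum.atMost_Suc)

lemma fa_mult_add_left: "fa_mult (p + q) r = fa_mult p r + fa_mult q r"
  by (rule ext) (simp add: fa_mult_def distrib_right sum.distrib)

lemma fa_mult_add_right: "fa_mult p (q + r) = fa_mult p q + fa_mult p r"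
  by (rule ext) (simp add: fa_mult_def distrib_left sum.distrib)

lemma fa_mult_smul_left: "fa_mult (fa_smul c p) (q :: ('g, 'k::comm_ring_1) fa) = fa_smul c (fa_mult p q)"
  by (rule ext) (simp add: fa_mult_def fa_smul_def sum_distrib_left mult_ac)

lemma fa_mult_smul_right: "fa_mult p (fa_smul c q :: ('g, 'k::comm_ring_1) fa) = fa_smul c (fa_mult p q)"
  by (rule ext) (simp add: fa_mult_def fa_smul_def sum_distrib_left mult_ac)

lemma fa_mult_assoc: "fa_mult (fa_mult p q) r = fa_mult p (fa_mult q (r :: ('g, 'k::comm_ring_1) fa))"
proof
  fix w show "fa_mult (fa_mult p q) r w = fa_mult p (fa_mult q r) w"
  proof (induction w arbitrary: p q)
    case Nil
    then show ?case by (simp add: fa_mult_Nil mult.assoc)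
  next
    case (Cons x w)
    have "(\<lambda>v. fa_mult p q (x # v))
        = fa_smul (p []) (\<lambda>v. q (x # v)) + fa_mult (\<lambda>v. p (x # v)) q"
      by (rule ext) (simp add: fa_mult_Cons fa_smul_def)
    then show ?case
      by (simp add: fa_mult_Cons fa_mult_Nil fa_mult_add_left fa_mult_smul_left Cons.IH)
        (simp add: fa_smul_def algebra_simps)
  qed
qed

lemma fa_mult_zero_left: "fa_mult (\<lambda>_. 0) q = (\<lambda>_. 0 :: 'k::comm_ring_1)"
  by (rule ext) (simp add: fa_mult_def)

lemma fa_mult_word:
  "fa_mult (fa_word u) (fa_word v) = (fa_word (u @ v) :: ('g, 'k::comm_ring_1) fa)"
proof
  fix w show "fa_mult (fa_word u) (fa_word v) w = (fa_word (u @ v) w :: 'k)"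
  proof (induction u arbitrary: w)
    case Nil
    have "fa_mult (fa_word []) q w = (q w :: 'k)" for q and w :: "'g list"
      by (cases w) (simp_all add: fa_mult_Nil fa_mult_Cons fa_word_def fa_mult_zero_left)
    then show ?case by simp
  next
    case (Cons x u)
    show ?case
    proof (cases w)
      case Nil then show ?thesis by (simp add: fa_mult_Nil fa_word_def)
    next
      case (Cons y w')
      have "(\<lambda>v. fa_word (x # u) (y # v)) = (if x = y then fa_word u else (\<lambda>_. 0 :: 'k))"
        by (auto simp: fa_word_def)
      then show ?thesis using Cons.IH[of w'] Cons
        by (auto simp: fa_mult_Cons fa_word_def fa_mult_zero_left)
    qed
  qed
qed

lemma fa_mult_one_left: "fa_mult fa_one q = (q :: ('g, 'k::comm_ring_1) fa)"
proof
  fix w show "fa_mult fa_one q w = q w"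
    by (cases w) (simp_all add: fa_mult_Nil fa_mult_Cons fa_one_def fa_word_def fa_mult_zero_left)
qed

lemma fa_mult_one_right: "fa_mult p fa_one = (p :: ('g, 'k::comm_ring_1) fa)"
proof
  fix w show "fa_mult p fa_one w = p w"
  proof (induction w arbitrary: p)
    case Nil then show ?case by (simp add: fa_mult_Nil fa_one_def fa_word_def)
  next
    case (Cons x w)
    then show ?case by (simp add: fa_mult_Cons) (simp add: fa_one_def fa_word_def)
  qed
qed

lemma fa_fin_mult:
  assumes "p \<in> fa_fin" "q \<in> fa_fin"
  shows "fa_mult p q \<in> (fa_fin :: ('g, 'k::comm_ring_1) fa set)"
proof -
  have "{w. fa_mult p q w \<noteq> 0} \<subseteq> (\<lambda>(u, v). u @ v) ` ({u. p u \<noteq> 0} \<times> {v. q v \<noteq> 0})"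
  proof
    fix w assume "w \<in> {w. fa_mult p q w \<noteq> 0}"
    then have "(\<Sum>i\<le>length w. p (take i w) * q (drop i w)) \<noteq> 0" by (simp add: fa_mult_def)
    then obtain i where "p (take i w) * q (drop i w) \<noteq> 0"
      by (meson sum.not_neutral_contains_not_neutral)
    then have "p (take i w) \<noteq> 0" "q (drop i w) \<noteq> 0" by auto
    then show "w \<in> (\<lambda>(u, v). u @ v) ` ({u. p u \<noteq> 0} \<times> {v. q v \<noteq> 0})"
      by (intro image_eqI[of _ _ "(take i w, drop i w)"]) auto
  qed
  then show ?thesis using assms unfolding fa_fin_def
    by (auto intro: finite_subset)
qed

lemma fa_fin_add: "p \<in> fa_fin \<Longrightarrow> q \<in> fa_fin \<Longrightarrow> p + q \<in> (fa_fin :: ('g, 'k::comm_ring_1) fa set)"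
  by (auto simp: fa_fin_def intro!: finite_subset[of "{w. p w + q w \<noteq> 0}" "{w. p w \<noteq> 0} \<union> {w. q w \<noteq> 0}"])

lemma fa_fin_uminus: "p \<in> fa_fin \<Longrightarrow> - p \<in> (fa_fin :: ('g, 'k::comm_ring_1) fa set)"
  by (simp add: fa_fin_def)

lemma fa_fin_smul: "p \<in> fa_fin \<Longrightarrow> fa_smul c p \<in> (fa_fin :: ('g, 'k::comm_ring_1) fa set)"
  unfolding fa_fin_def fa_smul_def
  by (auto elim!: finite_subset[rotated, of "{w. p w \<noteq> 0}"])

lemma fa_fin_word: "fa_word w \<in> fa_fin"
  by (simp add: fa_fin_def fa_word_def)

text \<open>Bundling finite support into a type makes the free algebra an instance of
  \<open>ring_1\<close>, so that powers and ring simplification apply; \<open>coef\<close> leads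
  back to the coefficient functions of the definitions.\<close>

typedef (overloaded) ('g, 'k) falg = "fa_fin :: ('g, 'k::zero) fa set"
  morphisms coef Abs_falg
  by (auto simp: fa_fin_def intro!: exI[of _ "\<lambda>_. 0"])

setup_lifting type_definition_falg

instantiation falg :: (type, comm_ring_1) ring_1
begin

lift_definition zero_falg :: "('a, 'b) falg" is 0 by (simp add: fa_fin_def)
lift_definition one_falg :: "('a, 'b) falg" is fa_one by (simp add: fa_one_def fa_fin_word)
lift_definition plus_falg :: "('a, 'b) falg \<Rightarrow> ('a, 'b) falg \<Rightarrow> ('a, 'b) falg" is "(+)"
  by (rule fa_fin_add)
lift_definition uminus_falg :: "('a, 'b) falg \<Rightarrow> ('a, 'b) falg" is uminus
  by (rule fa_fin_uminus)
lift_definition minus_falg :: "('a, 'b) falg \<Rightarrow> ('a, 'b) falg \<Rightarrow> ('a, 'b) falg" is "(-)"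
  by (metis fa_fin_add fa_fin_uminus add_uminus_conv_diff)
lift_definition times_falg :: "('a, 'b) falg \<Rightarrow> ('a, 'b) falg \<Rightarrow> ('a, 'b) falg" is fa_mult
  by (rule fa_fin_mult)

instance
proof
  show "(0 :: ('a, 'b) falg) \<noteq> 1"
    by transfer (simp add: fa_one_def fa_word_def zero_fun_def fun_eq_iff exI[of _ "[]"])
qed (transfer; simp add: fa_mult_assoc fa_mult_add_left fa_mult_add_right fa_mult_one_left
      fa_mult_one_right add.assoc add.commute)+

end

lift_definition scal :: "'k::comm_ring_1 \<Rightarrow> ('g, 'k) falg \<Rightarrow> ('g, 'k) falg" is fa_smul
  by (rule fa_fin_smul)

lift_definition word :: "'g list \<Rightarrow> ('g, 'k::comm_ring_1) falg" is fa_word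
  by (rule fa_fin_word)

abbreviation gen :: "'g \<Rightarrow> ('g, 'k::comm_ring_1) falg" where
  "gen x \<equiv> word [x]"

lemma word_mult: "word u * word v = word (u @ v)"
  by transfer (rule fa_mult_word)

lemma word_Nil: "word [] = 1"
  by transfer (simp add: fa_one_def)

lemma word_Cons: "word (x # w) = gen x * word w"
  by (simp add: word_mult)

interpretation falg: module scal
  by standard (transfer; auto simp: fa_smul_def algebra_simps fun_eq_iff)+

lemma scal_mult_left: "scal c a * b = scal c (a * b)"
  by transfer (rule fa_mult_smul_left)

lemma scal_mult_right: "a * scal c b = scal c (a * b)"
  by transfer (rule fa_mult_smul_right)

lemma coef_add: "coef (a + b) = coef a + coef b" by transfer simp
lemma coef_diff: "coef (a - b) = coef a - coef b" by transfer simp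
lemma coef_scal: "coef (scal c a) = fa_smul c (coef a)" by transfer simp
lemma coef_mult: "coef (a * b) = fa_mult (coef a) (coef b)" by transfer simp
lemma coef_word: "coef (word w) = fa_word w" by transfer simp
lemma coef_zero: "coef 0 = 0" by transfer simp
lemma coef_one: "coef 1 = fa_one" by transfer simp

lemma coef_sum: "coef (\<Sum>i\<in>A. f i) = (\<Sum>i\<in>A. coef (f i))"
  by (induction A rule: infinite_finite_induct) (simp_all add: coef_zero coef_add)

lemma coef_power: "coef (a ^ n) = fa_pow (coef a) n"
  by (induction n) (simp_all add: coef_one coef_mult)

lemma finite_coef: "finite {w. coef a w \<noteq> 0}"
  using coef[of a] by (simp add: fa_fin_def)

lemma falg_eqI: "(\<And>w. coef a w = coef b w) \<Longrightarrow> a = b"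
  by (simp add: coef_inject[symmetric] fun_eq_iff)

lemma sum_fun_apply: "(\<Sum>i\<in>A. f i) x = (\<Sum>i\<in>A. f i x :: 'b::comm_monoid_add)"
  by (induction A rule: infinite_finite_induct) simp_all

lemma falg_expand: "a = (\<Sum>w | coef a w \<noteq> 0. scal (coef a w) (word w))"
proof (rule falg_eqI)
  fix v
  have "coef (\<Sum>w | coef a w \<noteq> 0. scal (coef a w) (word w)) v
      = (\<Sum>w | coef a w \<noteq> 0. if v = w then coef a w else 0)"
    by (simp add: coef_sum sum_fun_apply fa_smul_def coef_scal coef_word fa_word_def
        mult_ac if_distrib cong: if_cong)
  also have "\<dots> = coef a v" by (simp add: finite_coef)
  finally show "coef a v = coef (\<Sum>w | coef a w \<noteq> 0. scal (coef a w) (word w)) v" by simp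
qed

lemma falg_induct [case_names zero add word]:
  assumes "P 0" "\<And>a b. P a \<Longrightarrow> P b \<Longrightarrow> P (a + b)" "\<And>c w. P (scal c (word w))"
  shows "P a"
proof -
  have "P (\<Sum>w\<in>S. scal (coef a w) (word w))" for S
    by (induction S rule: infinite_finite_induct) (auto intro: assms)
  then show ?thesis by (subst falg_expand)
qed

section \<open>Linear extension of functions on words\<close>

text \<open>The scalar multiplication is an argument because values are taken both in g, for
  \<open>phi\<close>, and in the free algebra, for \<open>rb\<close> and
  \<open>star\<close>.\<close>

definition lin :: "('k::comm_ring_1 \<Rightarrow> 'm \<Rightarrow> 'm::ab_group_add) \<Rightarrow> ('g list \<Rightarrow> 'm) \<Rightarrow> ('g, 'k) falg \<Rightarrow> 'm"
  where "lin s f a = (\<Sum>w | coef a w \<noteq> 0. s (coef a w) (f w))"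

context module
begin

lemma lin_superset:
  assumes "finite S" "{w. coef a w \<noteq> 0} \<subseteq> S"
  shows "lin scale f a = (\<Sum>w\<in>S. coef a w *s f w)"
  unfolding lin_def using assms by (intro sum.mono_neutral_left) auto

lemma lin_add: "lin scale f (a + b) = lin scale f a + lin scale f b"
proof -
  let ?S = "{w. coef a w \<noteq> 0} \<union> {w. coef b w \<noteq> 0}"
  have S: "finite ?S" by (simp add: finite_coef)
  show ?thesis
    by (subst (1 2 3) lin_superset[OF S]) (auto simp: coef_add scale_left_distrib sum.distrib)
qed

lemma lin_scal: "lin scale f (scal c a) = c *s lin scale f a"
  by (subst (1 2) lin_superset[OF finite_coef[of a]])
    (auto simp: coef_scal fa_smul_def scale_sum_right)

lemma lin_zero: "lin scale f 0 = 0"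
  by (simp add: lin_def coef_zero)

lemma lin_word: "lin scale f (word w) = f w"
  by (subst lin_superset[of "{w}"]) (auto simp: coef_word fa_word_def split: if_splits)

lemma lin_diff: "lin scale f (a - b) = lin scale f a - lin scale f b"
  using lin_add[of f "a - b" b] by simp

lemma lin_sum: "lin scale f (\<Sum>i\<in>A. h i) = (\<Sum>i\<in>A. lin scale f (h i))"
  by (induction A rule: infinite_finite_induct) (simp_all add: lin_zero lin_add)

end

section \<open>Congruences\<close>

definition cg :: "'m::ab_group_add set \<Rightarrow> 'm \<Rightarrow> 'm \<Rightarrow> bool" where
  "cg I a b \<longleftrightarrow> a - b \<in> I"

lemma cg_eq_trans [trans]: "cg I a b \<Longrightarrow> b = c \<Longrightarrow> cg I a c"
  and eq_cg_trans [trans]: "a = b \<Longrightarrow> cg I b c \<Longrightarrow> cg I a c"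
  by simp_all

context module
begin

context
  fixes I assumes I: "subspace I"
begin

lemma cg_refl: "cg I a a"
  using I by (simp add: cg_def subspace_0)

lemma cg_sym: "cg I a b \<Longrightarrow> cg I b a"
  using subspace_neg[OF I, of "a - b"] by (simp add: cg_def)

lemma cg_trans: "cg I a b \<Longrightarrow> cg I b c \<Longrightarrow> cg I a c"
  using subspace_add[OF I, of "a - b" "b - c"] by (simp add: cg_def)

lemma cg_add: "cg I a b \<Longrightarrow> cg I c d \<Longrightarrow> cg I (a + c) (b + d)"
  using subspace_add[OF I, of "a - b" "c - d"] by (simp add: cg_def algebra_simps)

lemma cg_diff: "cg I a b \<Longrightarrow> cg I c d \<Longrightarrow> cg I (a - c) (b - d)"
  using subspace_diff[OF I, of "a - b" "c - d"] by (simp add: cg_def algebra_simps)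

lemma cg_scale: "cg I a b \<Longrightarrow> cg I (c *s a) (c *s b)"
  using subspace_scale[OF I, of "a - b" c] by (simp add: cg_def scale_right_diff_distrib)

lemma cg_sum: "(\<And>i. i \<in> A \<Longrightarrow> cg I (f i) (g i)) \<Longrightarrow> cg I (\<Sum>i\<in>A. f i) (\<Sum>i\<in>A. g i)"
  by (induction A rule: infinite_finite_induct) (auto simp: cg_refl intro: cg_add)

lemma cg_add_mem: "b \<in> I \<Longrightarrow> cg I (a + b) a"
  by (simp add: cg_def)

end

end

definition two_sided :: "('g, 'k::comm_ring_1) falg set \<Rightarrow> bool" where
  "two_sided I \<longleftrightarrow> falg.subspace I \<and> (\<forall>a\<in>I. \<forall>b. a * b \<in> I \<and> b * a \<in> I)"

lemma two_sided_subspace: "two_sided I \<Longrightarrow> falg.subspace I"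
  by (simp add: two_sided_def)

lemma two_sided_mult: "two_sided I \<Longrightarrow> a \<in> I \<Longrightarrow> a * b \<in> I" "two_sided I \<Longrightarrow> a \<in> I \<Longrightarrow> b * a \<in> I"
  by (simp_all add: two_sided_def)

lemma cg_mult:
  assumes "two_sided I" "cg I a a'" "cg I b b'"
  shows "cg I (a * b) (a' * b')"
proof -
  have "(a - a') * b + a' * (b - b') \<in> I"
    using assms by (intro falg.subspace_add) (auto simp: two_sided_def cg_def)
  then show ?thesis by (simp add: cg_def algebra_simps)
qed

lemma cg_power: "two_sided I \<Longrightarrow> cg I a b \<Longrightarrow> cg I (a ^ n) (b ^ n)"
  by (induction n) (auto simp: two_sided_subspace falg.cg_refl intro: cg_mult)

section \<open>Convolution of functions on words\<close>

text \<open>Convolution with respect to the unshuffle coproduct of words: as letters are primitive,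
  the operation f \<mapsto> f(x \<sqdot>) is a derivation.\<close>

fun conv :: "('m \<Rightarrow> 'm \<Rightarrow> 'm) \<Rightarrow> ('g list \<Rightarrow> 'm) \<Rightarrow> ('g list \<Rightarrow> 'm) \<Rightarrow> 'g list \<Rightarrow> 'm::ab_group_add" where
  "conv m f h [] = m (f []) (h [])"
| "conv m f h (x # w) = conv m (\<lambda>v. f (x # v)) h w + conv m f (\<lambda>v. h (x # v)) w"

text \<open>The value at \<open>w\<close> involves only subwords of \<open>w\<close>. This locality
  lets an approximation that is correct on short words stand in for its limit.\<close>

lemma conv_cong:
  assumes "\<And>v. length v \<le> length w \<Longrightarrow> f v = f' v" "\<And>v. length v \<le> length w \<Longrightarrow> h v = h' v"
  shows "conv m f h w = conv m f' h' w"
  using assms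
proof (induction w arbitrary: f f' h h')
  case (Cons x w)
  have "conv m (\<lambda>v. f (x # v)) h w = conv m (\<lambda>v. f' (x # v)) h' w"
    "conv m f (\<lambda>v. h (x # v)) w = conv m f' (\<lambda>v. h' (x # v)) w"
    by (intro Cons.IH; simp add: Cons.prems)+
  then show ?case by simp
qed simp

text \<open>The coproduct is multiplicative and letters are primitive, so a letter may be split off
  at the end as well as at the front. Right multiplication in \<open>delta\<close> uses
  this.\<close>

lemma conv_snoc:
  "conv m f h (w @ [y]) = conv m (\<lambda>v. f (v @ [y])) h w + conv m f (\<lambda>v. h (v @ [y])) w"
  by (induction w arbitrary: f h) (simp_all add: algebra_simps)

lemma conv_mem:
  assumes "\<And>a b. a \<in> I \<Longrightarrow> b \<in> I \<Longrightarrow> a + b \<in> I"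
    and "\<And>v v'. length v \<le> length w \<Longrightarrow> length v' \<le> length w \<Longrightarrow> m (f v) (h v') \<in> I"
  shows "conv m f h w \<in> I"
  using assms(2)
proof (induction w arbitrary: f h)
  case (Cons x w)
  have "conv m (\<lambda>v. f (x # v)) h w \<in> I" "conv m f (\<lambda>v. h (x # v)) w \<in> I"
    by (intro Cons.IH Cons.prems; simp)+
  then show ?case by (simp add: assms(1))
qed simp

text \<open>Order of vanishing at the empty word. Convolution adds these orders, so high powers of a
  function with value 0 at \<open>[]\<close> vanish on short words and a power series in it is a
  finite sum on each word.\<close>

definition vanish :: "nat \<Rightarrow> ('g list \<Rightarrow> 'm::zero) \<Rightarrow> bool" where
  "vanish n f \<longleftrightarrow> (\<forall>w. length w < n \<longrightarrow> f w = 0)"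

lemma vanish_0: "vanish 0 f"
  by (simp add: vanish_def)

definition weighted :: "(nat \<Rightarrow> 'g set) \<Rightarrow> 'g list \<Rightarrow> nat list \<Rightarrow> bool" where
  "weighted F w ms \<longleftrightarrow> list_all2 (\<lambda>x m. 1 \<le> m \<and> x \<in> F m) w ms"

lemma weighted_Cons:
  "weighted F (x # w) ms \<longleftrightarrow> (\<exists>m ms'. ms = m # ms' \<and> 1 \<le> m \<and> x \<in> F m \<and> weighted F w ms')"
  by (auto simp: weighted_def list_all2_Cons1)

lemma weighted_Nil: "weighted F [] ms \<longleftrightarrow> ms = []"
  by (simp add: weighted_def)

text \<open>A letter lies in many steps of the filtration, so the degrees are carried by a list
  \<open>ms\<close> chosen along with the word. The offset \<open>k\<close> records the degrees of
  letters already split off, as in \<open>graded_by_Cons\<close>.\<close>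

definition graded_by :: "(nat \<Rightarrow> 'g set) \<Rightarrow> (nat \<Rightarrow> 'm set) \<Rightarrow> nat \<Rightarrow> ('g list \<Rightarrow> 'm) \<Rightarrow> bool" where
  "graded_by F G k f \<longleftrightarrow> (\<forall>w ms. weighted F w ms \<longrightarrow> f w \<in> G (k + sum_list ms))"

lemma graded_byD: "graded_by F G k f \<Longrightarrow> weighted F w ms \<Longrightarrow> f w \<in> G (k + sum_list ms)"
  by (simp add: graded_by_def)

lemma graded_by_Cons:
  assumes "graded_by F G k f" "1 \<le> m" "x \<in> F m"
  shows "graded_by F G (k + m) (\<lambda>v. f (x # v))"
  unfolding graded_by_def
proof (intro allI impI)
  fix w ms assume "weighted F w ms"
  then have "weighted F (x # w) (m # ms)" using assms by (simp add: weighted_Cons)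
  from graded_byD[OF assms(1) this] show "f (x # w) \<in> G (k + m + sum_list ms)"
    by (simp add: add.assoc)
qed

lemma graded_by_conv:
  assumes add: "\<And>n a b. a \<in> G n \<Longrightarrow> b \<in> G n \<Longrightarrow> a + b \<in> G n"
    and mult: "\<And>i j a b. a \<in> G i \<Longrightarrow> b \<in> G j \<Longrightarrow> m a b \<in> G (i + j)"
    and f: "graded_by F G k f" and h: "graded_by F G l h"
  shows "graded_by F G (k + l) (conv m f h)"
proof -
  have "conv m f h w \<in> G (k + l + sum_list ms)" if "weighted F w ms" for w ms
    using that f h
  proof (induction w arbitrary: f h k l ms)
    case Nil
    then have "ms = []" by (simp add: weighted_Nil)
    moreover have "f [] \<in> G k" "h [] \<in> G l"
      using graded_byD[OF Nil.prems(2), of "[]" "[]"] graded_byD[OF Nil.prems(3), of "[]" "[]"]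
      by (simp_all add: weighted_Nil)
    ultimately show ?case using mult by simp
  next
    case (Cons x w)
    then obtain m1 ms' where ms: "ms = m1 # ms'" "1 \<le> m1" "x \<in> F m1" "weighted F w ms'"
      by (auto simp: weighted_Cons)
    have "conv m (\<lambda>v. f (x # v)) h w \<in> G (k + m1 + l + sum_list ms')"
      by (rule Cons.IH[OF ms(4) graded_by_Cons[OF Cons.prems(2) ms(2,3)] Cons.prems(3)])
    moreover have "conv m f (\<lambda>v. h (x # v)) w \<in> G (k + (l + m1) + sum_list ms')"
      by (rule Cons.IH[OF ms(4) Cons.prems(2) graded_by_Cons[OF Cons.prems(3) ms(2,3)]])
    ultimately show ?case using ms by (simp add: add algebra_simps)
  qed
  then show ?thesis by (simp add: graded_by_def)
qed

text \<open>\<open>respecting smul br s I n f\<close>: modulo I, the linear extension of f vanishes on the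
  defining relators of U(g), placed between words of total length at most n.\<close>

definition respecting ::
  "('k \<Rightarrow> 'g::ab_group_add \<Rightarrow> 'g) \<Rightarrow> ('g \<Rightarrow> 'g \<Rightarrow> 'g) \<Rightarrow> ('k \<Rightarrow> 'm::ab_group_add \<Rightarrow> 'm) \<Rightarrow> 'm set \<Rightarrow> nat
    \<Rightarrow> ('g list \<Rightarrow> 'm) \<Rightarrow> bool" where
  "respecting smul br s I n f \<longleftrightarrow> (\<forall>u v. length u + length v \<le> n \<longrightarrow>
     (\<forall>x y. f (u @ (x + y) # v) - f (u @ x # v) - f (u @ y # v) \<in> I) \<and>
     (\<forall>c x. f (u @ smul c x # v) - s c (f (u @ x # v)) \<in> I) \<and>
     (\<forall>x y. f (u @ x # y # v) - f (u @ y # x # v) - f (u @ br x y # v) \<in> I))"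

lemma respectingD:
  assumes "respecting smul br s I n f" "length u + length v \<le> n"
  shows "f (u @ (x + y) # v) - f (u @ x # v) - f (u @ y # v) \<in> I"
    "f (u @ smul c x # v) - s c (f (u @ x # v)) \<in> I"
    "f (u @ x # y # v) - f (u @ y # x # v) - f (u @ br x y # v) \<in> I"
  using assms by (auto simp: respecting_def)

lemma respecting_mono: "respecting smul br s I n f \<Longrightarrow> k \<le> n \<Longrightarrow> respecting smul br s I k f"
  by (auto simp: respecting_def)

lemma respecting_Cons:
  assumes "respecting smul br s I (Suc n) f" shows "respecting smul br s I n (\<lambda>v. f (z # v))"
  unfolding respecting_def
  using respectingD[OF assms, of "z # u" v for u v] by auto

section \<open>Convolution with respect to a bilinear product\<close>

locale bilinear_module = module scale
  for scale :: "'k::comm_ring_1 \<Rightarrow> 'm::ab_group_add \<Rightarrow> 'm" +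
  fixes m :: "'m \<Rightarrow> 'm \<Rightarrow> 'm"
  assumes m_add_left: "m (a + b) c = m a c + m b c"
    and m_add_right: "m a (b + c) = m a b + m a c"
    and m_scale_left: "m (scale k a) b = scale k (m a b)"
    and m_scale_right: "m a (scale k b) = scale k (m a b)"
begin

lemma m_zero_left: "m 0 b = 0"
  using m_add_left[of 0 0 b] by simp

lemma m_zero_right: "m a 0 = 0"
  using m_add_right[of a 0 0] by simp

lemma m_diff_left: "m (a - b) c = m a c - m b c"
  using m_add_left[of "a - b" b c] by simp

lemma m_diff_right: "m a (b - c) = m a b - m a c"
  using m_add_right[of a "b - c" c] by simp

lemma conv_add_left: "conv m (\<lambda>v. f v + g v) h w = conv m f h w + conv m g h w"
  by (induction w arbitrary: f g h) (simp_all add: m_add_left)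

lemma conv_add_right: "conv m f (\<lambda>v. g v + h v) w = conv m f g w + conv m f h w"
  by (induction w arbitrary: f g h) (simp_all add: m_add_right)

lemma conv_diff_left: "conv m (\<lambda>v. f v - g v) h w = conv m f h w - conv m g h w"
  by (induction w arbitrary: f g h) (simp_all add: m_diff_left)

lemma conv_diff_right: "conv m f (\<lambda>v. g v - h v) w = conv m f g w - conv m f h w"
  by (induction w arbitrary: f g h) (simp_all add: m_diff_right)

lemma conv_scale_left: "conv m (\<lambda>v. scale c (f v)) h w = scale c (conv m f h w)"
  by (induction w arbitrary: f h) (simp_all add: m_scale_left scale_right_distrib)

lemma conv_scale_right: "conv m f (\<lambda>v. scale c (h v)) w = scale c (conv m f h w)"
  by (induction w arbitrary: f h) (simp_all add: m_scale_right scale_right_distrib)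

lemma conv_zero_left: "conv m (\<lambda>v. 0) h w = 0"
  by (induction w arbitrary: h) (simp_all add: m_zero_left)

lemma conv_zero_right: "conv m f (\<lambda>v. 0) w = 0"
  by (induction w arbitrary: f) (simp_all add: m_zero_right)

lemma conv_sum_left: "conv m (\<lambda>v. \<Sum>i\<in>A. f i v) h w = (\<Sum>i\<in>A. conv m (f i) h w)"
  by (induction A rule: infinite_finite_induct) (simp_all add: conv_zero_left conv_add_left)

lemma conv_sum_right: "conv m f (\<lambda>v. \<Sum>i\<in>A. h i v) w = (\<Sum>i\<in>A. conv m f (h i) w)"
  by (induction A rule: infinite_finite_induct) (simp_all add: conv_zero_right conv_add_right)

lemma vanish_conv:
  assumes "vanish k f" "vanish l h" shows "vanish (k + l) (conv m f h)"
proof -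
  have "conv m f h w = 0" if "length w < k + l" for w
    using that assms
  proof (induction w arbitrary: f h k l)
    case Nil
    then have "f [] = 0 \<or> h [] = 0" by (cases k) (auto simp: vanish_def)
    then show ?case by (auto simp: m_zero_left m_zero_right)
  next
    case (Cons x w)
    have "vanish (k - 1) (\<lambda>v. f (x # v))" "vanish (l - 1) (\<lambda>v. h (x # v))"
      using Cons.prems by (auto simp: vanish_def)
    moreover have "length w < k - 1 + l" "length w < k + (l - 1)" using Cons.prems by auto
    ultimately show ?case using Cons.IH[of "k - 1" l] Cons.IH[of k "l - 1"] Cons.prems by simp
  qed
  then show ?thesis by (simp add: vanish_def)
qed

definition unit_at :: "'m \<Rightarrow> 'g list \<Rightarrow> 'm" where
  "unit_at a w = (if w = [] then a else 0)"

lemma unit_at_simps [simp]: "unit_at a [] = a" "unit_at a (x # w) = 0"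
  by (simp_all add: unit_at_def)

lemma conv_unit_at: "conv m (unit_at a) h w = m a (h w)"
  by (induction w arbitrary: h) (simp_all add: conv_zero_left)

text \<open>Relators are primitive for the coproduct. Up to the distribution of the surrounding
  words, the convolution on a relator is therefore \<open>f\<close> on the relator times
  \<open>h\<close>, plus \<open>f\<close> times \<open>h\<close> on the relator. The bound
  \<open>n\<close> is preserved, for inductions on it.\<close>

lemma conv_respecting:
  assumes I: "subspace I" and mI: "\<And>a b. a \<in> I \<Longrightarrow> m a b \<in> I" "\<And>a b. b \<in> I \<Longrightarrow> m a b \<in> I"
    and f: "respecting smul br scale I n f" and h: "respecting smul br scale I n h"
  shows "respecting smul br scale I n (conv m f h)"
proof -
  note add = subspace_add[OF I]
  have left: "conv m d e w \<in> I" if "\<And>v. length v \<le> length w \<Longrightarrow> d v \<in> I" for d e w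
    using that by (intro conv_mem add mI(1))
  have right: "conv m d e w \<in> I" if "\<And>v. length v \<le> length w \<Longrightarrow> e v \<in> I" for d e w
    using that by (intro conv_mem add mI(2))
  have "(\<forall>x y. conv m f h (u @ (x + y) # v) - conv m f h (u @ x # v) - conv m f h (u @ y # v) \<in> I) \<and>
     (\<forall>c x. conv m f h (u @ smul c x # v) - scale c (conv m f h (u @ x # v)) \<in> I) \<and>
     (\<forall>x y. conv m f h (u @ x # y # v) - conv m f h (u @ y # x # v) - conv m f h (u @ br x y # v) \<in> I)"
    if "length u + length v \<le> n" for u v
    using that f h
  proof (induction u arbitrary: f h n)
    case Nil
    have "respecting smul br scale I (length v) f" "respecting smul br scale I (length v) h"
      using Nil respecting_mono by auto
    note fD = respectingD[OF this(1), of "[]", simplified] and hD = respectingD[OF this(2), of "[]", simplified]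
    show ?case
    proof (intro conjI allI)
      fix x y
      have "conv m (\<lambda>v. f ((x + y) # v) - f (x # v) - f (y # v)) h v
          + conv m f (\<lambda>v. h ((x + y) # v) - h (x # v) - h (y # v)) v \<in> I"
        by (intro add left right fD(1) hD(1))
      then show "conv m f h ([] @ (x + y) # v) - conv m f h ([] @ x # v) - conv m f h ([] @ y # v) \<in> I"
        by (simp add: conv_diff_left conv_diff_right conv_add_left conv_add_right algebra_simps)
    next
      fix c x
      have "conv m (\<lambda>v. f (smul c x # v) - scale c (f (x # v))) h v
          + conv m f (\<lambda>v. h (smul c x # v) - scale c (h (x # v))) v \<in> I"
        by (intro add left right fD(2) hD(2))
      then show "conv m f h ([] @ smul c x # v) - scale c (conv m f h ([] @ x # v)) \<in> I"
        by (simp add: conv_diff_left conv_diff_right conv_add_left conv_add_right conv_scale_left conv_scale_right algebra_simps)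
    next
      fix x y
      \<comment> \<open>The mixed terms, with \<open>x\<close> in one factor and \<open>y\<close> in
        the other, are symmetric in \<open>x\<close> and \<open>y\<close> and cancel.\<close>
      have "conv m (\<lambda>v. f (x # y # v) - f (y # x # v) - f (br x y # v)) h v
          + conv m f (\<lambda>v. h (x # y # v) - h (y # x # v) - h (br x y # v)) v \<in> I"
        by (intro add left right fD(3) hD(3))
      then show "conv m f h ([] @ x # y # v) - conv m f h ([] @ y # x # v) - conv m f h ([] @ br x y # v) \<in> I"
        by (simp add: conv_diff_left conv_diff_right conv_add_left conv_add_right algebra_simps)
    qed
  next
    case (Cons z u)
    then obtain n' where n': "n = Suc n'" by (cases n) auto
    have *: "length u + length v \<le> n'" using Cons.prems n' by simp
    have f': "respecting smul br scale I n' (\<lambda>v. f (z # v))" "respecting smul br scale I n' f"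
      using Cons.prems(2) respecting_Cons respecting_mono[of smul br scale I n f n'] by (auto simp: n')
    have h': "respecting smul br scale I n' (\<lambda>v. h (z # v))" "respecting smul br scale I n' h"
      using Cons.prems(3) respecting_Cons respecting_mono[of smul br scale I n h n'] by (auto simp: n')
    note 1 = Cons.IH[OF * f'(1) h'(2)] and 2 = Cons.IH[OF * f'(2) h'(1)]
    show ?case
    proof (intro conjI allI)
      fix x y
      show "conv m f h ((z # u) @ (x + y) # v) - conv m f h ((z # u) @ x # v) - conv m f h ((z # u) @ y # v) \<in> I"
        using add[OF 1[THEN conjunct1, rule_format, of x y] 2[THEN conjunct1, rule_format, of x y]]
        by (simp add: algebra_simps)
    next
      fix c x
      show "conv m f h ((z # u) @ smul c x # v) - scale c (conv m f h ((z # u) @ x # v)) \<in> I"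
        using add[OF 1[THEN conjunct2, THEN conjunct1, rule_format, of c x]
            2[THEN conjunct2, THEN conjunct1, rule_format, of c x]]
        by (simp add: algebra_simps)
    next
      fix x y
      show "conv m f h ((z # u) @ x # y # v) - conv m f h ((z # u) @ y # x # v) - conv m f h ((z # u) @ br x y # v) \<in> I"
        using add[OF 1[THEN conjunct2, THEN conjunct2, rule_format, of x y]
            2[THEN conjunct2, THEN conjunct2, rule_format, of x y]]
        by (simp add: algebra_simps)
    qed
  qed
  then show ?thesis by (simp add: respecting_def)
qed

end

interpretation falg: bilinear_module scal "(*)"
  by standard (simp_all add: algebra_simps scal_mult_left scal_mult_right)

lemma conv_assoc:
  "conv (*) (conv (*) f g) h w = conv (*) f (conv (*) g h) (w :: 'g list)"
  for f :: "'g list \<Rightarrow> 'a::ring"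
proof (induction w arbitrary: f g h)
  case (Cons x w)
  have dist_l: "conv (*) (\<lambda>v. p v + q v) r w = conv (*) p r w + conv (*) q r w"
    for p q r :: "'g list \<Rightarrow> 'a" and w
    by (induction w arbitrary: p q r) (simp_all add: algebra_simps)
  have dist_r: "conv (*) r (\<lambda>v. p v + q v) w = conv (*) r p w + conv (*) r q w"
    for p q r :: "'g list \<Rightarrow> 'a" and w
    by (induction w arbitrary: p q r) (simp_all add: algebra_simps)
  show ?case by (simp add: dist_l dist_r Cons.IH add.assoc)
qed (simp add: mult.assoc)

section \<open>The ideal of U(g) and its filtration\<close>

locale lie_alg =
  fixes smul :: "'k::field_char_0 \<Rightarrow> 'g::ab_group_add \<Rightarrow> 'g" and br :: "'g \<Rightarrow> 'g \<Rightarrow> 'g"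
  assumes lie: "lie_algebra smul br"

sublocale lie_alg \<subseteq> g: bilinear_module smul br
  using lie by unfold_locales (simp_all add: lie_algebra_def)

context lie_alg
begin

lemma br_self: "br x x = 0"
  using lie by (simp add: lie_algebra_def)

lemma br_swap: "br x y = - br y x"
proof -
  have "br x x + br x y + (br y x + br y y) = 0"
    using br_self[of "x + y"] by (simp add: g.m_add_left g.m_add_right algebra_simps)
  then show ?thesis by (simp add: br_self eq_neg_iff_add_eq_0)
qed

lemma jacobi: "br x (br y z) + br y (br z x) + br z (br x y) = 0"
  using lie by (simp add: lie_algebra_def)

lemma jacobi_derivation: "br x (br y z) = br (br x y) z + br y (br x z)"
proof -
  have "br y (br z x) = - br y (br x z)"
    by (subst br_swap[of z x]) (metis g.m_diff_right g.m_zero_right diff_0)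
  then show ?thesis using jacobi[of x y z] br_swap[of z "br x y"] by (simp add: algebra_simps)
qed

lemma coef_gen: "coef (gen x) = fa_gen x"
  by (simp add: coef_word fa_gen_def)

lemma fa_ideal_fin: "p \<in> fa_ideal smul br \<Longrightarrow> p \<in> fa_fin"
proof (induction rule: fa_ideal.induct)
  case (gen_add x y) then show ?case using coef[of "gen (x + y) - gen x - gen y"] by (simp add: coef_diff coef_gen fun_diff_def)
next
  case (gen_smul c x) then show ?case using coef[of "gen (smul c x) - scal c (gen x)"] by (simp add: coef_diff coef_scal coef_gen fun_diff_def)
next
  case (gen_lie x y) then show ?case using coef[of "gen x * gen y - gen y * gen x - gen (br x y)"] by (simp add: coef_diff coef_mult coef_gen fun_diff_def)
next
  case zero then show ?case by (simp add: fa_fin_def)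
qed (simp_all add: fa_fin_add[unfolded plus_fun_def] fa_fin_smul fa_fin_mult)

definition J :: "('g, 'k) falg set" where
  "J = {a. coef a \<in> fa_ideal smul br}"

lemma J_two_sided: "two_sided J"
  unfolding two_sided_def falg.subspace_def J_def
  by (auto simp: coef_zero coef_add coef_scal coef_mult
      intro: fa_ideal.intros[unfolded zero_fun_def[symmetric]] coef)

lemmas J_subspace = two_sided_subspace[OF J_two_sided]

lemma J_gen_add: "gen (x + y) - gen x - gen y \<in> J"
  by (simp add: J_def coef_diff coef_gen fa_ideal.gen_add)

lemma J_gen_smul: "gen (smul c x) - scal c (gen x) \<in> J"
  by (simp add: J_def coef_diff coef_gen coef_scal fa_ideal.gen_smul)

lemma J_gen_lie: "gen x * gen y - gen y * gen x - gen (br x y) \<in> J"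
  by (simp add: J_def coef_diff coef_gen coef_mult fa_ideal.gen_lie del: word_mult)

text \<open>A linear map that kills the generators of a two-sided ideal between arbitrary words
  kills the ideal. The induction carries the two words along, which makes it stable under
  multiplication on either side.\<close>

lemma J_lin:
  assumes s: "module s" and I: "module.subspace s I"
    and f: "\<And>n. respecting smul br s I n f" and a: "a \<in> J"
  shows "lin s f a \<in> I"
proof -
  interpret M: module s by fact
  note lin = M.lin_add M.lin_diff M.lin_scal M.lin_word M.lin_zero
  have "\<exists>a. coef a = p \<and> (\<forall>u v. lin s f (word u * a * word v) \<in> I)" if "p \<in> fa_ideal smul br" for p
    using that
  proof induction
    case (gen_add x y)
    have "lin s f (word u * (gen (x + y) - gen x - gen y) * word v) \<in> I" for u v
      using respectingD(1)[OF f order.refl] by (simp add: left_diff_distrib right_diff_distrib word_mult lin)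
    then show ?case
      by (intro exI[of _ "gen (x + y) - gen x - gen y"]) (simp add: coef_diff coef_gen)
  next
    case (gen_smul c x)
    have "lin s f (word u * (gen (smul c x) - scal c (gen x)) * word v) \<in> I" for u v
      using respectingD(2)[OF f order.refl]
      by (simp add: left_diff_distrib right_diff_distrib scal_mult_left scal_mult_right word_mult lin)
    then show ?case
      by (intro exI[of _ "gen (smul c x) - scal c (gen x)"]) (simp add: coef_diff coef_scal coef_gen)
  next
    case (gen_lie x y)
    have "lin s f (word u * (gen x * gen y - gen y * gen x - gen (br x y)) * word v) \<in> I" for u v
      using respectingD(3)[OF f order.refl] by (simp add: left_diff_distrib right_diff_distrib word_mult lin)
    then show ?case
      by (intro exI[of _ "gen x * gen y - gen y * gen x - gen (br x y)"])
        (simp add: coef_diff coef_mult coef_gen)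
  next
    case zero
    show ?case by (intro exI[of _ 0]) (simp add: coef_zero zero_fun_def lin M.subspace_0[OF I])
  next
    case (add a b)
    then obtain a' b' where "coef a' = a" "coef b' = b"
      "\<forall>u v. lin s f (word u * a' * word v) \<in> I" "\<forall>u v. lin s f (word u * b' * word v) \<in> I" by blast
    then show ?case
      by (intro exI[of _ "a' + b'"]) (auto simp: coef_add algebra_simps lin M.subspace_add[OF I])
  next
    case (smul a c)
    then obtain a' where "coef a' = a" "\<forall>u v. lin s f (word u * a' * word v) \<in> I" by blast
    then show ?case
      by (intro exI[of _ "scal c a'"])
        (auto simp: coef_scal scal_mult_left scal_mult_right lin M.subspace_scale[OF I])
  next
    case (lmult a p)
    then obtain a' where a': "coef a' = a" "\<forall>u v. lin s f (word u * a' * word v) \<in> I" by blast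
    obtain b where b: "coef b = p" using lmult Abs_falg_inverse by blast
    have "lin s f (word u * (b * a') * word v) \<in> I" for u v
    proof (induction b rule: falg_induct)
      case (word c w)
      have "word u * (scal c (word w) * a') * word v = scal c (word (u @ w) * a' * word v)"
        by (simp add: word_mult[symmetric] scal_mult_left scal_mult_right mult.assoc)
      then show ?case using a' by (simp add: lin M.subspace_scale[OF I])
    qed (simp_all add: lin algebra_simps M.subspace_add[OF I] M.subspace_0[OF I])
    then show ?case using a' b by (intro exI[of _ "b * a'"]) (simp add: coef_mult)
  next
    case (rmult a p)
    then obtain a' where a': "coef a' = a" "\<forall>u v. lin s f (word u * a' * word v) \<in> I" by blast
    obtain b where b: "coef b = p" using rmult Abs_falg_inverse by blast
    have "lin s f (word u * (a' * b) * word v) \<in> I" for u v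
    proof (induction b rule: falg_induct)
      case (word c w)
      have "word u * (a' * scal c (word w)) * word v = scal c (word u * a' * word (w @ v))"
        by (simp add: word_mult[symmetric] scal_mult_left scal_mult_right mult.assoc)
      then show ?case using a' by (simp add: lin M.subspace_scale[OF I])
    qed (simp_all add: lin algebra_simps M.subspace_add[OF I] M.subspace_0[OF I])
    then show ?case using a' b by (intro exI[of _ "a' * b"]) (simp add: coef_mult)
  qed
  then obtain a' where "coef a' = coef a" "\<forall>u v. lin s f (word u * a' * word v) \<in> I"
    using a unfolding J_def by blast
  then have "lin s f (word [] * a * word []) \<in> I" by (metis coef_inject)
  then show ?thesis by (simp add: word_Nil)
qed

end

section \<open>The filtration of U(g), lifted to the free algebra\<close>

locale filtered_lie = lie_alg smul br
  for smul :: "'k::field_char_0 \<Rightarrow> 'g::ab_group_add \<Rightarrow> 'g" and br :: "'g \<Rightarrow> 'g \<Rightarrow> 'g" +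
  fixes F :: "nat \<Rightarrow> 'g set"
  assumes filtration: "lie_filtration smul br F"
begin

lemma F_1: "x \<in> F (Suc 0)"
  using filtration by (simp add: lie_filtration_def)

lemma F_subspace: "1 \<le> n \<Longrightarrow> g.subspace (F n)"
  using filtration by (simp add: lie_filtration_def g.subspace_def)

lemma F_Suc: "1 \<le> n \<Longrightarrow> x \<in> F (Suc n) \<Longrightarrow> x \<in> F n"
  using filtration by (auto simp: lie_filtration_def)

lemma F_br: "1 \<le> i \<Longrightarrow> 1 \<le> j \<Longrightarrow> x \<in> F i \<Longrightarrow> y \<in> F j \<Longrightarrow> br x y \<in> F (i + j)"
  using filtration by (simp add: lie_filtration_def)

lemma F_mono: "1 \<le> i \<Longrightarrow> i \<le> j \<Longrightarrow> x \<in> F j \<Longrightarrow> x \<in> F i"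
  by (rotate_tac 1, induction j rule: dec_induct) (simp, metis F_Suc le_trans)

definition Fil :: "nat \<Rightarrow> ('g, 'k) falg set" where
  "Fil n = {a. coef a \<in> fa_filt smul br F n}"

lemma J_Fil: "a \<in> J \<Longrightarrow> a \<in> Fil n"
  by (simp add: J_def Fil_def fa_filt.ideal)

lemma Fil_subspace: "falg.subspace (Fil n)"
  unfolding falg.subspace_def Fil_def
  by (auto simp: coef_zero coef_add coef_scal
      intro: fa_filt.zero[unfolded zero_fun_def[symmetric]] fa_filt.add fa_filt.smul)

lemma Fil_0: "a \<in> Fil 0"
  by (simp add: Fil_def fa_filt.all0 coef)

lemma Fil_word:
  assumes "weighted F w ms" "n \<le> sum_list ms" shows "word w \<in> Fil n"
proof (cases "w = []")
  \<comment> \<open>Products generating the filtration have at least one factor. The empty word has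
    total degree 0, and step 0 is everything.\<close>
  case True
  then show ?thesis using assms Fil_0 by (auto simp: weighted_Nil)
next
  case False
  have len: "length w = length ms" using assms by (auto simp: weighted_def list_all2_lengthD)
  have "fa_word (map fst (zip w ms)) \<in> fa_filt smul br F n"
    using assms False len
    by (intro fa_filt.prod) (auto simp: weighted_def list_all2_iff split: prod.splits)
  then show ?thesis using len by (simp add: Fil_def coef_word)
qed

lemma weighted_ones: "weighted F w (replicate (length w) 1)"
  by (induction w) (auto simp: weighted_Cons weighted_Nil F_1)

text \<open>Step 0 is absorbed in the case of words: every letter lies in \<open>F 1\<close>, so any
  word counts with all degrees equal to 1.\<close>

lemma Fil_induct [consumes 1, case_names J word zero add scal]:
  assumes a: "a \<in> Fil n"
    and J: "\<And>a. a \<in> J \<Longrightarrow> P a"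
    and word: "\<And>w ms. weighted F w ms \<Longrightarrow> n \<le> sum_list ms \<Longrightarrow> P (word w)"
    and zero: "P 0" and add: "\<And>a b. P a \<Longrightarrow> P b \<Longrightarrow> P (a + b)"
    and scal: "\<And>c a. P a \<Longrightarrow> P (scal c a)"
  shows "P a"
proof -
  have "\<exists>a. coef a = p \<and> P a" if "p \<in> fa_filt smul br F n" for p
    using that
  proof induction
    case (all0 p)
    obtain b where b: "coef b = p" using all0 Abs_falg_inverse by blast
    have "P b"
    proof (induction b rule: falg_induct)
      case (word c w)
      show ?case by (intro scal assms(3)[OF weighted_ones]) (simp add: all0(1))
    qed (use zero add in auto)
    then show ?case using b by blast
  next
    case (ideal a)
    then have "Abs_falg a \<in> J" "coef (Abs_falg a) = a"
    proof -
      have "a \<in> fa_fin" using ideal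
        by (rule fa_ideal_fin)
      then show "coef (Abs_falg a) = a" by (rule Abs_falg_inverse)
      then show "Abs_falg a \<in> J" using ideal by (simp add: J_def)
    qed
    then show ?case using J by blast
  next
    case (prod xs)
    have "weighted F (map fst xs) (map snd xs)"
      using prod by (auto simp: weighted_def list_all2_iff zip_map_fst_snd split: prod.splits)
    then show ?case using prod(3) word by (intro exI[of _ "word (map fst xs)"]) (auto simp: coef_word)
  next
    case zero
    then show ?case using assms(4) by (intro exI[of _ 0]) (simp add: coef_zero zero_fun_def)
  next
    case (add a b)
    then show ?case using assms(5) by (metis coef_add)
  next
    case (smul a c)
    then show ?case using assms(6) by (metis coef_scal)
  qed
  then show ?thesis using a unfolding Fil_def by (metis coef_inject mem_Collect_eq)
qed

lemma Fil_lin: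
  assumes s: "module s" and I: "module.subspace s I"
    and J: "\<And>a. a \<in> J \<Longrightarrow> lin s f a \<in> I"
    and f: "\<And>w ms. weighted F w ms \<Longrightarrow> n \<le> sum_list ms \<Longrightarrow> f w \<in> I"
    and a: "a \<in> Fil n"
  shows "lin s f a \<in> I"
proof -
  interpret M: module s by fact
  show ?thesis using a
    by (induction rule: Fil_induct)
      (auto simp: J f M.lin_add M.lin_scal M.lin_word M.lin_zero M.subspace_add[OF I]
        M.subspace_scale[OF I] M.subspace_0[OF I])
qed

lemma Fil_mult:
  assumes "a \<in> Fil i" "b \<in> Fil j" shows "a * b \<in> Fil (i + j)"
proof -
  note sub = Fil_subspace[of "i + j"]
  note closed = falg.subspace_add[OF sub] falg.subspace_scale[OF sub] falg.subspace_0[OF sub]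
  note J_mult = two_sided_mult[OF J_two_sided]
  show ?thesis using assms(1)
  proof (induction rule: Fil_induct)
    case (word w ms)
    show ?case using assms(2)
    proof (induction rule: Fil_induct)
      case (word w' ms')
      have "weighted F (w @ w') (ms @ ms')"
        using \<open>weighted F w ms\<close> word(1) by (simp add: weighted_def list_all2_appendI)
      then show ?case unfolding word_mult
        by (rule Fil_word) (use \<open>i \<le> sum_list ms\<close> word(2) in simp)
    qed (auto simp: algebra_simps scal_mult_right closed J_Fil J_mult)
  qed (auto simp: algebra_simps scal_mult_left closed J_Fil J_mult)
qed

lemma Fil_mono: assumes "i \<le> j" "a \<in> Fil j" shows "a \<in> Fil i"
  using assms(2)
proof (induction rule: Fil_induct)
  case (word w ms)
  then show ?case using assms(1) by (intro Fil_word) auto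
qed (use falg.subspace_0[OF Fil_subspace] falg.subspace_add[OF Fil_subspace]
    falg.subspace_scale[OF Fil_subspace] J_Fil in auto)

lemma Fil_two_sided: "two_sided (Fil n)"
  unfolding two_sided_def using Fil_subspace Fil_mult[OF _ Fil_0] Fil_mult[OF Fil_0] by simp

lemma Fil_gen: "1 \<le> n \<Longrightarrow> x \<in> F n \<Longrightarrow> gen x \<in> Fil n"
  using Fil_word[of "[x]" "[n]" n] by (simp add: weighted_Cons weighted_Nil)

end

text \<open>Truncated Cauchy product: when the corner of the square beyond total degree
  \<open>N\<close> vanishes, the triangle remains, summed along antidiagonals.\<close>

lemma sum_triangle:
  fixes g :: "nat \<Rightarrow> nat \<Rightarrow> 'a::comm_monoid_add"
  assumes "\<And>i j. i \<le> N \<Longrightarrow> j \<le> N \<Longrightarrow> N < i + j \<Longrightarrow> g i j = 0"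
  shows "(\<Sum>i\<le>N. \<Sum>j\<le>N. g i j) = (\<Sum>n\<le>N. \<Sum>i\<le>n. g i (n - i))"
proof -
  have "(\<Sum>i\<le>N. \<Sum>j\<le>N. g i j) = (\<Sum>(i, j)\<in>{..N} \<times> {..N}. g i j)"
    by (simp add: sum.cartesian_product)
  also have "\<dots> = (\<Sum>(i, j)\<in>{(i, j). i + j \<le> N}. g i j)"
    by (rule sum.mono_neutral_right) (auto, meson assms not_le)
  also have "\<dots> = (\<Sum>n\<le>N. \<Sum>i\<le>n. g i (n - i))"
    by (rule sum.triangle_reindex_eq)
  finally show ?thesis .
qed

section \<open>The logarithm of the identity of U(g)\<close>

text \<open>The Taylor coefficients of z / (e^z - 1).\<close>

fun bern :: "nat \<Rightarrow> 'k::field_char_0" where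
  "bern n = (if n = 0 then 1 else - (\<Sum>j<n. bern j * inverse (fact (Suc (n - j)))))"

declare bern.simps [simp del]

lemma bern_0 [simp]: "bern 0 = 1"
  by (simp add: bern.simps)

text \<open>The Cauchy product of (e^z - 1) / z and z / (e^z - 1) is 1; the recursion for
  \<open>bern\<close> is this identity solved for its last term.\<close>

lemma bern_inverse:
  "(\<Sum>i\<le>n. inverse (fact (Suc i)) * bern (n - i)) = (if n = 0 then 1 else 0 :: 'k::field_char_0)"
proof -
  have "(\<Sum>i\<le>n. inverse (fact (Suc i)) * bern (n - i))
      = (\<Sum>j\<le>n. inverse (fact (Suc (n - j))) * bern j :: 'k)"
    by (rule sum.reindex_bij_witness[of _ "\<lambda>j. n - j" "\<lambda>j. n - j"]) auto
  also have "\<dots> = (\<Sum>j<n. inverse (fact (Suc (n - j))) * bern j) + bern n"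
    by (simp add: lessThan_Suc_atMost[symmetric])
  also have "\<dots> = (if n = 0 then 1 else 0)"
    by (subst (2) bern.simps) (simp add: mult.commute)
  finally show ?thesis .
qed

context lie_alg
begin

text \<open>The equation for \<open>phi\<close> at \<open>x # v\<close> uses \<open>phi\<close>
  inside iterated convolutions, on words no longer than \<open>v\<close>. Indexing approximations by
  a number gives a primitive recursion whose stage \<open>n\<close> is final on words of length at
  most \<open>n\<close>.\<close>

primrec phis :: "nat \<Rightarrow> 'g list \<Rightarrow> 'g" where
  "phis 0 = (\<lambda>_. 0)"
| "phis (Suc n) = (\<lambda>w. case w of [] \<Rightarrow> 0 | x # v \<Rightarrow>
     \<Sum>j\<le>length v. smul (bern j) ((conv br (phis n) ^^ j) (g.unit_at x) v))"

text \<open>\<open>phi\<close> is the logarithm of the identity of U(g) for the convolution product (the first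
  Eulerian idempotent), with values in g. It is given by its differential equation
  \<open>phi (x \<sqdot>) = (ad phi / (exp (ad phi) - 1)) x\<close>, so that no basis of g is needed.\<close>

definition phi :: "'g list \<Rightarrow> 'g" where
  "phi w = phis (length w) w"

abbreviation ad :: "('g list \<Rightarrow> 'g) \<Rightarrow> 'g list \<Rightarrow> 'g" where
  "ad \<equiv> conv br phi"

lemma conv_funpow_cong:
  assumes "\<And>v. length v \<le> n \<Longrightarrow> f v = f' v" "\<And>v. length v \<le> n \<Longrightarrow> h v = h' v" "length w \<le> n"
  shows "(conv br f ^^ j) h w = (conv br f' ^^ j) h' w"
  using assms(3) by (induction j arbitrary: w) (auto intro!: conv_cong simp: assms(1,2))

lemma phis_stable: "length w \<le> n \<Longrightarrow> length w \<le> m \<Longrightarrow> phis n w = phis m w"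
proof (induction n arbitrary: w m)
  case 0
  then show ?case by (cases m) auto
next
  case (Suc n)
  show ?case
  proof (cases w)
    case Nil
    then show ?thesis by (cases m) auto
  next
    case (Cons x v)
    then obtain m' where m': "m = Suc m'" using Suc.prems by (cases m) auto
    have "(conv br (phis n) ^^ j) (g.unit_at x) v = (conv br (phis m') ^^ j) (g.unit_at x) v" for j
      using Suc.prems m' Cons by (intro conv_funpow_cong[of "length v"] Suc.IH) auto
    then show ?thesis by (simp add: Cons m')
  qed
qed

lemma phi_Nil: "phi [] = 0"
  by (simp add: phi_def)

lemma vanish_ad: assumes "vanish k f" shows "vanish (k + j) ((ad ^^ j) f)"
proof (induction j)
  case (Suc j)
  have "vanish 1 phi" by (simp add: vanish_def phi_Nil)
  from g.vanish_conv[OF this Suc] show ?case by simp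
qed (simp add: assms)

lemma ad_eq_0: "length w < j \<Longrightarrow> (ad ^^ j) f w = 0"
  using vanish_ad[OF vanish_0, of j f] by (simp add: vanish_def)

text \<open>Terms with \<open>j\<close> above the length vanish, so any larger \<open>N\<close> will
  do; a common \<open>N\<close> lets words of different lengths be compared term by term.\<close>

lemma phi_Cons:
  assumes "length w \<le> N"
  shows "phi (x # w) = (\<Sum>j\<le>N. smul (bern j) ((ad ^^ j) (g.unit_at x) w))"
proof -
  have "(conv br (phis (length w)) ^^ j) (g.unit_at x) w = (ad ^^ j) (g.unit_at x) w" for j
    by (rule conv_funpow_cong[of "length w"]) (auto simp: phi_def intro: phis_stable)
  then have "phi (x # w) = (\<Sum>j\<le>length w. smul (bern j) ((ad ^^ j) (g.unit_at x) w))"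
    by (simp add: phi_def)
  also have "\<dots> = (\<Sum>j\<le>N. smul (bern j) ((ad ^^ j) (g.unit_at x) w))"
    using assms by (intro sum.mono_neutral_left) (auto simp: ad_eq_0)
  finally show ?thesis .
qed

lemma phi_single: "phi [x] = x"
  by (simp add: phi_Cons[of "[]" 0])

lemma ad_diff: "(ad ^^ j) (\<lambda>v. f v - h v) = (\<lambda>v. (ad ^^ j) f v - (ad ^^ j) h v)"
proof (induction j)
  case (Suc j)
  show ?case by (rule ext) (simp add: Suc g.conv_diff_right)
qed simp

lemma ad_scale: "(ad ^^ j) (\<lambda>v. smul c (f v)) = (\<lambda>v. smul c ((ad ^^ j) f v))"
proof (induction j)
  case (Suc j)
  show ?case by (rule ext) (simp add: Suc g.conv_scale_right)
qed simp

lemma ad_sum: "(ad ^^ j) (\<lambda>v. \<Sum>i\<in>A. f i v) = (\<lambda>v. \<Sum>i\<in>A. (ad ^^ j) (f i) v)"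
proof (induction j)
  case (Suc j)
  show ?case by (rule ext) (simp add: Suc g.conv_sum_right)
qed simp

text \<open>The operator (exp (ad phi) - 1) / ad phi, which turns a derivative of \<open>phi\<close>
  into the logarithmic derivative of its exponential. The sum stops where the terms vanish.\<close>

definition Psi :: "('g list \<Rightarrow> 'g) \<Rightarrow> 'g list \<Rightarrow> 'g" where
  "Psi f w = (\<Sum>i\<le>length w. smul (inverse (fact (Suc i))) ((ad ^^ i) f w))"

lemma Psi_eq:
  "length w \<le> N \<Longrightarrow> Psi f w = (\<Sum>i\<le>N. smul (inverse (fact (Suc i))) ((ad ^^ i) f w))"
  unfolding Psi_def by (intro sum.mono_neutral_left) (auto simp: ad_eq_0)

lemma Psi_diff: "Psi (\<lambda>v. f v - h v) w = Psi f w - Psi h w"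
  by (simp add: Psi_def ad_diff g.scale_right_diff_distrib sum_subtractf)

lemma Psi_scale: "Psi (\<lambda>v. smul c (f v)) w = smul c (Psi f w)"
  by (simp add: Psi_def ad_scale g.scale_sum_right mult.commute)

text \<open>The power series of \<open>Psi\<close> and of \<open>bern\<close> are inverse to each
  other, so the defining equation says that the logarithmic derivative of exp phi in the direction
  \<open>x\<close> is the constant \<open>x\<close>.\<close>

lemma Psi_phi: "Psi (\<lambda>v. phi (x # v)) w = g.unit_at x w"
proof -
  let ?N = "length w" and ?u = "g.unit_at x :: 'g list \<Rightarrow> 'g"
  have "Psi (\<lambda>v. phi (x # v)) w
      = (\<Sum>i\<le>?N. smul (inverse (fact (Suc i)))
          ((ad ^^ i) (\<lambda>v. \<Sum>j\<le>?N. smul (bern j) ((ad ^^ j) ?u v)) w))"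
    unfolding Psi_def
    by (intro sum.cong refl arg_cong[where f = "smul _"] conv_funpow_cong[of ?N]) (auto simp: phi_Cons)
  also have "\<dots> = (\<Sum>i\<le>?N. \<Sum>j\<le>?N. smul (inverse (fact (Suc i)) * bern j) ((ad ^^ (i + j)) ?u w))"
    by (simp add: ad_sum ad_scale g.scale_sum_right funpow_add)
  also have "\<dots> = (\<Sum>n\<le>?N. \<Sum>i\<le>n. smul (inverse (fact (Suc i)) * bern (n - i)) ((ad ^^ (i + (n - i))) ?u w))"
    by (rule sum_triangle) (simp add: ad_eq_0)
  also have "\<dots> = (\<Sum>n\<le>?N. smul (if n = 0 then 1 else 0) ((ad ^^ n) ?u w))"
    by (intro sum.cong refl) (simp add: g.scale_sum_left[symmetric] bern_inverse del: fact_Suc)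
  also have "\<dots> = (\<Sum>n\<le>?N. if n = 0 then ?u w else 0)"
    by (intro sum.cong refl) auto
  also have "\<dots> = ?u w" by simp
  finally show ?thesis .
qed

text \<open>\<open>Psi\<close> is the identity plus terms that raise the order of vanishing, so the
  lowest nonzero part of \<open>f\<close> would survive in \<open>Psi f\<close>.\<close>

lemma Psi_inj:
  assumes "\<And>w. Psi f w = 0" shows "f w = 0"
proof -
  have "vanish n f" for n
  proof (induction n)
    case (Suc n)
    have "f w = 0" if "length w = n" for w
    proof -
      have "(\<Sum>i\<le>length w. smul (inverse (fact (Suc i))) ((ad ^^ i) f w))
          = (\<Sum>i\<le>length w. if i = 0 then f w else 0)"
      proof (intro sum.cong refl)
        fix i
        have "(ad ^^ i) f w = 0" if "i \<noteq> 0"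
          using vanish_ad[OF Suc, of i] that \<open>length w = n\<close> by (auto simp: vanish_def)
        then show "smul (inverse (fact (Suc i))) ((ad ^^ i) f w) = (if i = 0 then f w else 0)" by auto
      qed
      then show ?thesis using assms[of w] by (simp add: Psi_def)
    qed
    then show ?case using Suc by (auto simp: vanish_def less_Suc_eq)
  qed (rule vanish_0)
  from this[of "Suc (length w)"] show ?thesis by (simp add: vanish_def)
qed

text \<open>Unshuffling is cocommutative, so convolution carries the Lie bracket of g over to
  functions: here antisymmetry, and next the Jacobi identity.\<close>

lemma conv_br_swap: "conv br f h w = - conv br h f w"
proof (induction w arbitrary: f h)
  case Nil
  show ?case unfolding conv.simps by (rule br_swap)
next
  case (Cons x w)
  have "conv br f h (x # w) = - conv br h (\<lambda>v. f (x # v)) w + - conv br (\<lambda>v. h (x # v)) f w"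
    unfolding conv.simps by (intro arg_cong2[where f = "(+)"] Cons.IH)
  then show ?case by simp
qed

lemma conv_br_derivation:
  "conv br p (conv br f h) w = conv br (conv br p f) h w + conv br f (conv br p h) w"
proof (induction w arbitrary: p f h)
  case Nil
  show ?case unfolding conv.simps by (rule jacobi_derivation)
next
  case (Cons x w)
  show ?case
    using Cons.IH[of "\<lambda>v. p (x # v)" f h] Cons.IH[of p "\<lambda>v. f (x # v)" h] Cons.IH[of p f "\<lambda>v. h (x # v)"]
    by (simp add: g.conv_add_left g.conv_add_right)
qed

text \<open>The coefficients of the Maurer--Cartan equation for the one-form
  \<open>((exp (ad phi) - 1) / ad phi) (d phi)\<close>.\<close>

lemma maurer_cartan_coeff:
  fixes x y
  defines "f \<equiv> \<lambda>i. (ad ^^ i) (\<lambda>v. phi (x # v))" and "h \<equiv> \<lambda>i. (ad ^^ i) (\<lambda>v. phi (y # v))"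
  shows "h n (x # w) - f n (y # w) = (ad ^^ n) (\<lambda>v. phi (y # x # v) - phi (x # y # v)) w
    + (\<Sum>i<n. smul (of_nat (Suc n choose Suc i)) (conv br (f i) (h (n - Suc i)) w))"
proof (induction n arbitrary: w)
  case 0
  then show ?case by (simp add: f_def h_def)
next
  case (Suc n)
  let ?k = "\<lambda>v. phi (y # x # v) - phi (x # y # v)"
  define X where "X i = conv br (f i) (h (n - i)) w" for i
  define C where "C i = (of_nat (Suc n choose i) :: 'k)" for i
  have step: "f (Suc i) = ad (f i)" "h (Suc i) = ad (h i)" for i by (simp_all add: f_def h_def)
  define S where "S = (\<Sum>i<n. smul (C (Suc i)) (X (Suc i)) + smul (C (Suc i)) (X i))"
  have X: "conv br (f 0) (h n) w = X 0" "conv br (h 0) (f n) w = - X n"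
    by (simp_all add: X_def conv_br_swap[of "h 0" "f n"])
  have "h (Suc n) (x # w) - f (Suc n) (y # w)
      = conv br (f 0) (h n) w - conv br (h 0) (f n) w + conv br phi (\<lambda>v. h n (x # v) - f n (y # v)) w"
    by (simp add: step g.conv_diff_right) (simp add: f_def h_def)
  also have "(\<lambda>v. h n (x # v) - f n (y # v)) = (\<lambda>v. (ad ^^ n) ?k v
      + (\<Sum>i<n. smul (C (Suc i)) (conv br (f i) (h (n - Suc i)) v)))"
    by (simp add: Suc.IH C_def)
  also have "conv br phi \<dots> w = (ad ^^ Suc n) ?k w
      + (\<Sum>i<n. smul (C (Suc i)) (conv br phi (conv br (f i) (h (n - Suc i))) w))"
    by (simp add: g.conv_add_right g.conv_sum_right g.conv_scale_right)
  also have "(\<Sum>i<n. smul (C (Suc i)) (conv br phi (conv br (f i) (h (n - Suc i))) w)) = S"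
    unfolding S_def by (intro sum.cong refl)
      (simp add: conv_br_derivation X_def step[symmetric] Suc_diff_Suc g.scale_right_distrib)
  finally have 1: "h (Suc n) (x # w) - f (Suc n) (y # w) = X 0 + X n + ((ad ^^ Suc n) ?k w + S)"
    unfolding X by (simp only: diff_minus_eq_add)
  \<comment> \<open>\<open>X 0\<close> and \<open>X n\<close> arise from differentiating the
    outermost \<open>phi\<close>. In \<open>S\<close> the derivation rule has turned each term of
    the previous stage into two neighbours, and Pascal's rule merges the coefficients.\<close>
  have "X 0 + X n + S = (\<Sum>i\<le>n. smul (C i) (X i)) + (\<Sum>i\<le>n. smul (C (Suc i)) (X i))"
  proof -
    have "(\<Sum>i\<le>n. smul (C i) (X i)) = X 0 + (\<Sum>i<n. smul (C (Suc i)) (X (Suc i)))"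
      by (simp add: sum.atMost_shift C_def del: sum.atMost_Suc)
    moreover have "(\<Sum>i\<le>n. smul (C (Suc i)) (X i)) = (\<Sum>i<n. smul (C (Suc i)) (X i)) + X n"
      by (simp add: lessThan_Suc_atMost[symmetric] C_def binomial_eq_0)
    ultimately show ?thesis by (simp add: S_def sum.distrib algebra_simps)
  qed
  also have "\<dots> = (\<Sum>i<Suc n. smul (of_nat (Suc (Suc n) choose Suc i)) (conv br (f i) (h (Suc n - Suc i)) w))"
    by (simp add: lessThan_Suc_atMost sum.distrib[symmetric] g.scale_left_distrib[symmetric]
        C_def X_def del: sum.lessThan_Suc)
  finally have 2: "X 0 + X n + S = \<dots>" .
  show ?case unfolding 1 2[symmetric] by (simp only: add_ac)
qed

lemma inverse_fact_binomial:
  assumes "i \<le> n"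
  shows "inverse (fact (Suc (Suc n))) * of_nat (Suc (Suc n) choose Suc i)
    = (inverse (fact (Suc i)) * inverse (fact (Suc (n - i))) :: 'k::field_char_0)"
proof -
  have "of_nat (Suc (Suc n) choose Suc i)
      = (fact (Suc (Suc n)) / (fact (Suc i) * fact (Suc (Suc n) - Suc i)) :: 'k)"
    using assms by (intro binomial_fact) auto
  moreover have "Suc (Suc n) - Suc i = Suc (n - i)" using assms by simp
  ultimately show ?thesis by (simp only:) (simp add: divide_simps del: fact_Suc)
qed

text \<open>The logarithmic derivative of exp phi is constant by \<open>Psi_phi\<close>, so its
  Maurer--Cartan equation says that \<open>Psi\<close> of the commutator of second derivatives, plus
  [x, y], is 0. As [x, y] is itself \<open>Psi\<close> of a derivative of \<open>phi\<close>,
  injectivity of \<open>Psi\<close> gives the relation.\<close>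

lemma phi_lie_head: "phi (x # y # w) - phi (y # x # w) - phi (br x y # w) = 0"
proof -
  let ?k = "\<lambda>v. phi (y # x # v) - phi (x # y # v)"
  let ?a = "\<lambda>i. inverse (fact (Suc i)) :: 'k"
  let ?f = "\<lambda>i. (ad ^^ i) (\<lambda>v. phi (x # v))" and ?h = "\<lambda>i. (ad ^^ i) (\<lambda>v. phi (y # v))"
  have "Psi ?k w + g.unit_at (br x y) w = 0" for w
  proof -
    let ?M = "length w"
    \<comment> \<open>A constant function has derivative 0: \<open>g.unit_at\<close> is 0 on
      nonempty words.\<close>
    have "0 = Psi (\<lambda>v. phi (y # v)) (x # w) - Psi (\<lambda>v. phi (x # v)) (y # w)"
      by (simp add: Psi_phi)
    also have "\<dots> = (\<Sum>n\<le>Suc ?M. smul (?a n) (?h n (x # w) - ?f n (y # w)))"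
      by (simp only: Psi_eq[of _ "Suc ?M"] list.size add_0_right add_Suc_right order.refl
          g.scale_right_diff_distrib sum_subtractf)
    also have "\<dots> = (\<Sum>n\<le>Suc ?M. smul (?a n) ((ad ^^ n) ?k w)
        + smul (?a n) (\<Sum>i<n. smul (of_nat (Suc n choose Suc i)) (conv br (?f i) (?h (n - Suc i)) w)))"
      by (simp only: maurer_cartan_coeff g.scale_right_distrib)
    also have "\<dots> = Psi ?k w
        + (\<Sum>n\<le>Suc ?M. smul (?a n) (\<Sum>i<n. smul (of_nat (Suc n choose Suc i)) (conv br (?f i) (?h (n - Suc i)) w)))"
      by (simp only: sum.distrib Psi_eq[of w "Suc ?M"] le_SucI order.refl)
    \<comment> \<open>Dividing by (n + 1)! splits the binomial coefficient into the weights of the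
      two factors, which leaves a Cauchy product. The term n = 0 is empty, hence the shift of the
      index.\<close>
    also have "(\<Sum>n\<le>Suc ?M. smul (?a n) (\<Sum>i<n. smul (of_nat (Suc n choose Suc i)) (conv br (?f i) (?h (n - Suc i)) w)))
        = (\<Sum>n\<le>?M. \<Sum>i\<le>n. smul (?a i * ?a (n - i)) (conv br (?f i) (?h (n - i)) w))"
    proof -
      have "(\<Sum>n\<le>Suc ?M. smul (?a n) (\<Sum>i<n. smul (of_nat (Suc n choose Suc i)) (conv br (?f i) (?h (n - Suc i)) w)))
        = (\<Sum>n\<le>?M. smul (?a (Suc n)) (\<Sum>i<Suc n. smul (of_nat (Suc (Suc n) choose Suc i)) (conv br (?f i) (?h (Suc n - Suc i)) w)))"
        by (subst sum.atMost_Suc_shift) (simp only: lessThan_0 sum.empty g.scale_zero_right add_0)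
      also have "\<dots> = (\<Sum>n\<le>?M. \<Sum>i\<le>n. smul (?a i * ?a (n - i)) (conv br (?f i) (?h (n - i)) w))"
        by (intro sum.cong refl)
          (simp only: g.scale_sum_right lessThan_Suc_atMost g.scale_scale diff_Suc_Suc,
           intro sum.cong refl, simp only: atMost_iff inverse_fact_binomial)
      finally show ?thesis .
    qed
    also have "\<dots> = (\<Sum>i\<le>?M. \<Sum>j\<le>?M. smul (?a i * ?a j) (conv br (?f i) (?h j) w))"
    proof (rule sum_triangle[symmetric])
      fix i j assume "?M < i + j"
      moreover have "vanish (i + j) (conv br (?f i) (?h j))"
        using vanish_ad[OF vanish_0, of i "\<lambda>v. phi (x # v)"] vanish_ad[OF vanish_0, of j "\<lambda>v. phi (y # v)"]
        by (intro g.vanish_conv) simp_all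
      ultimately show "smul (?a i * ?a j) (conv br (?f i) (?h j) w) = 0"
        by (simp add: vanish_def)
    qed
    also have "\<dots> = conv br (\<lambda>v. \<Sum>i\<le>?M. smul (?a i) (?f i v)) (\<lambda>v. \<Sum>j\<le>?M. smul (?a j) (?h j v)) w"
      by (simp only: g.conv_sum_left g.conv_sum_right g.conv_scale_left g.conv_scale_right
          g.scale_sum_right g.scale_scale)
    also have "\<dots> = conv br (g.unit_at x) (g.unit_at y) w"
      by (intro conv_cong) (simp_all only: Psi_eq[symmetric] Psi_phi)
    also have "\<dots> = g.unit_at (br x y) w"
      by (simp add: g.conv_unit_at) (simp add: g.unit_at_def g.m_zero_right)
    finally show ?thesis by simp
  qed
  then have "Psi (\<lambda>v. (phi (x # y # v) - phi (y # x # v)) - phi (br x y # v)) w = 0" for w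
    unfolding Psi_diff Psi_phi by (simp add: Psi_diff algebra_simps eq_neg_iff_add_eq_0)
  from Psi_inj[OF this] show ?thesis .
qed

lemma phi_add_head: "phi ((x + y) # w) - phi (x # w) - phi (y # w) = 0"
proof (rule Psi_inj[of "\<lambda>w. phi ((x + y) # w) - phi (x # w) - phi (y # w)"])
  fix w show "Psi (\<lambda>w. phi ((x + y) # w) - phi (x # w) - phi (y # w)) w = 0"
    unfolding Psi_diff Psi_phi by (simp add: g.unit_at_def)
qed

lemma phi_smul_head: "phi (smul c x # w) - smul c (phi (x # w)) = 0"
proof (rule Psi_inj[of "\<lambda>w. phi (smul c x # w) - smul c (phi (x # w))"])
  fix w show "Psi (\<lambda>w. phi (smul c x # w) - smul c (phi (x # w))) w = 0"
    unfolding Psi_diff Psi_scale Psi_phi by (simp add: g.unit_at_def)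
qed

text \<open>Induction on the number of letters around the relator. At the head the three preceding
  lemmas apply; behind a first letter \<open>z\<close>, \<open>phi\<close> is a combination of
  iterated convolutions of \<open>phi\<close>, evaluated with one surrounding letter fewer.\<close>

lemma phi_respecting: "respecting smul br smul {0} n phi"
proof (induction n)
  case 0
  then show ?case
    unfolding respecting_def by (simp add: phi_lie_head phi_add_head phi_smul_head)
next
  case (Suc n)
  have ad_resp: "respecting smul br smul {0} n ((ad ^^ j) (g.unit_at z))" for j z
  proof (induction j)
    case 0
    show ?case by (simp add: respecting_def g.unit_at_def)
  next
    case (Suc j)
    show ?case unfolding funpow.simps comp_def
      by (rule g.conv_respecting[OF _ _ _ \<open>respecting smul br smul {0} n phi\<close> Suc])
        (simp_all add: g.m_zero_left g.m_zero_right)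
  qed
  have "(\<forall>x y. phi (u @ (x + y) # v) - phi (u @ x # v) - phi (u @ y # v) \<in> {0}) \<and>
     (\<forall>c x. phi (u @ smul c x # v) - smul c (phi (u @ x # v)) \<in> {0}) \<and>
     (\<forall>x y. phi (u @ x # y # v) - phi (u @ y # x # v) - phi (u @ br x y # v) \<in> {0})"
    if len: "length u + length v \<le> Suc n" for u v
  proof (cases u)
    case Nil
    then show ?thesis by (simp add: phi_lie_head phi_add_head phi_smul_head)
  next
    case (Cons z t)
    have len': "length t + length v \<le> n" using len Cons by simp
    note D = respectingD[OF ad_resp len', simplified]
    \<comment> \<open>The bound leaves room for the two letters of the bracket relator, so that all
      words compared share one range of summation.\<close>
    have phi: "phi (z # t @ s @ v) = (\<Sum>j\<le>Suc (Suc n). smul (bern j) ((ad ^^ j) (g.unit_at z) (t @ s @ v)))"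
      if "length s \<le> 2" for s
      using that len' by (intro phi_Cons) simp
    show ?thesis
    proof (intro conjI allI)
      fix x y
      show "phi (u @ (x + y) # v) - phi (u @ x # v) - phi (u @ y # v) \<in> {0}"
        using phi[of "[x + y]"] phi[of "[x]"] phi[of "[y]"]
        by (simp add: Cons sum_subtractf[symmetric] g.scale_right_diff_distrib[symmetric] D
            del: sum.atMost_Suc)
    next
      fix c x
      have *: "smul c (smul (bern j) ((ad ^^ j) (g.unit_at z) (t @ x # v)))
          = smul (bern j) ((ad ^^ j) (g.unit_at z) (t @ smul c x # v))" for j
        using D(2)[of j z c x] by (simp add: mult.commute)
      show "phi (u @ smul c x # v) - smul c (phi (u @ x # v)) \<in> {0}"
        using phi[of "[smul c x]"] phi[of "[x]"]
        by (simp add: Cons g.scale_sum_right * del: sum.atMost_Suc g.scale_scale)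
    next
      fix x y
      show "phi (u @ x # y # v) - phi (u @ y # x # v) - phi (u @ br x y # v) \<in> {0}"
        using phi[of "[x, y]"] phi[of "[y, x]"] phi[of "[br x y]"]
        by (simp add: Cons sum_subtractf[symmetric] g.scale_right_diff_distrib[symmetric] D
            del: sum.atMost_Suc)
    qed
  qed
  then show ?case by (simp add: respecting_def)
qed

end

section \<open>Filtration degrees of the logarithm\<close>

context filtered_lie
begin

text \<open>F 0 is unconstrained; \<open>F' 0\<close> is the whole of g.\<close>

definition F' :: "nat \<Rightarrow> 'g set" where
  "F' n = F (max 1 n)"

lemma F'_subspace: "g.subspace (F' n)"
  by (simp add: F'_def F_subspace)

lemma F'_br: "x \<in> F' i \<Longrightarrow> y \<in> F' j \<Longrightarrow> br x y \<in> F' (i + j)"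
  unfolding F'_def by (rule F_mono[OF _ _ F_br]) auto

lemma phi_graded: "graded_by F F' 0 phi"
proof -
  note add = g.subspace_add[OF F'_subspace]
  have phis: "graded_by F F' 0 (phis n)" for n
  proof (induction n)
    case 0
    show ?case by (simp add: graded_by_def g.subspace_0[OF F'_subspace])
  next
    case (Suc n)
    have ad: "graded_by F F' m ((conv br (phis n) ^^ j) (g.unit_at x))" if "1 \<le> m" "x \<in> F m" for m x j
    proof (induction j)
      case 0
      show ?case using that
        by (simp add: graded_by_def g.unit_at_def weighted_Nil F'_def g.subspace_0[OF F_subspace])
    next
      case (Suc j)
      have "graded_by F F' (0 + m) (conv br (phis n) ((conv br (phis n) ^^ j) (g.unit_at x)))"
        by (rule graded_by_conv[OF _ _ \<open>graded_by F F' 0 (phis n)\<close> Suc]) (auto intro: add F'_br)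
      then show ?case by simp
    qed
    show ?case
      unfolding graded_by_def
    proof (intro allI impI)
      fix w ms assume w: "weighted F w ms"
      show "phis (Suc n) w \<in> F' (0 + sum_list ms)"
      proof (cases w)
        case Nil
        then show ?thesis by (simp add: g.subspace_0[OF F'_subspace])
      next
        case (Cons x v)
        then obtain m ms' where ms: "ms = m # ms'" "1 \<le> m" "x \<in> F m" "weighted F v ms'"
          using w by (auto simp: weighted_Cons)
        show ?thesis
          using graded_byD[OF ad[OF ms(2,3)] ms(4)]
          by (simp add: Cons ms(1) g.subspace_sum[OF F'_subspace] g.subspace_scale[OF F'_subspace])
      qed
    qed
  qed
  show ?thesis unfolding graded_by_def phi_def
    by (intro allI impI graded_byD[OF phis])
qed

text \<open>This is the only consequence of the Poincare--Birkhoff--Witt theorem that is needed.\<close>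

lemma gen_Fil_imp_F:
  assumes n: "1 \<le> n" and "gen x \<in> Fil n" shows "x \<in> F n"
proof -
  have "lin smul phi (gen x) \<in> F' n"
  proof (rule Fil_lin[OF g.module_axioms F'_subspace])
    fix a :: "('g, 'k) falg" assume "a \<in> J"
    then have "lin smul phi a \<in> {0}"
      by (intro J_lin g.module_axioms phi_respecting) auto
    then show "lin smul phi a \<in> F' n" by (simp add: g.subspace_0[OF F'_subspace])
  next
    fix w ms assume w: "weighted F w ms" "n \<le> sum_list ms"
    show "phi w \<in> F' n"
      unfolding F'_def by (rule F_mono[OF _ _ graded_byD[OF phi_graded w(1), unfolded F'_def]]) (use w in auto)
  qed fact
  then show ?thesis using n by (simp add: g.lin_word phi_single F'_def max_def)
qed

end

section \<open>Exponentials as exponentials of Lie elements\<close>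

lemma conv_cg:
  assumes I: "two_sided I"
    and "\<And>v. length v \<le> length w \<Longrightarrow> cg I (f v) (f' v)" "\<And>v. length v \<le> length w \<Longrightarrow> cg I (h v) (h' v)"
  shows "cg I (conv (*) f h w) (conv (*) f' h' w)"
  using assms(2,3)
proof (induction w arbitrary: f h f' h')
  case Nil
  then show ?case by (simp add: cg_mult[OF I])
next
  case (Cons x w)
  have "cg I (conv (*) (\<lambda>v. f (x # v)) h w) (conv (*) (\<lambda>v. f' (x # v)) h' w)"
    "cg I (conv (*) f (\<lambda>v. h (x # v)) w) (conv (*) f' (\<lambda>v. h' (x # v)) w)"
    by (intro Cons.IH Cons.prems; simp)+
  then show ?case by (simp add: falg.cg_add[OF two_sided_subspace[OF I]])
qed

text \<open>Pascal's rule in the shape needed for the derivative of a power, in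
  \<open>cpow_Cons\<close>; the variant that follows serves the Leibniz rule for iterated
  derivations.\<close>

lemma sum_lessThan_choose:
  fixes X :: "nat \<Rightarrow> 'm::ab_group_add" and s :: "'k::field_char_0 \<Rightarrow> 'm \<Rightarrow> 'm"
  assumes "module s"
  shows "(\<Sum>i<Suc n. s (of_nat (Suc n choose Suc i)) (X i))
    = X 0 + (\<Sum>i<n. s (of_nat (n choose Suc i)) (X (Suc i) + X i))"
proof -
  interpret M: module s by fact
  have "(\<Sum>i<Suc n. s (of_nat (Suc n choose Suc i)) (X i))
      = (\<Sum>i\<le>n. s (of_nat (n choose i)) (X i)) + (\<Sum>i\<le>n. s (of_nat (n choose Suc i)) (X i))"
    by (simp add: lessThan_Suc_atMost sum.distrib[symmetric] M.scale_left_distrib[symmetric]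
        del: sum.lessThan_Suc)
  also have "(\<Sum>i\<le>n. s (of_nat (n choose i)) (X i)) = X 0 + (\<Sum>i<n. s (of_nat (n choose Suc i)) (X (Suc i)))"
    by (simp add: sum.atMost_shift del: sum.atMost_Suc)
  also have "(\<Sum>i\<le>n. s (of_nat (n choose Suc i)) (X i)) = (\<Sum>i<n. s (of_nat (n choose Suc i)) (X i))"
    by (simp add: lessThan_Suc_atMost[symmetric] binomial_eq_0)
  finally show ?thesis by (simp add: M.scale_right_distrib sum.distrib add_ac)
qed

lemma sum_atMost_choose:
  fixes X :: "nat \<Rightarrow> 'm::ab_group_add" and s :: "'k::field_char_0 \<Rightarrow> 'm \<Rightarrow> 'm"
  assumes "module s"
  shows "(\<Sum>i\<le>Suc n. s (of_nat (Suc n choose i)) (X i))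
    = (\<Sum>i\<le>n. s (of_nat (n choose i)) (X (Suc i) + X i))"
proof -
  interpret M: module s by fact
  have "(\<Sum>i\<le>Suc n. s (of_nat (Suc n choose i)) (X i))
      = X 0 + ((\<Sum>i\<le>n. s (of_nat (n choose i)) (X (Suc i))) + (\<Sum>i\<le>n. s (of_nat (n choose Suc i)) (X (Suc i))))"
    by (simp add: sum.atMost_Suc_shift sum.distrib[symmetric] M.scale_left_distrib[symmetric]
        del: sum.atMost_Suc)
  also have "(\<Sum>i\<le>n. s (of_nat (n choose Suc i)) (X (Suc i))) = (\<Sum>i<n. s (of_nat (n choose Suc i)) (X (Suc i)))"
    by (simp add: lessThan_Suc_atMost[symmetric] binomial_eq_0)
  also have "X 0 + ((\<Sum>i\<le>n. s (of_nat (n choose i)) (X (Suc i))) + (\<Sum>i<n. s (of_nat (n choose Suc i)) (X (Suc i))))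
      = (\<Sum>i\<le>n. s (of_nat (n choose i)) (X (Suc i))) + (\<Sum>i\<le>n. s (of_nat (n choose i)) (X i))"
    by (simp add: sum.atMost_shift[of "\<lambda>i. s (of_nat (n choose i)) (X i)"] add_ac del: sum.atMost_Suc)
  finally show ?thesis by (simp only: M.scale_right_distrib sum.distrib)
qed

section \<open>Star multiplication transposed to functions on words\<close>

definition delta :: "'g \<Rightarrow> 'g \<Rightarrow> ('g list \<Rightarrow> 'm::ab_group_add) \<Rightarrow> 'g list \<Rightarrow> 'm" where
  "delta z y f w = f (z # w) + f (y # w) - f (w @ [y])"

lemma delta_funpow_Suc:
  "(delta z y ^^ Suc j) f w
    = (delta z y ^^ j) f (z # w) + (delta z y ^^ j) f (y # w) - (delta z y ^^ j) f (w @ [y])"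
  by (simp add: delta_def[of z y "(delta z y ^^ j) f" w])

lemma delta_funpow_mem:
  assumes "\<And>a b. a \<in> I \<Longrightarrow> b \<in> I \<Longrightarrow> a + b \<in> I" "\<And>a b. a \<in> I \<Longrightarrow> b \<in> I \<Longrightarrow> a - b \<in> I"
    and "\<And>v. length v = length w + j \<Longrightarrow> f v \<in> I"
  shows "(delta z y ^^ j) f w \<in> I"
  using assms(3)
proof (induction j arbitrary: w)
  case (Suc j)
  have "(delta z y ^^ j) f (z # w) \<in> I" "(delta z y ^^ j) f (y # w) \<in> I"
    "(delta z y ^^ j) f (w @ [y]) \<in> I"
    by (intro Suc.IH Suc.prems; simp)+
  then show ?case unfolding delta_funpow_Suc by (intro assms(1,2))
qed simp

lemma delta_funpow_diff:
  "(delta z y ^^ j) (\<lambda>v. f v - h v) w = (delta z y ^^ j) f w - (delta z y ^^ j) h w"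
  by (induction j arbitrary: w) (simp_all add: delta_funpow_Suc del: funpow.simps(2))

lemma (in module) delta_funpow_sum:
  "(delta z y ^^ j) (\<lambda>v. \<Sum>i\<in>A. c i *s f i v) w = (\<Sum>i\<in>A. c i *s (delta z y ^^ j) (f i) w)"
  by (induction j arbitrary: w)
    (simp_all add: delta_funpow_Suc sum.distrib sum_subtractf scale_right_distrib scale_right_diff_distrib
      del: funpow.simps(2))

text \<open>\<open>delta z y\<close> is composition with w -> z w + y w - w y, hence the transpose
  of \<open>star_op z y\<close>. Letters are primitive whether prepended or appended, so it is a
  derivation of the convolution.\<close>

lemma delta_conv:
  "delta z y (conv (*) f h) w = conv (*) (delta z y f) h w + conv (*) f (delta z y h) (w :: 'g list)"
  for f h :: "'g list \<Rightarrow> ('g, 'k::comm_ring_1) falg"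
proof -
  have "delta z y p = (\<lambda>v. p (z # v) + p (y # v) - p (v @ [y]))" for p :: "'g list \<Rightarrow> ('g, 'k) falg"
    by (simp add: fun_eq_iff delta_def)
  then show ?thesis
    by (simp add: conv_snoc falg.conv_add_left falg.conv_add_right falg.conv_diff_left falg.conv_diff_right)
qed

lemma delta_scale_sum:
  "delta z y (\<lambda>v. \<Sum>i\<in>A. scal (c i) (f i v)) w = (\<Sum>i\<in>A. scal (c i) (delta z y (f i) w))"
  using falg.delta_funpow_sum[of 1 z y c f A w] by simp

lemma delta_funpow_conv:
  fixes f h :: "'g list \<Rightarrow> ('g, 'k::field_char_0) falg"
  shows "(delta z y ^^ j) (conv (*) f h) w
    = (\<Sum>p\<le>j. scal (of_nat (j choose p)) (conv (*) ((delta z y ^^ p) f) ((delta z y ^^ (j - p)) h) w))"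
proof (induction j arbitrary: w)
  case (Suc j)
  define X where "X p = conv (*) ((delta z y ^^ p) f) ((delta z y ^^ (Suc j - p)) h) w" for p
  have "(delta z y ^^ Suc j) (conv (*) f h) w = delta z y (\<lambda>w. \<Sum>p\<le>j. scal (of_nat (j choose p))
      (conv (*) ((delta z y ^^ p) f) ((delta z y ^^ (j - p)) h) w)) w"
    by (simp add: Suc.IH[abs_def])
  also have "\<dots> = (\<Sum>p\<le>j. scal (of_nat (j choose p)) (X (Suc p) + X p))"
    unfolding delta_scale_sum delta_conv X_def
    by (intro sum.cong refl) (simp add: Suc_diff_le)
  also have "\<dots> = (\<Sum>p\<le>Suc j. scal (of_nat (Suc j choose p)) (X p))"
    by (rule sum_atMost_choose[symmetric]) (rule falg.module_axioms)
  finally show ?case by (simp only: X_def)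
qed simp

text \<open>The value of the linear extension of \<open>f\<close> at the \<open>j\<close>-th term of
  the star exponential series; for \<open>f\<close> equal to \<open>word\<close> it is that
  term.\<close>

definition ev :: "'g \<Rightarrow> 'g \<Rightarrow> nat \<Rightarrow> ('g list \<Rightarrow> ('g, 'k::field_char_0) falg) \<Rightarrow> ('g, 'k) falg" where
  "ev z y j f = scal (inverse (fact j)) ((delta z y ^^ j) f [])"

text \<open>In other words, the sequence \<open>ev z y j word\<close> is a divided power sequence for the coproduct.\<close>

lemma ev_conv:
  fixes f h :: "'g list \<Rightarrow> ('g, 'k::field_char_0) falg"
  shows "ev z y j (conv (*) f h) = (\<Sum>p\<le>j. ev z y p f * ev z y (j - p) h)"
proof -
  have "inverse (fact j) * of_nat (j choose p) = (inverse (fact p) * inverse (fact (j - p)) :: 'k)"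
    if "p \<le> j" for p
    using that by (simp add: binomial_fact divide_simps)
  then show ?thesis
    by (simp add: ev_def delta_funpow_conv falg.scale_sum_right scal_mult_left scal_mult_right
        mult.commute[of "inverse (fact _)" "inverse (fact _)"])
qed

text \<open>For y = R z this is the star product of z with b; for y = 0 it is the product, since
  \<open>gen 0\<close> is in the ideal J.\<close>

definition star_op :: "'g \<Rightarrow> 'g \<Rightarrow> ('g, 'k::comm_ring_1) falg \<Rightarrow> ('g, 'k) falg" where
  "star_op z y b = gen z * b + gen y * b - b * gen y"

lemma star_op_add: "star_op z y (a + b) = star_op z y a + star_op z y b"
  by (simp add: star_op_def algebra_simps)

lemma star_op_diff: "star_op z y (a - b) = star_op z y a - star_op z y b"
  by (simp add: star_op_def algebra_simps)

lemma star_op_funpow_add: "(star_op z y ^^ j) (a + b) = (star_op z y ^^ j) a + (star_op z y ^^ j) b"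
  by (induction j) (simp_all add: star_op_add)

lemma star_op_funpow_diff: "(star_op z y ^^ j) (a - b) = (star_op z y ^^ j) a - (star_op z y ^^ j) b"
  by (induction j) (simp_all add: star_op_diff)

lemma delta_funpow_word:
  "(delta z y ^^ j) word w = (star_op z y ^^ j) (word w :: ('g, 'k::comm_ring_1) falg)"
proof (induction j arbitrary: w)
  case (Suc j)
  have "star_op z y (word w :: ('g, 'k) falg) = word (z # w) + word (y # w) - word (w @ [y])"
    by (simp add: star_op_def word_mult)
  then show ?case
    unfolding delta_funpow_Suc Suc.IH
    by (simp only: star_op_funpow_add[symmetric] star_op_funpow_diff[symmetric]
        funpow_Suc_right comp_apply)
qed simp

lemma ev_word: "ev z y j word = scal (inverse (fact j)) ((star_op z y ^^ j) 1)"
  by (simp add: ev_def delta_funpow_word word_Nil)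

section \<open>Convolution powers of the logarithm, modulo the ideal\<close>

context lie_alg
begin

lemmas cgJ_refl = falg.cg_refl[OF J_subspace]
  and cgJ_sym = falg.cg_sym[OF J_subspace]
  and cgJ_trans [trans] = falg.cg_trans[OF J_subspace]
  and cgJ_add = falg.cg_add[OF J_subspace]
  and cgJ_diff = falg.cg_diff[OF J_subspace]
  and cgJ_scale = falg.cg_scale[OF J_subspace]
  and cgJ_sum = falg.cg_sum[OF J_subspace]
  and cgJ_mult = cg_mult[OF J_two_sided]

lemma cgJ_gen_add: "cg J (gen (x + y)) (gen x + gen y)"
  using J_gen_add[of x y] by (simp add: cg_def diff_diff_eq)

lemma gen_0_J: "gen 0 \<in> J"
  using J_gen_add[of 0 0] falg.subspace_neg[OF J_subspace, of "- gen 0"] by simp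

text \<open>Unlike \<open>gen\<close>, which sends 0 to a nonzero element of J, this representative of the
  inclusion of g preserves vanishing.\<close>

definition gz :: "'g \<Rightarrow> ('g, 'k) falg" where
  "gz x = (if x = 0 then 0 else gen x)"

lemma gz_0 [simp]: "gz 0 = 0"
  by (simp add: gz_def)

lemma gz_gen: "cg J (gz x) (gen x)"
  using falg.subspace_neg[OF J_subspace gen_0_J] by (simp add: gz_def cg_def falg.subspace_0[OF J_subspace])

lemmas gen_gz = cgJ_sym[OF gz_gen]

lemma gz_add: "cg J (gz (x + y)) (gz x + gz y)"
  by (rule cgJ_trans[OF gz_gen cgJ_trans[OF cgJ_gen_add cgJ_add[OF gen_gz gen_gz]]])

lemma gz_smul: "cg J (gz (smul c x)) (scal c (gz x))"
  by (rule cgJ_trans[OF gz_gen cgJ_trans[OF _ cgJ_scale[OF gen_gz]]])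
    (simp add: cg_def J_gen_smul)

lemma gz_diff: "cg J (gz (x - y)) (gz x - gz y)"
proof -
  have "cg J (gz x) (gz (x - y) + gz y)" using gz_add[of "x - y" y] by simp
  from cgJ_sym[OF cgJ_diff[OF this cgJ_refl[of "gz y"]]] show ?thesis by simp
qed

lemma gz_sum: "cg J (gz (\<Sum>i\<in>A. f i)) (\<Sum>i\<in>A. gz (f i))"
proof (induction A rule: infinite_finite_induct)
  case (insert i A)
  then show ?case using cgJ_trans[OF gz_add cgJ_add[OF cgJ_refl insert.IH]] by simp
qed (simp_all add: cgJ_refl)

lemma gz_br: "cg J (gz (br x y)) (gz x * gz y - gz y * gz x)"
proof -
  have "cg J (gen x * gen y - gen y * gen x) (gen (br x y))"
    using J_gen_lie by (simp add: cg_def)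
  then show ?thesis
    by (rule cgJ_trans[OF gz_gen cgJ_trans[OF cgJ_sym cgJ_diff[OF cgJ_mult cgJ_mult]]])
      (rule gen_gz)+
qed

lemma gz_conv:
  "cg J (gz (conv br f h w))
    (conv (*) (\<lambda>v. gz (f v)) (\<lambda>v. gz (h v)) w - conv (*) (\<lambda>v. gz (h v)) (\<lambda>v. gz (f v)) w)"
proof (induction w arbitrary: f h)
  case Nil
  then show ?case by (simp add: gz_br)
next
  case (Cons x w)
  show ?case
    using cgJ_trans[OF gz_add cgJ_add[OF Cons.IH[of "\<lambda>v. f (x # v)" h] Cons.IH[of f "\<lambda>v. h (x # v)"]]]
    by (simp add: algebra_simps)
qed

definition gphi :: "'g list \<Rightarrow> ('g, 'k) falg" where
  "gphi w = gz (phi w)"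

primrec cpow :: "nat \<Rightarrow> 'g list \<Rightarrow> ('g, 'k) falg" where
  "cpow 0 = falg.unit_at 1"
| "cpow (Suc n) = conv (*) gphi (cpow n)"

lemma vanish_cpow: "vanish n (cpow n)"
proof (induction n)
  case (Suc n)
  have "vanish 1 gphi" by (simp add: vanish_def gphi_def phi_Nil)
  from falg.vanish_conv[OF this Suc] show ?case by simp
qed (simp add: vanish_0)

definition dpow :: "'g \<Rightarrow> nat \<Rightarrow> 'g list \<Rightarrow> ('g, 'k) falg" where
  "dpow x i w = gz ((ad ^^ i) (\<lambda>v. phi (x # v)) w)"

lemma vanish_dpow: "vanish i (dpow x i)"
  by (simp add: vanish_def dpow_def ad_eq_0)

lemma dpow_Suc: "cg J (conv (*) gphi (dpow x i) w) (dpow x (Suc i) w + conv (*) (dpow x i) gphi w)"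
proof -
  have "cg J (dpow x (Suc i) w) (conv (*) gphi (dpow x i) w - conv (*) (dpow x i) gphi w)"
    unfolding dpow_def gphi_def funpow.simps comp_def by (rule gz_conv)
  from cgJ_add[OF cgJ_sym[OF this] cgJ_refl[of "conv (*) (dpow x i) gphi w"]] show ?thesis by simp
qed

text \<open>Derivative of a power when \<open>phi\<close> does not commute with its derivative:
  moving the powers of \<open>phi\<close> to the right of the derivative produces iterated
  commutators with binomial coefficients.\<close>

lemma cpow_Cons:
  "cg J (cpow n (x # w))
    (\<Sum>i<n. scal (of_nat (n choose Suc i)) (conv (*) (dpow x i) (cpow (n - Suc i)) w))"
proof (induction n arbitrary: w)
  case 0
  show ?case by (simp add: cgJ_refl)
next
  case (Suc n)
  define Y where "Y i = conv (*) (dpow x i) (cpow (n - i)) w" for i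
  have "cg J (conv (*) gphi (\<lambda>v. cpow n (x # v)) w)
      (conv (*) gphi (\<lambda>v. \<Sum>i<n. scal (of_nat (n choose Suc i)) (conv (*) (dpow x i) (cpow (n - Suc i)) v)) w)"
    by (intro conv_cg J_two_sided Suc cgJ_refl)
  also have "\<dots> = (\<Sum>i<n. scal (of_nat (n choose Suc i)) (conv (*) gphi (conv (*) (dpow x i) (cpow (n - Suc i))) w))"
    by (simp add: falg.conv_sum_right falg.conv_scale_right)
  also have "cg J \<dots> (\<Sum>i<n. scal (of_nat (n choose Suc i)) (Y (Suc i) + Y i))"
  proof (intro cgJ_sum cgJ_scale)
    fix i assume "i \<in> {..<n}"
    then have n: "n - i = Suc (n - Suc i)" by auto
    let ?c = "cpow (n - Suc i)"
    have "conv (*) gphi (conv (*) (dpow x i) ?c) w = conv (*) (conv (*) gphi (dpow x i)) ?c w"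
      by (simp add: conv_assoc)
    also have "cg J \<dots> (conv (*) (\<lambda>v. dpow x (Suc i) v + conv (*) (dpow x i) gphi v) ?c w)"
      by (intro conv_cg J_two_sided dpow_Suc cgJ_refl)
    also have "\<dots> = Y (Suc i) + Y i"
      unfolding Y_def n by (simp only: falg.conv_add_left conv_assoc cpow.simps)
    finally show "cg J (conv (*) gphi (conv (*) (dpow x i) ?c) w) (Y (Suc i) + Y i)" .
  qed
  finally have *: "cg J (conv (*) gphi (\<lambda>v. cpow n (x # v)) w)
      (\<Sum>i<n. scal (of_nat (n choose Suc i)) (Y (Suc i) + Y i))" .
  have "cpow (Suc n) (x # w) = Y 0 + conv (*) gphi (\<lambda>v. cpow n (x # v)) w"
    by (simp add: Y_def dpow_def[abs_def] gphi_def)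
  then have "cg J (cpow (Suc n) (x # w))
      (Y 0 + (\<Sum>i<n. scal (of_nat (n choose Suc i)) (Y (Suc i) + Y i)))"
    using cgJ_add[OF cgJ_refl[of "Y 0"] *] by (simp only:)
  also have "\<dots> = (\<Sum>i<Suc n. scal (of_nat (Suc n choose Suc i)) (Y i))"
    by (rule sum_lessThan_choose[OF falg.module_axioms, symmetric])
  finally show ?case by (simp only: Y_def diff_Suc_Suc)
qed

text \<open>The convolution exponential of \<open>gphi\<close> is the identity of U(g).\<close>

lemma exp_gphi:
  "length w \<le> N \<Longrightarrow> cg J (\<Sum>n\<le>N. scal (inverse (fact n)) (cpow n w)) (word w)"
proof (induction w arbitrary: N)
  case Nil
  have "(\<Sum>n\<le>N. scal (inverse (fact n)) (cpow n [])) = (\<Sum>n\<le>N. if n = 0 then 1 else 0)"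
    using vanish_cpow by (intro sum.cong refl) (auto simp: vanish_def)
  then show ?case by (simp add: word_Nil cgJ_refl)
next
  case (Cons x w)
  then obtain M where N: "N = Suc M" and M: "length w \<le> M" by (cases N) auto
  let ?a = "\<lambda>i. inverse (fact i) :: 'k"
  let ?Z = "\<lambda>i j. conv (*) (dpow x i) (cpow j) w"
  have "(\<Sum>n\<le>N. scal (?a n) (cpow n (x # w))) = (\<Sum>n\<le>M. scal (?a (Suc n)) (cpow (Suc n) (x # w)))"
    unfolding N by (subst sum.atMost_Suc_shift) (simp only: cpow.simps(1) falg.unit_at_simps falg.scale_zero_right add_0)
  also have "cg J \<dots> (\<Sum>n\<le>M. scal (?a (Suc n)) (\<Sum>i<Suc n. scal (of_nat (Suc n choose Suc i)) (?Z i (Suc n - Suc i))))"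
    by (intro cgJ_sum cgJ_scale cpow_Cons)
  also have "\<dots> = (\<Sum>n\<le>M. \<Sum>i\<le>n. scal (?a (Suc i) * ?a (n - i)) (?Z i (n - i)))"
  proof (intro sum.cong refl)
    fix n
    have "?a (Suc n) * of_nat (Suc n choose Suc i) = ?a (Suc i) * ?a (n - i)" if "i \<le> n" for i
      using that binomial_fact[of "Suc i" "Suc n", where 'a = 'k]
      by (simp add: divide_simps del: fact_Suc binomial_Suc_Suc)
    then show "scal (?a (Suc n)) (\<Sum>i<Suc n. scal (of_nat (Suc n choose Suc i)) (?Z i (Suc n - Suc i)))
        = (\<Sum>i\<le>n. scal (?a (Suc i) * ?a (n - i)) (?Z i (n - i)))"
      by (simp only: falg.scale_sum_right lessThan_Suc_atMost falg.scale_scale diff_Suc_Suc)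
        (intro sum.cong refl, simp del: fact_Suc binomial_Suc_Suc)
  qed
  also have "\<dots> = (\<Sum>i\<le>M. \<Sum>j\<le>M. scal (?a (Suc i) * ?a j) (?Z i j))"
  proof (rule sum_triangle[symmetric])
    fix i j assume "M < i + j"
    then have "length w < i + j" using M by simp
    then show "scal (?a (Suc i) * ?a j) (?Z i j) = 0"
      using falg.vanish_conv[OF vanish_dpow[of i x] vanish_cpow[of j]] by (simp add: vanish_def)
  qed
  also have "\<dots> = conv (*) (\<lambda>v. \<Sum>i\<le>M. scal (?a (Suc i)) (dpow x i v)) (\<lambda>v. \<Sum>j\<le>M. scal (?a j) (cpow j v)) w"
    by (simp only: falg.conv_sum_left falg.conv_sum_right falg.conv_scale_left falg.conv_scale_right
        falg.scale_sum_right falg.scale_scale)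
  \<comment> \<open>The first factor is \<open>Psi\<close> of the derivative of \<open>phi\<close>,
    hence the constant \<open>x\<close>.\<close>
  also have "cg J \<dots> (conv (*) (\<lambda>v. falg.unit_at (gz x) v) (\<lambda>v. \<Sum>j\<le>M. scal (?a j) (cpow j v)) w)"
  proof (intro conv_cg J_two_sided cgJ_refl)
    fix v :: "'g list" assume v: "length v \<le> length w"
    have "cg J (\<Sum>i\<le>M. scal (?a (Suc i)) (dpow x i v))
        (gz (\<Sum>i\<le>M. smul (?a (Suc i)) ((ad ^^ i) (\<lambda>v. phi (x # v)) v)))"
      unfolding dpow_def
      by (rule cgJ_sym[OF cgJ_trans[OF gz_sum cgJ_sum[OF gz_smul]]])
    also have "\<dots> = gz (g.unit_at x v)"
      by (simp only: Psi_eq[OF order.trans[OF v M], symmetric] Psi_phi)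
    also have "\<dots> = falg.unit_at (gz x) v"
      by (simp add: g.unit_at_def falg.unit_at_def)
    finally show "cg J (\<Sum>i\<le>M. scal (?a (Suc i)) (dpow x i v)) (falg.unit_at (gz x) v)" .
  qed
  also have "\<dots> = gz x * (\<Sum>j\<le>M. scal (?a j) (cpow j w))"
    by (simp add: falg.conv_unit_at)
  also have "cg J \<dots> (gen x * word w)"
    by (intro cgJ_mult gz_gen Cons.IH M)
  finally show ?case by (simp add: word_Cons[of x w])
qed

lemma delta_funpow_gz:
  "cg J ((delta z y ^^ j) (\<lambda>v. gz (f v)) w) (gz ((delta z y ^^ j) f w))"
proof (induction j arbitrary: w)
  case (Suc j)
  show ?case unfolding delta_funpow_Suc
    by (rule cgJ_trans[OF cgJ_diff[OF cgJ_add[OF Suc Suc] Suc]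
          cgJ_sym[OF cgJ_trans[OF gz_diff cgJ_diff[OF gz_add cgJ_refl]]]])
qed (simp add: cgJ_refl)

end

section \<open>Star exponentials modulo a step of the filtration\<close>

context filtered_lie
begin

lemmas cgF_refl = falg.cg_refl[OF Fil_subspace]
  and cgF_sym = falg.cg_sym[OF Fil_subspace]
  and cgF_trans [trans] = falg.cg_trans[OF Fil_subspace]
  and cgF_add = falg.cg_add[OF Fil_subspace]
  and cgF_diff = falg.cg_diff[OF Fil_subspace]
  and cgF_scale = falg.cg_scale[OF Fil_subspace]
  and cgF_sum = falg.cg_sum[OF Fil_subspace]
  and cgF_mult = cg_mult[OF Fil_two_sided]
  and cgF_power = cg_power[OF Fil_two_sided]

lemma cgJ_cgF: "cg J a b \<Longrightarrow> cg (Fil n) a b"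
  by (simp add: cg_def J_Fil)

lemma star_op_cg:
  assumes "cg (Fil n) (gen z) (gen z')" "cg (Fil n) (gen y) (gen y')" "cg (Fil n) b b'"
  shows "cg (Fil n) (star_op z y b) (star_op z' y' b')"
  unfolding star_op_def by (intro cgF_add cgF_diff cgF_mult assms)

lemma gen_Fil_1: "gen x \<in> Fil 1"
  by (rule Fil_gen) (simp_all add: F_1)

lemma power_Fil: "a \<in> Fil 1 \<Longrightarrow> a ^ n \<in> Fil n"
  by (induction n) (use Fil_mult[of _ 1] Fil_0 in auto)

text \<open>All letters lie in \<open>F 1\<close>, so \<open>phi\<close> takes words of length
  \<open>p\<close> into \<open>F' p\<close>.\<close>

lemma ev_gphi_Fil: "ev z y p gphi \<in> Fil p"
  unfolding ev_def
proof (intro falg.subspace_scale Fil_subspace delta_funpow_mem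
    falg.subspace_add[OF Fil_subspace] falg.subspace_diff[OF Fil_subspace])
  fix v :: "'g list" assume "length v = length ([] :: 'g list) + p"
  then have "phi v \<in> F' p"
    using graded_byD[OF phi_graded weighted_ones, of v] by (simp add: sum_list_replicate)
  then show "gphi v \<in> Fil p"
    by (cases "p = 0") (auto simp: gphi_def gz_def Fil_0 F'_def max_def Suc_le_eq
        intro!: Fil_gen falg.subspace_0[OF Fil_subspace])
qed

lemma ev_cpow_Fil: "ev z y j (cpow n) \<in> Fil j"
proof (induction n arbitrary: j)
  case 0
  show ?case unfolding ev_def
    by (intro falg.subspace_scale Fil_subspace delta_funpow_mem falg.subspace_add[OF Fil_subspace]
        falg.subspace_diff[OF Fil_subspace])
      (auto simp: falg.unit_at_def Fil_0 falg.subspace_0[OF Fil_subspace])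
next
  case (Suc n)
  have "ev z y p gphi * ev z y (j - p) (cpow n) \<in> Fil j" if "p \<le> j" for p
    using Fil_mult[OF ev_gphi_Fil[of z y p] Suc[of "j - p"]] that by simp
  then show ?case by (auto simp: ev_conv intro: falg.subspace_sum[OF Fil_subspace])
qed

text \<open>By \<open>ev_conv\<close>, evaluation at the star exponential turns convolution into
  multiplication, up to the corner of the product with total degree at least
  \<open>N\<close>.\<close>

lemma sum_ev_cpow:
  "cg (Fil N) (\<Sum>j<N. ev z y j (cpow n)) ((\<Sum>j<N. ev z y j gphi) ^ n)"
proof (cases N)
  case 0
  then show ?thesis by (simp add: cg_def Fil_0)
next
  case (Suc M)
  have "cg (Fil N) (\<Sum>j\<le>M. ev z y j (cpow n)) ((\<Sum>j\<le>M. ev z y j gphi) ^ n)"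
  proof (induction n)
    case 0
    have "ev z y j (cpow 0) = (if j = 0 then 1 else 0)" for j
    proof (cases "j = 0")
      case False
      then have "(delta z y ^^ j) (falg.unit_at (1 :: ('g, 'k) falg)) [] \<in> {0}"
        by (intro delta_funpow_mem) (auto simp: falg.unit_at_def)
      then show ?thesis using False by (simp add: ev_def)
    qed (simp add: ev_def)
    then show ?case by (simp add: cgF_refl)
  next
    case (Suc n)
    let ?g = "\<lambda>i j. ev z y i gphi * ev z y j (cpow n)"
    \<comment> \<open>The condition always holds here; it is inserted so that the corner vanishes
      and \<open>sum_triangle\<close> applies.\<close>
    have "(\<Sum>j\<le>M. ev z y j (cpow (Suc n))) = (\<Sum>j\<le>M. \<Sum>p\<le>j. if p + (j - p) \<le> M then ?g p (j - p) else 0)"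
      by (simp add: ev_conv)
    also have "\<dots> = (\<Sum>i\<le>M. \<Sum>j\<le>M. if i + j \<le> M then ?g i j else 0)"
      by (rule sum_triangle[symmetric]) simp
    also have "cg (Fil N) \<dots> (\<Sum>i\<le>M. \<Sum>j\<le>M. ?g i j)"
    proof (intro cgF_sum)
      fix i j
      show "cg (Fil N) (if i + j \<le> M then ?g i j else 0) (?g i j)"
        using Fil_mono[OF _ Fil_mult[OF ev_gphi_Fil ev_cpow_Fil], of N i j z y z y n]
          falg.subspace_neg[OF Fil_subspace, of "?g i j" N]
        by (auto simp: cgF_refl \<open>N = Suc M\<close>) (simp add: cg_def)
    qed
    also have "\<dots> = (\<Sum>j\<le>M. ev z y j gphi) * (\<Sum>j\<le>M. ev z y j (cpow n))"
      by (simp add: sum_product)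
    also have "cg (Fil N) \<dots> ((\<Sum>j\<le>M. ev z y j gphi) ^ Suc n)"
      unfolding power_Suc by (intro cgF_mult cgF_refl Suc)
    finally show ?case .
  qed
  then show ?thesis by (simp add: Suc lessThan_Suc_atMost)
qed

definition exp_trunc :: "nat \<Rightarrow> 'g \<Rightarrow> ('g, 'k) falg" where
  "exp_trunc N c = (\<Sum>n<N. scal (inverse (fact n)) (gen c ^ n))"

definition star_exp_trunc :: "nat \<Rightarrow> 'g \<Rightarrow> 'g \<Rightarrow> ('g, 'k) falg" where
  "star_exp_trunc N z y = (\<Sum>n<N. scal (inverse (fact n)) ((star_op z y ^^ n) 1))"

text \<open>As \<open>star_op z y\<close> is the sum of the commuting operators of left multiplication by
  z + y and right multiplication by - y, this contains the Baker--Campbell--Hausdorff theorem.\<close>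

lemma star_exp_is_exp: "\<exists>c. cg (Fil N) (star_exp_trunc N z y) (exp_trunc N c)"
proof
  \<comment> \<open>The linear extension of \<open>phi\<close> at the truncated star exponential,
    that is, the logarithm of the latter.\<close>
  define c where "c = (\<Sum>j<N. smul (inverse (fact j)) ((delta z y ^^ j) phi []))"
  let ?a = "\<lambda>n. inverse (fact n) :: 'k"
  let ?E = "\<Sum>j<N. ev z y j gphi"
  have E: "cg J ?E (gen c)"
  proof -
    have "cg J ?E (\<Sum>j<N. scal (?a j) (gz ((delta z y ^^ j) phi [])))"
      unfolding ev_def gphi_def[abs_def] by (intro cgJ_sum cgJ_scale delta_funpow_gz)
    also have "cg J \<dots> (\<Sum>j<N. gz (smul (?a j) ((delta z y ^^ j) phi [])))"
      by (intro cgJ_sum cgJ_sym[OF gz_smul])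
    also have "cg J \<dots> (gz c)" unfolding c_def by (rule cgJ_sym[OF gz_sum])
    also have "cg J \<dots> (gen c)" by (rule gz_gen)
    finally show ?thesis .
  qed
  have "star_exp_trunc N z y = (\<Sum>j<N. ev z y j word)"
    by (simp add: star_exp_trunc_def ev_word)
  \<comment> \<open>The identity of U(g) is replaced by the convolution exponential of
    \<open>gphi\<close>; powers up to \<open>N\<close> suffice, as only words of length
    \<open>j < N\<close> are evaluated.\<close>
  also have "cg (Fil N) \<dots> (\<Sum>j<N. ev z y j (\<lambda>w. \<Sum>n\<le>N. scal (?a n) (cpow n w)))"
  proof (intro cgF_sum)
    fix j assume j: "j \<in> {..<N}"
    have "(delta z y ^^ j) (\<lambda>v. word v - (\<Sum>n\<le>N. scal (?a n) (cpow n v))) [] \<in> J"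
    proof (rule delta_funpow_mem[OF falg.subspace_add[OF J_subspace] falg.subspace_diff[OF J_subspace]])
      fix v :: "'g list" assume "length v = length ([] :: 'g list) + j"
      then show "word v - (\<Sum>n\<le>N. scal (?a n) (cpow n v)) \<in> J"
        using j cgJ_sym[OF exp_gphi[of v N]] by (simp add: cg_def)
    qed
    then show "cg (Fil N) (ev z y j word) (ev z y j (\<lambda>w. \<Sum>n\<le>N. scal (?a n) (cpow n w)))"
      unfolding ev_def by (intro cgF_scale) (simp add: cg_def delta_funpow_diff J_Fil)
  qed
  also have "\<dots> = (\<Sum>n\<le>N. scal (?a n) (\<Sum>j<N. ev z y j (cpow n)))"
    unfolding ev_def falg.delta_funpow_sum falg.scale_sum_right
    by (subst sum.swap) (simp add: mult.commute)
  also have "cg (Fil N) \<dots> (\<Sum>n\<le>N. scal (?a n) (gen c ^ n))"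
    by (intro cgF_sum cgF_scale cgF_trans[OF sum_ev_cpow cgF_power[OF cgJ_cgF[OF E]]])
  also have "\<dots> = exp_trunc N c + scal (?a N) (gen c ^ N)"
    by (simp add: exp_trunc_def lessThan_Suc_atMost[symmetric])
  also have "cg (Fil N) \<dots> (exp_trunc N c)"
    by (intro falg.cg_add_mem Fil_subspace falg.subspace_scale power_Fil gen_Fil_1)
  finally show "cg (Fil N) (star_exp_trunc N z y) (exp_trunc N c)" .
qed

end

section \<open>The Rota--Baxter operator of U(g)\<close>

text \<open>The transpose of the derivation of the free algebra that extends \<open>br y\<close>. It
  is the sum subtracted in the recursion for \<open>rbw\<close>; modulo J the derivation is the
  commutator with \<open>y\<close>.\<close>

definition der :: "('g \<Rightarrow> 'g \<Rightarrow> 'g) \<Rightarrow> 'g \<Rightarrow> ('g list \<Rightarrow> 'm::ab_group_add) \<Rightarrow> 'g list \<Rightarrow> 'm" where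
  "der br y f w = (\<Sum>i<length w. f (w[i := br y (w ! i)]))"

lemma der_Nil: "der br y f [] = 0"
  by (simp add: der_def)

lemma der_Cons: "der br y f (a # w) = f (br y a # w) + der br y (\<lambda>v. f (a # v)) w"
  by (simp add: der_def sum.lessThan_Suc_shift del: sum.lessThan_Suc)

lemma der_append: "der br y f (u @ v) = der br y (\<lambda>t. f (t @ v)) u + der br y (\<lambda>t. f (u @ t)) v"
  by (induction u arbitrary: f) (simp_all add: der_Nil der_Cons add.assoc)

lemma der_add: "der br y (\<lambda>v. f v + h v) w = der br y f w + der br y h w"
  by (simp add: der_def sum.distrib)

lemma der_diff: "der br y (\<lambda>v. f v - h v) w = der br y f w - der br y h w"
  by (simp add: der_def sum_subtractf)

lemma der_mult: "der br y (\<lambda>v. a * f v) w = (a :: 'a::ring) * der br y f w"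
  by (simp add: der_def sum_distrib_left)

lemma (in module) der_scale: "der br y (\<lambda>v. scale c (f v)) w = scale c (der br y f w)"
  by (simp add: der_def scale_sum_right)

lemma (in module) der_mem:
  assumes "subspace I" "\<And>v. length v = length w \<Longrightarrow> f v \<in> I"
  shows "der br y f w \<in> I"
  unfolding der_def using assms by (intro subspace_sum) auto

context lie_alg
begin

text \<open>Bracketing with \<open>z\<close> is a derivation of g, so its extension maps relators to
  combinations of relators.\<close>

lemma respecting_der:
  assumes s: "module s" and I: "module.subspace s I" and f: "respecting smul br s I n f"
  shows "respecting smul br s I n (der br z f)"
proof -
  interpret M: module s by fact
  note add = M.subspace_add[OF I] and sub = M.subspace_diff[OF I] and der_mem = M.der_mem[OF I]
  have mid: "der br z f (u @ a # v) = der br z (\<lambda>t. f (t @ a # v)) u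
      + (f (u @ br z a # v) + der br z (\<lambda>t. f (u @ a # t)) v)" for u a v
    by (simp add: der_append der_Cons)
  have "(\<forall>x y. der br z f (u @ (x + y) # v) - der br z f (u @ x # v) - der br z f (u @ y # v) \<in> I) \<and>
     (\<forall>c x. der br z f (u @ smul c x # v) - s c (der br z f (u @ x # v)) \<in> I) \<and>
     (\<forall>x y. der br z f (u @ x # y # v) - der br z f (u @ y # x # v) - der br z f (u @ br x y # v) \<in> I)"
    if len: "length u + length v \<le> n" for u v
  proof (intro conjI allI)
    note D = respectingD[OF f]
    fix x y
    have "der br z (\<lambda>t. f (t @ (x + y) # v) - f (t @ x # v) - f (t @ y # v)) u \<in> I"
      "f (u @ (br z x + br z y) # v) - f (u @ br z x # v) - f (u @ br z y # v) \<in> I"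
      "der br z (\<lambda>t. f (u @ (x + y) # t) - f (u @ x # t) - f (u @ y # t)) v \<in> I"
      by (intro der_mem D(1); use len in simp)+
    from add[OF this(1) add[OF this(2,3)]]
    show "der br z f (u @ (x + y) # v) - der br z f (u @ x # v) - der br z f (u @ y # v) \<in> I"
      by (simp add: mid der_diff der_add g.m_add_right algebra_simps)
    fix c
    have "der br z (\<lambda>t. f (t @ smul c x # v) - s c (f (t @ x # v))) u \<in> I"
      "f (u @ smul c (br z x) # v) - s c (f (u @ br z x # v)) \<in> I"
      "der br z (\<lambda>t. f (u @ smul c x # t) - s c (f (u @ x # t))) v \<in> I"
      by (intro der_mem D(2); use len in simp)+
    from add[OF this(1) add[OF this(2,3)]]
    show "der br z f (u @ smul c x # v) - s c (der br z f (u @ x # v)) \<in> I"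
      by (simp add: mid der_diff der_add M.der_scale g.m_scale_right M.scale_right_distrib algebra_simps)
    have 1: "der br z (\<lambda>t. f (t @ x # y # v) - f (t @ y # x # v) - f (t @ br x y # v)) u \<in> I"
      "f (u @ br z x # y # v) - f (u @ y # br z x # v) - f (u @ br (br z x) y # v) \<in> I"
      "f (u @ x # br z y # v) - f (u @ br z y # x # v) - f (u @ br x (br z y) # v) \<in> I"
      "der br z (\<lambda>t. f (u @ x # y # t) - f (u @ y # x # t) - f (u @ br x y # t)) v \<in> I"
      by (intro der_mem D(3); use len in simp)+
    have 2: "f (u @ (br (br z x) y + br x (br z y)) # v) - f (u @ br (br z x) y # v) - f (u @ br x (br z y) # v) \<in> I"
      by (rule D(1)[OF len])
    have mid2: "der br z f (u @ a # b # v) = der br z (\<lambda>t. f (t @ a # b # v)) u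
        + (f (u @ br z a # b # v) + (f (u @ a # br z b # v) + der br z (\<lambda>t. f (u @ a # b # t)) v))" for a b
      by (simp add: der_append der_Cons)
    show "der br z f (u @ x # y # v) - der br z f (u @ y # x # v) - der br z f (u @ br x y # v) \<in> I"
      using add[OF 1(1) add[OF 1(2) add[OF 1(3) sub[OF 1(4) 2]]]]
      by (simp add: mid[of u "br x y" v] mid2 der_diff der_add jacobi_derivation[of z x y] algebra_simps)
  qed
  then show ?thesis by (simp add: respecting_def)
qed

context
  fixes f :: "'g list \<Rightarrow> ('g, 'k) falg" and w :: "'g list"
  assumes f: "\<And>n. n < length w \<Longrightarrow> respecting smul br scal J n f"
begin

text \<open>Only one letter changes at a time, so relators between fewer than
  \<open>length w\<close> letters suffice. The induction in \<open>rb_respecting\<close> depends on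
  this strict bound.\<close>

lemma der_add_left: "der br (x + y) f w - der br x f w - der br y f w \<in> J"
  unfolding der_def sum_subtractf[symmetric]
proof (rule falg.subspace_sum[OF J_subspace])
  fix i assume "i \<in> {..<length w}"
  then have "i < length w" "length w - 1 < length w" by auto
  then show "f (w[i := br (x + y) (w ! i)]) - f (w[i := br x (w ! i)]) - f (w[i := br y (w ! i)]) \<in> J"
    using respectingD(1)[OF f, of "length w - 1" "take i w" "drop (Suc i) w" "br x (w ! i)" "br y (w ! i)"]
    by (simp add: upd_conv_take_nth_drop g.m_add_left)
qed

lemma der_smul_left: "der br (smul c x) f w - scal c (der br x f w) \<in> J"
  unfolding der_def falg.scale_sum_right sum_subtractf[symmetric]
proof (rule falg.subspace_sum[OF J_subspace])
  fix i assume "i \<in> {..<length w}"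
  then have "i < length w" "length w - 1 < length w" by auto
  then show "f (w[i := br (smul c x) (w ! i)]) - scal c (f (w[i := br x (w ! i)])) \<in> J"
    using respectingD(2)[OF f, of "length w - 1" "take i w" "drop (Suc i) w" c "br x (w ! i)"]
    by (simp add: upd_conv_take_nth_drop g.m_scale_left)
qed

end

text \<open>Transposition reverses composition, whence the sign in front of the bracket. The Jacobi
  identity handles both brackets on the same letter; the terms with \<open>a\<close> and
  \<open>b\<close> on different letters cancel.\<close>

lemma der_commutator:
  assumes "\<And>n. n < length w \<Longrightarrow> respecting smul br scal J n f"
  shows "der br a (der br b f) w - der br b (der br a f) w + der br (br a b) f w \<in> J"
  using assms
proof (induction w arbitrary: f)
  case Nil
  then show ?case by (simp add: der_Nil falg.subspace_0[OF J_subspace])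
next
  case (Cons t s)
  have expand: "der br a (der br b f) (t # s) = f (br b (br a t) # s) + der br b (\<lambda>r. f (br a t # r)) s
      + der br a (\<lambda>r. f (br b t # r)) s + der br a (der br b (\<lambda>r. f (t # r))) s" for a b
    by (simp add: der_Cons der_add add.assoc)
  have "respecting smul br scal J n (\<lambda>r. f (t # r))" if "n < length s" for n
    using that by (intro respecting_Cons Cons.prems) simp
  then have 1: "der br a (der br b (\<lambda>r. f (t # r))) s - der br b (der br a (\<lambda>r. f (t # r))) s
      + der br (br a b) (\<lambda>r. f (t # r)) s \<in> J"
    by (rule Cons.IH)
  have 2: "f ((br (br a b) t + br b (br a t)) # s) - f (br (br a b) t # s) - f (br b (br a t) # s) \<in> J"
    using respectingD(1)[OF Cons.prems, of "length s" "[]" s] by simp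
  show ?case
    using falg.subspace_diff[OF J_subspace 1 2]
    by (simp add: expand[of a b] expand[of b a] der_Cons[of br "br a b"] jacobi_derivation[of a b t] algebra_simps)
qed

end

section \<open>The antipode and the iterated coproduct\<close>

lift_definition anti :: "('g, 'k::comm_ring_1) falg \<Rightarrow> ('g, 'k) falg" is fa_S
proof -
  fix p :: "('g, 'k) fa" assume p: "p \<in> fa_fin"
  have "{w. fa_S p w \<noteq> 0} \<subseteq> rev ` {w. p w \<noteq> 0}"
    by (auto simp: fa_S_def intro!: image_eqI[of _ rev "rev _"])
  then show "fa_S p \<in> fa_fin" using p unfolding fa_fin_def by (auto intro: finite_subset)
qed

lemma coef_anti: "coef (anti a) = fa_S (coef a)"
  by transfer simp

lemma anti_add: "anti (a + b) = anti a + anti b"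
  by transfer (simp add: fa_S_def fun_eq_iff distrib_left)

lemma anti_diff: "anti (a - b) = anti a - anti b"
  by transfer (simp add: fa_S_def fun_eq_iff right_diff_distrib)

lemma anti_scal: "anti (scal c a) = scal c (anti a)"
  by transfer (simp add: fa_S_def fa_smul_def fun_eq_iff mult.left_commute)

lemma anti_zero: "anti 0 = 0"
  by transfer (simp add: fa_S_def fun_eq_iff)

lemma anti_word: "anti (word w) = scal ((- 1) ^ length w) (word (rev w))"
  by transfer (auto simp: fa_S_def fa_smul_def fa_word_def fun_eq_iff)

lemma anti_mult: "anti (a * b) = anti b * anti a"
proof (induction a rule: falg_induct)
  case (word c u)
  have "anti (word u * b) = anti b * anti (word u)"
    by (induction b rule: falg_induct)
      (simp_all add: anti_zero anti_add anti_scal distrib_left distrib_right scal_mult_left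
        scal_mult_right word_mult anti_word power_add mult_ac falg.scale_right_distrib)
  then show ?case by (simp add: scal_mult_left scal_mult_right anti_scal)
qed (simp_all add: anti_zero anti_add distrib_left distrib_right)

lemma colourings_Suc:
  "colourings (Suc k) = (\<lambda>(c, cs). c # cs) ` ({0, 1, 2} \<times> colourings k)"
proof
  show "colourings (Suc k) \<subseteq> (\<lambda>(c, cs). c # cs) ` ({0, 1, 2} \<times> colourings k)"
  proof
    fix ds assume "ds \<in> colourings (Suc k)"
    then obtain c cs where "ds = c # cs" "c \<in> {0, 1, 2}" "cs \<in> colourings k"
      by (cases ds) (auto simp: colourings_def)
    then show "ds \<in> (\<lambda>(c, cs). c # cs) ` ({0, 1, 2} \<times> colourings k)" by force
  qed
qed (auto simp: colourings_def)

text \<open>The 3-colourings enumerate the unshuffles into three subwords, so the Sweedler formula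
  for the star product is an iterated convolution with \<open>b\<close> attached to the last
  factor.\<close>

lemma sum_colourings:
  fixes f0 f1 f2 :: "'g list \<Rightarrow> ('g, 'k::comm_ring_1) falg"
  shows "(\<Sum>cs\<in>colourings (length w). f0 (subword w cs 0) * f1 (subword w cs 1) * b * f2 (subword w cs 2))
    = conv (*) (conv (*) f0 f1) (\<lambda>v. b * f2 v) w"
proof (induction w arbitrary: f0 f1 f2)
  case Nil
  have "colourings 0 = {[]}" by (auto simp: colourings_def)
  then show ?case by (simp add: subword_def mult.assoc)
next
  case (Cons x w)
  let ?g = "\<lambda>ds. f0 (subword (x # w) ds 0) * f1 (subword (x # w) ds 1) * b * f2 (subword (x # w) ds 2)"
  have sub: "subword (x # w) (c # cs) i = (if c = i then x # subword w cs i else subword w cs i)" for c cs i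
    by (simp add: subword_def)
  have "sum ?g (colourings (length (x # w))) = (\<Sum>(c, cs)\<in>{0, 1, 2} \<times> colourings (length w). ?g (c # cs))"
    by (simp only: list.size colourings_Suc add_0_right add_Suc_right)
      (subst sum.reindex, auto simp: inj_on_def intro!: sum.cong)
  also have "\<dots> = (\<Sum>c\<in>{0, 1, 2}. \<Sum>cs\<in>colourings (length w). ?g (c # cs))"
    by (simp only: sum.cartesian_product)
  also have "\<dots> = conv (*) (conv (*) (\<lambda>v. f0 (x # v)) f1) (\<lambda>v. b * f2 v) w
      + conv (*) (conv (*) f0 (\<lambda>v. f1 (x # v))) (\<lambda>v. b * f2 v) w
      + conv (*) (conv (*) f0 f1) (\<lambda>v. b * f2 (x # v)) w"
    unfolding Cons.IH[symmetric] by (simp add: sub)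
  finally show ?case by (simp add: falg.conv_add_left)
qed

context lie_alg
begin

lemma lin_anti: "anti a = lin scal (\<lambda>w. anti (word w)) a"
  by (induction a rule: falg_induct)
    (simp_all add: falg.lin_zero falg.lin_add falg.lin_scal falg.lin_word anti_zero anti_add anti_scal)

text \<open>The antipode reverses products and negates letters, so it sends each relator to its
  negative.\<close>

lemma anti_J: assumes "a \<in> J" shows "anti a \<in> J"
proof (subst lin_anti, rule J_lin[OF falg.module_axioms J_subspace _ assms])
  fix n
  have sandwich: "anti (word u * r * word v) \<in> J" if "anti r \<in> J" for u r v
    using that by (simp add: anti_mult two_sided_mult[OF J_two_sided])
  show "respecting smul br scal J n (\<lambda>w. anti (word w))"
    unfolding respecting_def
  proof (intro allI impI conjI)
    fix u v :: "'g list" and x y c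
    have "anti (gen (x + y) - gen x - gen y :: ('g, 'k) falg) = - (gen (x + y) - gen x - gen y)"
      "anti (gen (smul c x) - scal c (gen x)) = - (gen (smul c x) - scal c (gen x))"
      "anti (gen x * gen y - gen y * gen x - gen (br x y) :: ('g, 'k) falg) = - (gen x * gen y - gen y * gen x - gen (br x y))"
      by (simp_all add: anti_diff anti_scal anti_word anti_mult del: word_mult)
    then have "anti (gen (x + y) - gen x - gen y) \<in> J" "anti (gen (smul c x) - scal c (gen x)) \<in> J"
      "anti (gen x * gen y - gen y * gen x - gen (br x y)) \<in> J"
      by (simp_all only: falg.subspace_neg[OF J_subspace] J_gen_add J_gen_smul J_gen_lie)
    note this[THEN sandwich, of u v]
    then show "anti (word (u @ (x + y) # v)) - anti (word (u @ x # v)) - anti (word (u @ y # v)) \<in> J"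
      "anti (word (u @ smul c x # v)) - scal c (anti (word (u @ x # v))) \<in> J"
      "anti (word (u @ x # y # v)) - anti (word (u @ y # x # v)) - anti (word (u @ br x y # v)) \<in> J"
      by (simp_all add: left_diff_distrib right_diff_distrib anti_diff scal_mult_left scal_mult_right
          anti_scal word_mult)
  qed
qed

lemma word_respecting: "respecting smul br scal J n word"
proof -
  have sandwich: "word u * r * word v \<in> J" if "r \<in> J" for u r v
    using that by (simp add: two_sided_mult[OF J_two_sided])
  show ?thesis
    unfolding respecting_def
    using J_gen_add[THEN sandwich] J_gen_smul[THEN sandwich] J_gen_lie[THEN sandwich]
    by (simp add: left_diff_distrib right_diff_distrib scal_mult_left scal_mult_right word_mult)
qed

lemma der_word: "cg J (der br y word w) (gen y * word w - word w * gen y)"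
proof (induction w)
  case Nil
  then show ?case by (simp add: der_Nil word_Nil cgJ_refl)
next
  case (Cons a w)
  have "gen a * der br y word w = der br y (\<lambda>v. word (a # v) :: ('g, 'k) falg) w"
    unfolding der_mult[symmetric] by (simp only: word_mult append_Cons append_Nil)
  then have "der br y word (a # w) = (gen (br y a) * word w + gen a * der br y word w :: ('g, 'k) falg)"
    by (simp only: der_Cons word_mult append_Cons append_Nil)
  also have "cg J \<dots> ((gen y * gen a - gen a * gen y) * word w + gen a * (gen y * word w - word w * gen y))"
    by (intro cgJ_add cgJ_mult cgJ_refl Cons cgJ_sym[where b = "gen (br _ _)"])
      (use J_gen_lie in \<open>simp add: cg_def\<close>)
  also have "\<dots> = gen y * word (a # w) - word (a # w) * gen y"
    unfolding word_Cons[of a w] by (simp add: algebra_simps)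
  finally show ?case .
qed

end

section \<open>Descent of the Rota--Baxter operator to U(g) and its filtration\<close>

locale rota_baxter_lie = filtered_lie smul br F
  for smul :: "'k::field_char_0 \<Rightarrow> 'g::ab_group_add \<Rightarrow> 'g" and br :: "'g \<Rightarrow> 'g \<Rightarrow> 'g"
    and F :: "nat \<Rightarrow> 'g set" +
  fixes R :: "'g \<Rightarrow> 'g"
  assumes rota_baxter: "rota_baxter smul br R"
    and F_R: "\<forall>n\<ge>1. R ` F n \<subseteq> F n"
begin

lemma R_add: "R (x + y) = R x + R y" and R_smul: "R (smul c x) = smul c (R x)"
  and R_br: "br (R x) (R y) = R (br (R x) y + br x (R y) + br x y)"
  using rota_baxter by (simp_all add: rota_baxter_def)

lemma R_F: "1 \<le> n \<Longrightarrow> x \<in> F n \<Longrightarrow> R x \<in> F n"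
  using F_R by blast

definition rb :: "'g list \<Rightarrow> ('g, 'k) falg" where
  "rb w = Abs_falg (rbw R br w)"

lemma rbw_fin: "rbw R br w \<in> (fa_fin :: ('g, 'k) fa set)"
proof (induction "length w" arbitrary: w rule: less_induct)
  case less
  show ?case
  proof (cases w)
    case Nil
    then show ?thesis by (simp add: fa_one_def fa_fin_word)
  next
    case (Cons x v)
    have "(\<Sum>i<n. rbw R br (v[i := br (R x) (v ! i)])) \<in> (fa_fin :: ('g, 'k) fa set)" for n
      by (induction n) (use less Cons in \<open>simp_all add: fa_fin_add[unfolded plus_fun_def] fa_fin_def[symmetric]
        zero_fun_def\<close>, simp add: fa_fin_def)
    then have "fa_mult (fa_gen (R x)) (rbw R br v) + - (\<Sum>i<length v. rbw R br (v[i := br (R x) (v ! i)]))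
        \<in> (fa_fin :: ('g, 'k) fa set)"
      using less Cons by (intro fa_fin_add fa_fin_uminus fa_fin_mult) (auto simp: fa_gen_def fa_fin_word)
    then show ?thesis unfolding Cons by (simp only: rbw.simps add_uminus_conv_diff)
  qed
qed

lemma coef_rb: "coef (rb w) = rbw R br w"
  by (simp add: rb_def Abs_falg_inverse rbw_fin)

lemma rb_Nil: "rb [] = 1"
  by (rule falg_eqI) (simp add: coef_rb coef_one)

lemma rb_Cons: "rb (x # w) = gen (R x) * rb w - der br (R x) rb w"
  by (rule falg_eqI)
    (simp add: coef_rb coef_diff coef_mult coef_gen der_def coef_sum)

text \<open>For the bracket relator the recursion is expanded twice; terms with one outer factor and
  one derivation are symmetric in \<open>x\<close> and \<open>y\<close> and drop out. By the
  Rota--Baxter identity the rest is the value on [R x, y] + [x, R y] + [x, y], less the values on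
  the first two summands.\<close>

lemma rb_head:
  assumes v: "\<And>n. n < length v \<Longrightarrow> respecting smul br scal J n rb"
  shows "rb ((x + y) # v) - rb (x # v) - rb (y # v) \<in> J"
    and "rb (smul c x # v) - scal c (rb (x # v)) \<in> J"
    and "rb (x # y # v) - rb (y # x # v) - rb (br x y # v) \<in> J"
proof -
  note J_mult = two_sided_mult[OF J_two_sided] and J_diff = falg.subspace_diff[OF J_subspace]
    and J_add = falg.subspace_add[OF J_subspace]
  show add: "rb ((x + y) # v) - rb (x # v) - rb (y # v) \<in> J" for x y
    using J_diff[OF J_mult(1)[OF J_gen_add[of "R x" "R y"], of "rb v"]
        der_add_left[where w = v and f = rb and x = "R x" and y = "R y", OF v]]
    by (simp add: rb_Cons R_add algebra_simps)
  show smul: "rb (smul c x # v) - scal c (rb (x # v)) \<in> J" for c x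
    using J_diff[OF J_mult(1)[OF J_gen_smul[of c "R x"], of "rb v"]
        der_smul_left[where w = v and f = rb and x = "R x" and c = c, OF v]]
    by (simp add: rb_Cons R_smul scal_mult_left algebra_simps)
  let ?c = "br (R x) y + br x (R y) + br x y" and ?A = "gen (R x)" and ?B = "gen (R y)"
  have two: "rb (x # y # v) = gen (R x) * gen (R y) * rb v - gen (R x) * der br (R y) rb v
      - rb (br (R x) y # v) - gen (R y) * der br (R x) rb v + der br (R x) (der br (R y) rb) v" for x y
  proof -
    have "rb (x # y # v) = gen (R x) * rb (y # v) - (rb (br (R x) y # v) + der br (R x) (\<lambda>t. rb (y # t)) v)"
      by (simp add: rb_Cons[of x "y # v"] der_Cons)
    then show ?thesis
      by (simp add: rb_Cons[of y] der_diff der_mult algebra_simps)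
  qed
  have rel: "(?A * ?B - ?B * ?A - gen (br (R x) (R y))) * rb v \<in> J"
    by (intro J_mult J_gen_lie)
  have com: "der br (R x) (der br (R y) rb) v - der br (R y) (der br (R x) rb) v
      + der br (br (R x) (R y)) rb v \<in> J"
    by (rule der_commutator[OF v])
  have c: "rb (?c # v) = gen (br (R x) (R y)) * rb v - der br (br (R x) (R y)) rb v"
    by (simp add: rb_Cons R_br[of x y])
  have c1: "rb (?c # v) - rb ((br (R x) y + br x (R y)) # v) - rb (br x y # v) \<in> J"
    and c2: "rb ((br (R x) y + br x (R y)) # v) - rb (br (R x) y # v) - rb (br x (R y) # v) \<in> J"
    by (rule add)+
  have swap: "rb (br (R y) x # v) + rb (br x (R y) # v) \<in> J"
    using smul[of "- 1" "br x (R y)"] by (simp add: br_swap[of "R y" x])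
  from J_add[OF J_add[OF rel com] J_add[OF J_add[OF c1 c2] swap]]
  show "rb (x # y # v) - rb (y # x # v) - rb (br x y # v) \<in> J"
    unfolding two[of x y] two[of y x] c by (simp add: algebra_simps)
qed

lemma rb_respecting: "respecting smul br scal J n rb"
proof (induction n rule: less_induct)
  case (less n)
  note J_mult = two_sided_mult[OF J_two_sided] and J_diff = falg.subspace_diff[OF J_subspace]
  have "(\<forall>x y. rb (u @ (x + y) # v) - rb (u @ x # v) - rb (u @ y # v) \<in> J) \<and>
     (\<forall>c x. rb (u @ smul c x # v) - scal c (rb (u @ x # v)) \<in> J) \<and>
     (\<forall>x y. rb (u @ x # y # v) - rb (u @ y # x # v) - rb (u @ br x y # v) \<in> J)"
    if len: "length u + length v \<le> n" for u v
  proof (cases u)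
    case Nil
    then have "m < length v \<Longrightarrow> respecting smul br scal J m rb" for m using len less by simp
    then show ?thesis using Nil by (simp add: rb_head)
  next
    case (Cons z t)
    then have len': "length t + length v \<le> length t + length v" "length t + length v < n"
      using len by auto
    note f = less[OF len'(2)]
    note D = respectingD[OF f len'(1)] and E = respectingD[OF respecting_der[OF falg.module_axioms J_subspace f] len'(1)]
    show ?thesis
    proof (intro conjI allI)
      fix x y
      show "rb (u @ (x + y) # v) - rb (u @ x # v) - rb (u @ y # v) \<in> J"
        using J_diff[OF J_mult(2)[OF D(1)[of x y], of "gen (R z)"] E(1)[of "R z" x y]]
        by (simp add: Cons rb_Cons algebra_simps)
      show "rb (u @ x # y # v) - rb (u @ y # x # v) - rb (u @ br x y # v) \<in> J"
        using J_diff[OF J_mult(2)[OF D(3)[of x y], of "gen (R z)"] E(3)[of "R z" x y]]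
        by (simp add: Cons rb_Cons algebra_simps)
      fix c
      show "rb (u @ smul c x # v) - scal c (rb (u @ x # v)) \<in> J"
        using J_diff[OF J_mult(2)[OF D(2)[of c x], of "gen (R z)"] E(2)[of "R z" c x]]
        by (simp add: Cons rb_Cons scal_mult_right algebra_simps)
    qed
  qed
  then show ?case by (simp add: respecting_def)
qed

text \<open>Bracketing the first letter into a later one transfers its degree there, so all terms of
  the recursion have the same total degree.\<close>

lemma rb_graded: "graded_by F Fil 0 rb"
proof -
  have "rb w \<in> Fil (sum_list ms)" if "weighted F w ms" for w ms
    using that
  proof (induction "length w" arbitrary: w ms rule: less_induct)
    case less
    show ?case
    proof (cases w)
      case Nil
      then show ?thesis using less by (simp add: weighted_Nil Fil_0)
    next
      case (Cons x v)
      then obtain m ms' where ms: "ms = m # ms'" "1 \<le> m" "x \<in> F m" "weighted F v ms'"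
        using less.prems by (auto simp: weighted_Cons)
      have len: "length ms' = length v" using ms(4) by (simp add: weighted_def list_all2_lengthD)
      have "rb (v[i := br (R x) (v ! i)]) \<in> Fil (sum_list ms)" if i: "i < length v" for i
      proof -
        have vi: "1 \<le> ms' ! i" "v ! i \<in> F (ms' ! i)"
          using ms(4) i by (auto simp: weighted_def list_all2_conv_all_nth)
        have "br (R x) (v ! i) \<in> F (m + ms' ! i)"
          using vi ms(2,3) by (intro F_br R_F)
        then have "weighted F (v[i := br (R x) (v ! i)]) (ms'[i := m + ms' ! i])"
          using ms(2,4) unfolding weighted_def by (intro list_all2_update_cong) auto
        from less.hyps[OF _ this] have "rb (v[i := br (R x) (v ! i)]) \<in> Fil (sum_list (ms'[i := m + ms' ! i]))"
          using Cons by simp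
        also have "sum_list (ms'[i := m + ms' ! i]) = sum_list ms"
          using i len by (simp add: ms(1) sum_list_update)
        finally show ?thesis .
      qed
      then have "der br (R x) rb v \<in> Fil (sum_list ms)"
        unfolding der_def by (intro falg.subspace_sum Fil_subspace) auto
      moreover have "gen (R x) * rb v \<in> Fil (sum_list ms)"
        using Fil_mult[OF Fil_gen[OF ms(2) R_F[OF ms(2,3)]] less.hyps[OF _ ms(4)]] Cons ms(1) by simp
      ultimately show ?thesis unfolding Cons rb_Cons by (intro falg.subspace_diff Fil_subspace)
    qed
  qed
  then show ?thesis by (simp add: graded_by_def)
qed

definition RB :: "('g, 'k) falg \<Rightarrow> ('g, 'k) falg" where
  "RB = lin scal rb"

lemma coef_RB: "coef (RB a) = fa_RB R br (coef a)"
  by (simp add: RB_def lin_def fa_RB_def coef_sum coef_scal coef_rb)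

lemma RB_J: "a \<in> J \<Longrightarrow> RB a \<in> J"
  unfolding RB_def by (intro J_lin falg.module_axioms J_subspace rb_respecting)

lemma RB_Fil: "a \<in> Fil n \<Longrightarrow> RB a \<in> Fil n"
  unfolding RB_def
proof (rule Fil_lin[OF falg.module_axioms Fil_subspace])
  fix w ms assume "weighted F w ms" "n \<le> sum_list ms"
  then show "rb w \<in> Fil n" using Fil_mono graded_byD[OF rb_graded] by fastforce
qed (auto simp: RB_def[symmetric] RB_J J_Fil)

lemma RB_diff: "RB (a - b) = RB a - RB b"
  by (simp add: RB_def falg.lin_diff)

lemma RB_cgJ: "cg J a b \<Longrightarrow> cg J (RB a) (RB b)"
  using RB_J[of "a - b"] by (simp add: cg_def RB_diff)

lemma RB_cgF: "cg (Fil n) a b \<Longrightarrow> cg (Fil n) (RB a) (RB b)"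
  using RB_Fil[of "a - b"] by (simp add: cg_def RB_diff)

text \<open>The star product of z with b is z b + [R z, b], so this is the recursion defining \<open>RB\<close>.\<close>

lemma RB_star_op: "cg J (RB (star_op z (R z) b)) (gen (R z) * RB b)"
proof (induction b rule: falg_induct)
  case zero
  then show ?case by (simp add: star_op_def RB_def falg.lin_zero cgJ_refl)
next
  case (add a b)
  then show ?case using cgJ_add by (fastforce simp: star_op_add RB_def falg.lin_add distrib_left)
next
  case (word c w)
  let ?y = "R z"
  have "star_op z ?y (scal c (word w)) = scal c (word (z # w) + (gen ?y * word w - word w * gen ?y))"
    by (simp add: star_op_def scal_mult_left scal_mult_right word_Cons[of z w]
        falg.scale_right_distrib falg.scale_right_diff_distrib)
  also have "cg J \<dots> (scal c (word (z # w) + der br ?y word w))"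
    by (intro cgJ_scale cgJ_add cgJ_refl cgJ_sym[OF der_word])
  finally have "cg J (RB (star_op z ?y (scal c (word w)))) (RB (scal c (word (z # w) + der br ?y word w)))"
    by (rule RB_cgJ)
  also have "\<dots> = scal c (rb (z # w) + der br ?y rb w)"
    by (simp add: RB_def falg.lin_scal falg.lin_add falg.lin_word der_def falg.lin_sum)
  also have "\<dots> = gen ?y * RB (scal c (word w))"
    by (simp add: rb_Cons RB_def falg.lin_scal falg.lin_word scal_mult_right)
  finally show ?case .
qed

lemma RB_star_op_power: "cg J (RB ((star_op z (R z) ^^ n) 1)) (gen (R z) ^ n)"
proof (induction n)
  case 0
  have "RB 1 = 1" by (simp add: RB_def word_Nil[symmetric] falg.lin_word rb_Nil[folded word_Nil])
  then show ?case by (simp add: cgJ_refl)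
next
  case (Suc n)
  have "cg J (RB ((star_op z (R z) ^^ Suc n) 1)) (gen (R z) * RB ((star_op z (R z) ^^ n) 1))"
    by (simp add: RB_star_op)
  also have "cg J \<dots> (gen (R z) ^ Suc n)"
    unfolding power_Suc by (intro cgJ_mult cgJ_refl Suc)
  finally show ?case .
qed

lemma RB_star_exp: "cg J (RB (star_exp_trunc N z (R z))) (exp_trunc N (R z))"
  unfolding star_exp_trunc_def exp_trunc_def RB_def falg.lin_sum falg.lin_scal
  by (intro cgJ_sum cgJ_scale RB_star_op_power[unfolded RB_def])

section \<open>The star product\<close>

definition star :: "('g, 'k) falg \<Rightarrow> ('g, 'k) falg \<Rightarrow> ('g, 'k) falg" where
  "star a b = lin scal (conv (*) (conv (*) word rb) (\<lambda>v. b * anti (rb v))) a"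

lemma coef_star: "coef (star a b) = fa_star R br (coef a) (coef b)"
  by (simp add: star_def lin_def fa_star_def star_word_def sum_colourings[symmetric] coef_sum coef_scal
      coef_mult coef_word coef_rb coef_anti)

text \<open>This allows a change of representative in the first argument of \<open>star\<close>. The
  three convolution factors respect the relators and add degrees, with \<open>b\<close> counted in
  degree 0.\<close>

lemma star_Fil: assumes "a \<in> Fil n" shows "star a b \<in> Fil n"
  unfolding star_def
proof (rule Fil_lin[OF falg.module_axioms Fil_subspace _ _ assms])
  let ?f = "conv (*) (conv (*) word rb) (\<lambda>v. b * anti (rb v))"
  note J_mult = two_sided_mult[OF J_two_sided]
  have "respecting smul br scal J n (\<lambda>v. b * anti (rb v))" for n
    unfolding respecting_def
    using respectingD[OF rb_respecting order.refl, THEN anti_J, THEN J_mult(2), of b]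
    by (simp add: right_diff_distrib anti_diff anti_scal scal_mult_right)
  then have "respecting smul br scal J n ?f" for n
    by (intro falg.conv_respecting J_subspace J_mult word_respecting rb_respecting)
  then show "lin scal ?f a \<in> Fil n" if "a \<in> J" for a
    using that by (intro J_Fil J_lin falg.module_axioms J_subspace)
  have anti_Fil: "anti a \<in> Fil n" if "a \<in> Fil n" for a n
    unfolding lin_anti[of a]
  proof (rule Fil_lin[OF falg.module_axioms Fil_subspace _ _ that])
    fix w ms assume "weighted F w ms" "n \<le> sum_list ms"
    then have "word (rev w) \<in> Fil n"
      by (intro Fil_word[of "rev w" "rev ms"]) (simp_all add: weighted_def list_all2_rev sum_list_rev)
    then show "anti (word w) \<in> Fil n"
      unfolding anti_word by (intro falg.subspace_scale Fil_subspace)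
  qed (simp add: lin_anti[symmetric] anti_J J_Fil)
  have Fil_add: "x \<in> Fil n \<Longrightarrow> y \<in> Fil n \<Longrightarrow> x + y \<in> Fil n" for n x y
    by (rule falg.subspace_add[OF Fil_subspace])
  have "graded_by F Fil 0 (\<lambda>v. b * anti (rb v))"
    unfolding graded_by_def
    using Fil_mult[OF Fil_0 anti_Fil[OF graded_byD[OF rb_graded]]] by simp
  moreover have "graded_by F Fil 0 word" by (simp add: graded_by_def Fil_word)
  ultimately have "graded_by F Fil (0 + 0 + 0) ?f"
    by (intro graded_by_conv rb_graded Fil_add Fil_mult)
  then show "?f w \<in> Fil n" if "weighted F w ms" "n \<le> sum_list ms" for w ms
    using graded_byD[OF _ that(1), of Fil 0 ?f] Fil_mono[OF that(2)] by simp
qed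

text \<open>A letter is primitive, so the Sweedler sum has three terms; the antipode gives the sign
  of the last.\<close>

lemma star_gen: "star (gen z) b = star_op z (R z) b"
proof -
  have "rb [z] = gen (R z)" by (simp add: rb_Cons rb_Nil der_Nil)
  moreover have "anti (1 :: ('g, 'k) falg) = 1" "anti (gen y :: ('g, 'k) falg) = - gen y" for y
    using anti_word[of "[] :: 'g list", where 'b = 'k] by (simp_all add: anti_word word_Nil)
  ultimately show ?thesis
    by (simp add: star_def falg.lin_word star_op_def rb_Nil word_Nil algebra_simps)
qed

lemma star_cg:
  assumes "cg (Fil n) a (gen z)" "cg (Fil n) b b'"
  shows "cg (Fil n) (star a b) (star_op z (R z) b')"
proof -
  have "star a b - star (gen z) b = star (a - gen z) b"
    by (simp add: star_def falg.lin_diff)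
  then have "cg (Fil n) (star a b) (star_op z (R z) b)"
    using star_Fil[of "a - gen z" n b] assms(1) by (simp add: cg_def star_gen)
  then show ?thesis using star_op_cg[OF cgF_refl cgF_refl assms(2)] by (rule cgF_trans)
qed

end

section \<open>Logarithms modulo the filtration\<close>

context filtered_lie
begin

lemma star_op_Fil:
  assumes "1 \<le> k" "z \<in> F k" "y \<in> F k" "b \<in> Fil j" shows "star_op z y b \<in> Fil (k + j)"
proof -
  have "b * gen y \<in> Fil (k + j)"
    using Fil_mult[OF assms(4) Fil_gen[OF assms(1,3)]] by (simp add: add.commute)
  moreover have "gen z * b \<in> Fil (k + j)" "gen y * b \<in> Fil (k + j)"
    using assms by (simp_all add: Fil_mult Fil_gen)
  ultimately show ?thesis
    unfolding star_op_def by (intro falg.subspace_add falg.subspace_diff Fil_subspace)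
qed

lemma star_op_power_Fil: "(star_op z y ^^ n) 1 \<in> Fil n"
proof (induction n)
  case (Suc n)
  then show ?case using star_op_Fil[of 1 z y _ n] by (simp add: F_1)
qed (simp add: Fil_0)

lemma star_op_perturb: "cg J (star_op (z + d) (y + e) b) (star_op z y b + star_op d e b)"
proof -
  have "cg J (star_op (z + d) (y + e) b) ((gen z + gen d) * b + (gen y + gen e) * b - b * (gen y + gen e))"
    unfolding star_op_def by (intro cgJ_add cgJ_diff cgJ_mult cgJ_refl cgJ_gen_add)
  also have "\<dots> = star_op z y b + star_op d e b"
    by (simp add: star_op_def algebra_simps)
  finally show ?thesis .
qed

text \<open>A term of the expansion that involves the perturbation has one factor of degree
  \<open>k\<close> and \<open>n\<close> further factors of degree at least 1.\<close>

lemma star_op_power_perturb: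
  assumes "1 \<le> k" "d \<in> F k" "e \<in> F k"
  shows "cg (Fil (k + n)) ((star_op (z + d) (y + e) ^^ Suc n) 1) ((star_op z y ^^ Suc n) 1)"
proof (induction n)
  case 0
  have "cg (Fil k) (star_op (z + d) (y + e) 1) (star_op z y 1 + star_op d e 1)"
    by (intro cgJ_cgF star_op_perturb)
  also have "cg (Fil k) \<dots> (star_op z y 1)"
    using star_op_Fil[OF assms Fil_0, of 1] by (intro falg.cg_add_mem Fil_subspace) simp
  finally show ?case by simp
next
  case (Suc n)
  let ?A' = "(star_op (z + d) (y + e) ^^ Suc n) 1" and ?A = "(star_op z y ^^ Suc n) 1"
  have 1: "star_op (z + d) (y + e) (?A' - ?A) \<in> Fil (k + Suc n)"
    using star_op_Fil[of 1 "z + d" "y + e" "?A' - ?A" "k + n"] Suc by (simp add: cg_def F_1)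
  have "star_op d e ?A \<in> Fil (k + Suc n)"
    by (rule star_op_Fil[OF assms star_op_power_Fil])
  then have 2: "cg (Fil (k + Suc n)) (star_op z y ?A + star_op d e ?A) (star_op z y ?A)"
    by (rule falg.cg_add_mem[OF Fil_subspace])
  have "cg (Fil (k + Suc n)) (star_op (z + d) (y + e) ?A') (star_op (z + d) (y + e) ?A)"
    using 1 by (simp only: cg_def star_op_diff)
  also have "cg (Fil (k + Suc n)) \<dots> (star_op z y ?A)"
    by (rule cgF_trans[OF cgJ_cgF[OF star_op_perturb] 2])
  finally show ?case by simp
qed

text \<open>Terms of order at least 2 do not change modulo step k + 1, and the linear term changes
  by \<open>d\<close>. The bound on \<open>N\<close> keeps the linear term in the
  truncation.\<close>

lemma star_exp_perturb:
  assumes k: "1 \<le> k" "d \<in> F k" "e \<in> F k" and N: "2 \<le> N"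
  shows "cg (Fil (Suc k)) (star_exp_trunc N (z + d) (y + e)) (star_exp_trunc N z y + gen d)"
proof -
  obtain M where M: "N = Suc (Suc M)" using N by (metis Suc_le_D numeral_2_eq_2 Suc_le_mono)
  let ?a = "\<lambda>n. inverse (fact n) :: 'k"
  define T where "T z y = (\<Sum>n<M. scal (?a (Suc (Suc n))) ((star_op z y ^^ Suc (Suc n)) 1))" for z y :: 'g
  have expand: "star_exp_trunc N z y = 1 + gen z + T z y" for z y
    unfolding star_exp_trunc_def M T_def
    by (simp add: sum.lessThan_Suc_shift star_op_def add.assoc del: sum.lessThan_Suc funpow.simps(2))
      (simp add: star_op_def)
  have "cg (Fil (Suc k)) (T (z + d) (y + e)) (T z y)"
    unfolding T_def
  proof (intro cgF_sum cgF_scale)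
    fix n
    show "cg (Fil (Suc k)) ((star_op (z + d) (y + e) ^^ Suc (Suc n)) 1) ((star_op z y ^^ Suc (Suc n)) 1)"
      using star_op_power_perturb[OF k, of "Suc n" z y] Fil_mono[of "Suc k" "k + Suc n"]
      by (simp add: cg_def del: funpow.simps(2))
  qed
  then have "cg (Fil (Suc k)) (1 + gen (z + d) + T (z + d) (y + e)) (1 + (gen z + gen d) + T z y)"
    by (intro cgF_add cgF_refl cgJ_cgF[OF cgJ_gen_add])
  then show ?thesis by (simp add: expand add_ac)
qed

lemma star_exp_1: assumes "1 \<le> N" shows "cg (Fil 1) (star_exp_trunc N z y) 1"
proof -
  obtain M where M: "N = Suc M" using assms by (cases N) auto
  have "scal (inverse (fact (Suc n))) ((star_op z y ^^ Suc n) 1) \<in> Fil 1" for n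
    using star_op_power_Fil[of "Suc n" z y] Fil_mono[of 1 "Suc n"]
    by (intro falg.subspace_scale Fil_subspace) auto
  then have "(\<Sum>n<M. scal (inverse (fact (Suc n))) ((star_op z y ^^ Suc n) 1)) \<in> Fil 1"
    by (intro falg.subspace_sum Fil_subspace)
  then show ?thesis
    unfolding star_exp_trunc_def M
    by (simp add: sum.lessThan_Suc_shift cg_def del: sum.lessThan_Suc funpow.simps(2) fact_Suc)
qed

lemma star_exp_Suc: "cg (Fil n) (star_exp_trunc (Suc n) z y) (star_exp_trunc n z y)"
  unfolding star_exp_trunc_def sum.lessThan_Suc
  by (intro falg.cg_add_mem Fil_subspace falg.subspace_scale star_op_power_Fil)

text \<open>Ordinary exponentials become the case of the zero operator, so perturbation and
  injectivity are proved once for both.\<close>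

lemma exp_star_exp: "cg J (exp_trunc N c) (star_exp_trunc N c 0)"
proof -
  have "cg J (gen c ^ n) ((star_op c 0 ^^ n) 1)" for n
  proof (induction n)
    case (Suc n)
    let ?A = "(star_op c 0 ^^ n) 1"
    have 0: "cg J (gen 0) 0" by (simp add: cg_def gen_0_J)
    have "cg J (star_op c 0 ?A) (gen c * ?A + 0 * ?A - ?A * 0)"
      unfolding star_op_def by (intro cgJ_add cgJ_diff cgJ_mult cgJ_refl 0)
    then have "cg J (gen c * ?A) (star_op c 0 ?A)" by (simp add: cgJ_sym)
    then show ?case
      unfolding power_Suc funpow.simps comp_apply
      by (rule cgJ_trans[OF cgJ_mult[OF cgJ_refl Suc]])
  qed (simp add: cgJ_refl)
  then show ?thesis unfolding exp_trunc_def star_exp_trunc_def by (intro cgJ_sum cgJ_scale)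
qed

lemmas exp_star_expF = cgJ_cgF[OF exp_star_exp]

lemma exp_trunc_perturb:
  assumes k: "1 \<le> k" "d \<in> F k" and N: "2 \<le> N"
  shows "cg (Fil (Suc k)) (exp_trunc N (c + d)) (exp_trunc N c + gen d)"
proof -
  have "cg (Fil (Suc k)) (exp_trunc N (c + d)) (star_exp_trunc N (c + d) (0 + 0))"
    using exp_star_expF by simp
  also have "cg (Fil (Suc k)) \<dots> (star_exp_trunc N c 0 + gen d)"
    using k by (intro star_exp_perturb N) (simp_all add: g.subspace_0[OF F_subspace])
  also have "cg (Fil (Suc k)) \<dots> (exp_trunc N c + gen d)"
    by (intro cgF_add cgF_refl cgF_sym[OF exp_star_expF])
  finally show ?thesis .
qed

lemma exp_trunc_Suc: "cg (Fil n) (exp_trunc (Suc n) c) (exp_trunc n c)"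
  by (rule cgF_trans[OF exp_star_expF cgF_trans[OF star_exp_Suc cgF_sym[OF exp_star_expF]]])

lemma gen_cg: assumes "1 \<le> n" "a - b \<in> F n" shows "cg (Fil n) (gen a) (gen b)"
proof -
  have "cg (Fil n) (gen ((a - b) + b)) (gen (a - b) + gen b)" by (intro cgJ_cgF cgJ_gen_add)
  also have "\<dots> = gen b + gen (a - b)" by (simp add: add.commute)
  also have "cg (Fil n) \<dots> (gen b)"
    by (intro falg.cg_add_mem Fil_subspace Fil_gen assms)
  finally show ?thesis by simp
qed

lemma exp_trunc_cg: "1 \<le> n \<Longrightarrow> a - b \<in> F n \<Longrightarrow> cg (Fil n) (exp_trunc N a) (exp_trunc N b)"
  unfolding exp_trunc_def by (intro cgF_sum cgF_scale cgF_power gen_cg)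

context
  fixes R :: "'g \<Rightarrow> 'g"
  assumes R_additive: "\<And>x y. R (x + y) = R x + R y"
    and R_filtered: "\<And>n x. 1 \<le> n \<Longrightarrow> x \<in> F n \<Longrightarrow> R x \<in> F n"
begin

lemma R_diff: "R (x - y) = R x - R y"
  using R_additive[of "x - y" y] by simp

lemma star_exp_cg:
  assumes "1 \<le> n" "a - b \<in> F n"
  shows "cg (Fil n) (star_exp_trunc N a (R a)) (star_exp_trunc N b (R b))"
proof -
  have gen: "cg (Fil n) (gen a) (gen b)" "cg (Fil n) (gen (R a)) (gen (R b))"
    using assms R_filtered by (auto intro!: gen_cg simp: R_diff[symmetric])
  have "cg (Fil n) ((star_op a (R a) ^^ j) 1) ((star_op b (R b) ^^ j) 1)" for j
  proof (induction j)
    case (Suc j)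
    then show ?case unfolding funpow.simps comp_apply by (intro star_op_cg gen)
  qed (simp add: cgF_refl)
  then show ?thesis unfolding star_exp_trunc_def by (intro cgF_sum cgF_scale)
qed

text \<open>The difference moves up one step of the filtration at a time: its class is visible in
  the star exponentials by \<open>star_exp_perturb\<close>, and \<open>gen_Fil_imp_F\<close> brings
  it back to g.\<close>

lemma star_exp_inj:
  assumes eq: "cg (Fil m) (star_exp_trunc N z (R z)) (star_exp_trunc N z' (R z'))"
    and m: "1 \<le> m" "m \<le> N"
  shows "z - z' \<in> F m"
proof -
  have "z - z' \<in> F k" if "1 \<le> k" "k \<le> m" for k
    using that
  proof (induction k rule: nat_induct_at_least)
    case base
    show ?case by (simp add: F_1)
  next
    case (Suc k)
    let ?d = "z - z'"
    have d: "?d \<in> F k" using Suc by simp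
    have "cg (Fil (Suc k)) (star_exp_trunc N (z' + ?d) (R z' + R ?d)) (star_exp_trunc N z' (R z') + gen ?d)"
      using Suc m by (intro star_exp_perturb d R_filtered) auto
    moreover have "cg (Fil (Suc k)) (star_exp_trunc N z (R z)) (star_exp_trunc N z' (R z'))"
      using eq Fil_mono[OF Suc.prems] by (simp add: cg_def)
    moreover have "z' + ?d = z" "R z' + R ?d = R z" by (simp_all add: R_additive[symmetric])
    ultimately have "cg (Fil (Suc k)) (star_exp_trunc N z' (R z') + gen ?d) (star_exp_trunc N z' (R z'))"
      by (metis cgF_trans cgF_sym)
    then have "gen ?d \<in> Fil (Suc k)" by (simp add: cg_def)
    then show ?case by (intro gen_Fil_imp_F) auto
  qed
  then show ?thesis using m by simp
qed

end

lemma exp_trunc_inj: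
  assumes "cg (Fil m) (exp_trunc N c) (exp_trunc N c')" "1 \<le> m" "m \<le> N"
  shows "c - c' \<in> F m"
proof -
  have "cg (Fil m) (star_exp_trunc N c 0) (star_exp_trunc N c' 0)"
    by (rule cgF_trans[OF cgF_sym[OF exp_star_expF] cgF_trans[OF assms(1) exp_star_expF]])
  then show ?thesis
    using star_exp_inj[of "\<lambda>_. 0"] assms(2,3) by (simp add: g.subspace_0[OF F_subspace])
qed

lemma star_exp_surj:
  fixes R :: "'g \<Rightarrow> 'g"
  assumes R_additive: "\<And>x y. R (x + y) = R x + R y"
    and R_filtered: "\<And>n x. 1 \<le> n \<Longrightarrow> x \<in> F n \<Longrightarrow> R x \<in> F n"
    and N: "1 \<le> N"
  shows "\<exists>z. cg (Fil N) (star_exp_trunc N z (R z)) (exp_trunc N x)"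
proof -
  have "\<exists>z. cg (Fil k) (star_exp_trunc N z (R z)) (exp_trunc N x)" if "1 \<le> k" "k \<le> N" for k
    using that
  proof (induction k rule: nat_induct_at_least)
    case base
    have "cg (Fil 1) (star_exp_trunc N 0 (R 0)) (exp_trunc N x)"
      by (rule cgF_trans[OF star_exp_1[OF N] cgF_sym[OF cgF_trans[OF exp_star_expF star_exp_1[OF N]]]])
    then show ?case by blast
  next
    case (Suc k)
    then obtain z where z: "cg (Fil k) (star_exp_trunc N z (R z)) (exp_trunc N x)" by auto
    \<comment> \<open>The current star exponential has a logarithm in g, valid modulo the final step
      \<open>N\<close>, so its distance from \<open>x\<close> can be measured in g.\<close>
    obtain c where c: "cg (Fil N) (star_exp_trunc N z (R z)) (exp_trunc N c)"
      using star_exp_is_exp by blast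
    have c_le: "cg (Fil i) (star_exp_trunc N z (R z)) (exp_trunc N c)" if "i \<le> N" for i
      using c Fil_mono[OF that] by (simp add: cg_def)
    have "cg (Fil k) (exp_trunc N x) (exp_trunc N c)"
      by (rule cgF_trans[OF cgF_sym[OF z] c_le]) (use Suc in simp)
    then have d: "x - c \<in> F k" by (rule exp_trunc_inj) (use Suc in simp_all)
    have N2: "2 \<le> N" using Suc by simp
    \<comment> \<open>Adding \<open>x - c\<close> to \<open>z\<close> and to \<open>c\<close>
      changes both exponentials by \<open>gen (x - c)\<close> modulo the next step.\<close>
    have "cg (Fil (Suc k)) (star_exp_trunc N (z + (x - c)) (R (z + (x - c))))
        (star_exp_trunc N z (R z) + gen (x - c))"
      unfolding R_additive using Suc by (intro star_exp_perturb d R_filtered N2)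
    also have "cg (Fil (Suc k)) \<dots> (exp_trunc N c + gen (x - c))"
      by (intro cgF_add cgF_refl c_le Suc.prems)
    also have "cg (Fil (Suc k)) \<dots> (exp_trunc N (c + (x - c)))"
      using Suc by (intro cgF_sym[OF exp_trunc_perturb] d N2)
    finally show ?case by auto
  qed
  then show ?thesis using N by simp
qed

section \<open>Passage to the completions\<close>

abbreviation fcos :: "nat \<Rightarrow> ('g, 'k) falg \<Rightarrow> ('g, 'k) fa set" where
  "fcos n a \<equiv> fcoset smul br F n (coef a)"

lemma mem_fcos: "p \<in> fcos n a \<longleftrightarrow> (\<exists>b. p = coef b \<and> cg (Fil n) b a)"
proof
  assume p: "p \<in> fcos n a"
  then have "p = coef (Abs_falg p)" by (simp add: fcoset_def Abs_falg_inverse)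
  then obtain b where "p = coef b" by blast
  then show "\<exists>b. p = coef b \<and> cg (Fil n) b a"
    using p by (auto simp: fcoset_def cg_def Fil_def coef_diff)
qed (auto simp: fcoset_def cg_def Fil_def coef_diff coef)

lemma fcos_eq_iff: "fcos n a = fcos n b \<longleftrightarrow> cg (Fil n) a b"
proof
  assume "fcos n a = fcos n b"
  moreover have "coef a \<in> fcos n a" using mem_fcos cgF_refl by blast
  ultimately obtain a' where "coef a = coef a'" "cg (Fil n) a' b" using mem_fcos by blast
  then show "cg (Fil n) a b" by (simp add: coef_inject)
next
  assume "cg (Fil n) a b"
  then have "cg (Fil n) c a \<longleftrightarrow> cg (Fil n) c b" for c
    using cgF_trans[of n c a b] cgF_trans[of n c b a] cgF_sym[of n a b] by blast
  then show "fcos n a = fcos n b" by (auto simp: mem_fcos)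
qed

lemma urep_fcos:
  assumes "c n = fcos n a" obtains b where "urep c n = coef b" "cg (Fil n) b a"
proof -
  have "coef a \<in> c n" unfolding assms mem_fcos using cgF_refl by blast
  then have "urep c n \<in> fcos n a" unfolding urep_def assms[symmetric] by (auto simp: some_in_eq)
  then show ?thesis using that mem_fcos by blast
qed

lemma ghat_emb_fcos: "ghat_emb smul br F c n = fcos n (gen (grep c n))"
  by (simp add: ghat_emb_def coef_gen)

lemma uhat_exp_emb:
  "uhat_exp smul br F (ghat_emb smul br F c) = (\<lambda>n. fcos n (exp_trunc n (grep c n)))"
proof
  fix n
  obtain p where p: "urep (ghat_emb smul br F c) n = coef p" "cg (Fil n) p (gen (grep c n))"
    by (rule urep_fcos[of "ghat_emb smul br F c", OF ghat_emb_fcos])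
  have "uhat_exp smul br F (ghat_emb smul br F c) n = fcos n (\<Sum>j<n. scal (inverse (fact j)) (p ^ j))"
    by (simp add: uhat_exp_def p coef_sum coef_scal coef_power)
  also have "\<dots> = fcos n (exp_trunc n (grep c n))"
    unfolding fcos_eq_iff exp_trunc_def by (intro cgF_sum cgF_scale cgF_power p)
  finally show "uhat_exp smul br F (ghat_emb smul br F c) n = fcos n (exp_trunc n (grep c n))" .
qed

lemma mem_gcoset: "y \<in> gcoset F n x \<longleftrightarrow> y - x \<in> F (Suc n)"
  by (simp add: gcoset_def)

lemma F_trans: "a - b \<in> F (Suc n) \<Longrightarrow> b - c \<in> F (Suc n) \<Longrightarrow> a - c \<in> F (Suc n)"
  using g.subspace_add[OF F_subspace, of "Suc n" "a - b" "b - c"] by simp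

lemma F_sym: "a - b \<in> F (Suc n) \<Longrightarrow> b - a \<in> F (Suc n)"
  using g.subspace_neg[OF F_subspace, of "Suc n" "a - b"] by simp

lemma gcoset_eqI: "a - b \<in> F (Suc n) \<Longrightarrow> gcoset F n a = gcoset F n b"
  unfolding gcoset_def using F_trans[of _ a n b] F_trans[of _ b n a] F_sym[of a b n] by blast

lemma grep_gcoset: assumes "c n = gcoset F n a" shows "grep c n - a \<in> F (Suc n)"
proof -
  have "a \<in> c n" by (simp add: assms mem_gcoset g.subspace_0[OF F_subspace])
  then have "grep c n \<in> c n" unfolding grep_def by (rule someI)
  then show ?thesis by (simp add: assms mem_gcoset)
qed

lemma ghat_gcoset: assumes "c \<in> ghat F" shows "c n = gcoset F n (grep c n)"
proof -
  have "\<exists>a. c n = gcoset F n a" using assms by (simp add: ghat_def)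
  then obtain a where a: "c n = gcoset F n a" by blast
  then show ?thesis using gcoset_eqI[OF F_sym[OF grep_gcoset[of c n a, OF a]]] by simp
qed

lemma grep_Suc: assumes "c \<in> ghat F" shows "grep c (Suc n) - grep c n \<in> F (Suc n)"
proof -
  have "grep c (Suc n) \<in> c (Suc n)"
    by (subst ghat_gcoset[OF assms]) (simp add: mem_gcoset g.subspace_0[OF F_subspace])
  then have "grep c (Suc n) \<in> c n" using assms by (auto simp: ghat_def)
  then show ?thesis by (subst (asm) ghat_gcoset[OF assms]) (simp add: mem_gcoset)
qed

lemma ghatI:
  assumes "\<And>n. Z (Suc n) - Z n \<in> F (Suc n)" shows "(\<lambda>n. gcoset F n (Z n)) \<in> ghat F"
  unfolding ghat_def
proof (intro CollectI conjI allI subsetI)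
  fix n y assume "y \<in> gcoset F (Suc n) (Z (Suc n))"
  then have "y - Z (Suc n) \<in> F (Suc n)" by (simp add: mem_gcoset F_Suc)
  then show "y \<in> gcoset F n (Z n)" unfolding mem_gcoset by (rule F_trans[OF _ assms])
qed blast

text \<open>Component \<open>n\<close> of the completion of g is a class modulo
  \<open>F (n + 1)\<close>, whereas exponentials are compared modulo step \<open>n\<close>.
  Coherence passes from index n + 1 down to \<open>n\<close>.\<close>

lemma ghat_eqI:
  assumes c: "c \<in> ghat F" "c' \<in> ghat F" and eq: "\<And>n. 1 \<le> n \<Longrightarrow> grep c n - grep c' n \<in> F n"
  shows "c = c'"
proof
  fix n
  have "grep c n - grep c' n \<in> F (Suc n)"
    by (rule F_trans[OF F_sym[OF grep_Suc[OF c(1)]] F_trans[OF eq[of "Suc n"] grep_Suc[OF c(2)]]]) simp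
  from gcoset_eqI[OF this] show "c n = c' n"
    using ghat_gcoset[OF c(1), of n] ghat_gcoset[OF c(2), of n] by metis
qed

lemma ghat_log_eqI:
  assumes c: "c \<in> ghat F" and y: "uhat_exp smul br F (ghat_emb smul br F c) = y"
  shows "ghat_log smul br F y = c"
  unfolding ghat_log_def
proof (rule the_equality)
  fix z assume z: "z \<in> ghat F \<and> uhat_exp smul br F (ghat_emb smul br F z) = y"
  then have "cg (Fil n) (exp_trunc n (grep z n)) (exp_trunc n (grep c n))" for n
    using y unfolding uhat_exp_emb fcos_eq_iff[symmetric] by metis
  then show "z = c" using z c by (intro ghat_eqI exp_trunc_inj) auto
qed (use assms in simp)

end

section \<open>Exponentials in the completions and the Magnus expansion\<close>

context rota_baxter_lie
begin

lemma uhat_RB_exp: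
  "uhat_RB smul br F R (uhat_exp smul br F (ghat_emb smul br F c))
    = (\<lambda>n. fcos n (RB (exp_trunc n (grep c n))))"
proof
  fix n
  let ?e = "uhat_exp smul br F (ghat_emb smul br F c)"
  obtain p where p: "urep ?e n = coef p" "cg (Fil n) p (exp_trunc n (grep c n))"
    by (rule urep_fcos[of ?e n "exp_trunc n (grep c n)"]) (simp_all add: uhat_exp_emb)
  show "uhat_RB smul br F R ?e n = fcos n (RB (exp_trunc n (grep c n)))"
    unfolding uhat_RB_def p(1) coef_RB[symmetric] fcos_eq_iff by (rule RB_cgF[OF p(2)])
qed

lemma fa_star_pow_coef: "fa_star_pow R br (coef p) j = coef ((star p ^^ j) 1)"
  by (induction j) (simp_all add: coef_one coef_star)

lemma uhat_exp_star_emb: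
  "uhat_exp_star smul br F R (ghat_emb smul br F c)
    = (\<lambda>n. fcos n (star_exp_trunc n (grep c n) (R (grep c n))))"
proof
  fix n
  let ?z = "grep c n"
  obtain p where p: "urep (ghat_emb smul br F c) n = coef p" "cg (Fil n) p (gen ?z)"
    by (rule urep_fcos[of "ghat_emb smul br F c", OF ghat_emb_fcos])
  have "cg (Fil n) ((star p ^^ j) 1) ((star_op ?z (R ?z) ^^ j) 1)" for j
    by (induction j) (auto intro: star_cg p simp: cgF_refl)
  then have "fcos n (\<Sum>j<n. scal (inverse (fact j)) ((star p ^^ j) 1)) = fcos n (star_exp_trunc n ?z (R ?z))"
    unfolding fcos_eq_iff star_exp_trunc_def by (intro cgF_sum cgF_scale)
  then show "uhat_exp_star smul br F R (ghat_emb smul br F c) n = fcos n (star_exp_trunc n ?z (R ?z))"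
    by (simp add: uhat_exp_star_def p fa_star_pow_coef coef_sum coef_scal)
qed

text \<open>\<open>ghat_log_star\<close> is a definite description, so \<open>magnus\<close> can be
  unfolded only once existence and uniqueness hold at exp x.\<close>

lemma magnus_ex1:
  assumes x: "x \<in> ghat F"
  shows "\<exists>!z. z \<in> ghat F
    \<and> uhat_exp_star smul br F R (ghat_emb smul br F z) = uhat_exp smul br F (ghat_emb smul br F x)"
proof -
  have eq_iff: "uhat_exp_star smul br F R (ghat_emb smul br F z) = uhat_exp smul br F (ghat_emb smul br F x)
    \<longleftrightarrow> (\<forall>n. cg (Fil n) (star_exp_trunc n (grep z n) (R (grep z n))) (exp_trunc n (grep x n)))" for z
    by (simp add: uhat_exp_star_emb uhat_exp_emb fun_eq_iff fcos_eq_iff)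
  \<comment> \<open>The choice is made at level n + 1 because component \<open>n\<close> of the
    result is a class modulo \<open>F (n + 1)\<close>.\<close>
  have "\<exists>z. cg (Fil (Suc n)) (star_exp_trunc (Suc n) z (R z)) (exp_trunc (Suc n) (grep x (Suc n)))" for n
    by (intro star_exp_surj R_add R_F) auto
  then obtain Z where
    Z: "\<And>n. cg (Fil (Suc n)) (star_exp_trunc (Suc n) (Z n) (R (Z n))) (exp_trunc (Suc n) (grep x (Suc n)))"
    by metis
  have Z': "cg (Fil n) (star_exp_trunc n (Z n) (R (Z n))) (exp_trunc n (grep x n))" for n
  proof (cases "n = 0")
    case False
    have "cg (Fil n) (star_exp_trunc n (Z n) (R (Z n))) (star_exp_trunc (Suc n) (Z n) (R (Z n)))"
      by (rule cgF_sym[OF star_exp_Suc])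
    also have "cg (Fil n) \<dots> (exp_trunc (Suc n) (grep x (Suc n)))"
      using Z[of n] Fil_mono[of n "Suc n"] by (simp add: cg_def)
    also have "cg (Fil n) \<dots> (exp_trunc n (grep x (Suc n)))"
      by (rule exp_trunc_Suc)
    also have "cg (Fil n) \<dots> (exp_trunc n (grep x n))"
      using False F_Suc[OF _ grep_Suc[OF x]] by (intro exp_trunc_cg) auto
    finally show ?thesis .
  qed (simp add: cg_def Fil_0)
  \<comment> \<open>The choices at different levels are independent of each other; injectivity makes
    them coherent.\<close>
  have "Z (Suc n) - Z n \<in> F (Suc n)" for n
  proof (rule star_exp_inj[of R])
    show "cg (Fil (Suc n)) (star_exp_trunc (Suc n) (Z (Suc n)) (R (Z (Suc n))))
        (star_exp_trunc (Suc n) (Z n) (R (Z n)))"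
      by (rule cgF_trans[OF Z' cgF_sym[OF Z]])
  qed (auto simp: R_add R_F)
  then have c: "(\<lambda>n. gcoset F n (Z n)) \<in> ghat F" (is "?c \<in> _") by (rule ghatI)
  show ?thesis
  proof (rule ex1I[of _ ?c])
    have "cg (Fil n) (star_exp_trunc n (grep ?c n) (R (grep ?c n))) (exp_trunc n (grep x n))" for n
    proof (cases "n = 0")
      case False
      have "grep ?c n - Z n \<in> F n"
        using False grep_gcoset[of ?c n "Z n"] F_Suc[of n] by simp
      then show ?thesis
        using False by (intro cgF_trans[OF star_exp_cg[of R] Z'] R_add R_F) auto
    qed (simp add: cg_def Fil_0)
    then show "?c \<in> ghat F \<and> uhat_exp_star smul br F R (ghat_emb smul br F ?c)
        = uhat_exp smul br F (ghat_emb smul br F x)"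
      using c eq_iff by blast
  next
    fix z
    assume z: "z \<in> ghat F \<and> uhat_exp_star smul br F R (ghat_emb smul br F z)
        = uhat_exp smul br F (ghat_emb smul br F x)"
    show "z = ?c"
    proof (rule ghat_eqI)
      fix n :: nat assume n: "1 \<le> n"
      have "cg (Fil n) (star_exp_trunc n (grep z n) (R (grep z n))) (exp_trunc n (grep x n))"
        using z eq_iff by blast
      then have "grep z n - Z n \<in> F n"
        by (intro star_exp_inj[of R n n] cgF_trans[OF _ cgF_sym[OF Z']]) (use n in \<open>auto simp: R_add R_F\<close>)
      moreover have "Z n - grep ?c n \<in> F n"
        using n F_sym[OF grep_gcoset[of ?c n "Z n"]] F_Suc[of n] by simp
      ultimately show "grep z n - grep ?c n \<in> F n"
        using g.subspace_add[OF F_subspace[OF n], of "grep z n - Z n" "Z n - grep ?c n"] by simp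
    qed (use z c in auto)
  qed
qed

theorem frakR_magnus:
  assumes x: "x \<in> ghat F"
  shows "frakR smul br F R x = ghat_R F R (magnus smul br F R x)"
proof -
  define z where "z = magnus smul br F R x"
  have "z \<in> ghat F \<and> uhat_exp_star smul br F R (ghat_emb smul br F z) = uhat_exp smul br F (ghat_emb smul br F x)"
    unfolding z_def magnus_def ghat_log_star_def by (rule theI'[OF magnus_ex1[OF x]])
  then have z: "z \<in> ghat F"
    and z_exp: "cg (Fil n) (star_exp_trunc n (grep z n) (R (grep z n))) (exp_trunc n (grep x n))" for n
    by (auto simp: uhat_exp_star_emb uhat_exp_emb fun_eq_iff fcos_eq_iff)
  have R_diff: "R a - R b = R (a - b)" for a b using R_add[of "a - b" b] by simp
  have Rz: "ghat_R F R z \<in> ghat F"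
    unfolding ghat_R_def by (intro ghatI) (simp add: R_diff R_F grep_Suc[OF z])
  have "cg (Fil n) (exp_trunc n (grep (ghat_R F R z) n)) (RB (exp_trunc n (grep x n)))" for n
  proof (cases "n = 0")
    case False
    have "grep (ghat_R F R z) n - R (grep z n) \<in> F n"
      using False grep_gcoset[of "ghat_R F R z" n "R (grep z n)"] F_Suc[of n] by (simp add: ghat_R_def)
    then have "cg (Fil n) (exp_trunc n (grep (ghat_R F R z) n)) (exp_trunc n (R (grep z n)))"
      using False by (intro exp_trunc_cg) auto
    also have "cg (Fil n) \<dots> (RB (star_exp_trunc n (grep z n) (R (grep z n))))"
      by (rule cgF_sym[OF cgJ_cgF[OF RB_star_exp]])
    also have "cg (Fil n) \<dots> (RB (exp_trunc n (grep x n)))"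
      by (rule RB_cgF[OF z_exp])
    finally show ?thesis .
  qed (simp add: cg_def Fil_0)
  then have "uhat_exp smul br F (ghat_emb smul br F (ghat_R F R z))
      = uhat_RB smul br F R (uhat_exp smul br F (ghat_emb smul br F x))"
    unfolding uhat_RB_exp by (intro ext) (simp add: uhat_exp_emb fcos_eq_iff)
  from ghat_log_eqI[OF Rz this] show ?thesis unfolding frakR_def z_def .
qed

end

theorem theorem4p21:
  fixes smul :: "'k::field_char_0 \<Rightarrow> 'g::ab_group_add \<Rightarrow> 'g"
    and br :: "'g \<Rightarrow> 'g \<Rightarrow> 'g"
    and F :: "nat \<Rightarrow> 'g set"
    and R :: "'g \<Rightarrow> 'g"
  assumes "lie_algebra smul br"
    and "lie_filtration smul br F"
    and "rota_baxter smul br R"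
    and "\<forall>n\<ge>1. R ` F n \<subseteq> F n"
  shows "\<forall>x \<in> ghat F. frakR smul br F R x = ghat_R F R (magnus smul br F R x)"
proof -
  interpret rota_baxter_lie smul br F R
    using assms by unfold_locales
  show ?thesis by (blast intro: frakR_magnus)
qed

end
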